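(* The following condition on a homogeneous polynomial $V(x_1,\dots,x_m)\in\mathbb{R}[x_1,\dots,x_m]$ of degree $d$ is algorithmically verifiable: for every $k=0,\dots,d-1$ and every homogeneous differential operator $D\in DOp_{\mathbb{R}}(\mathbb{R}^m)$ of degree $k$, if the polynomial $DV$ is non-zero, then $DV$ takes values of opposite signs. That is, there is an algorithm which, given $m$, $d$ and the coefficients of $V$, decides whether the condition holds. In particular, the condition is algorithmically verifiable when $V=V_{\mathcal{F}}$ is the volume polynomial of the multifan $\mathcal{F}$ of a quasitoric manifold $M^{2n}$ (with $d=n$).
   Context: $DOp_{\mathbb{R}}(\mathbb{R}^m)=\mathbb{R}[\partial_1,\dots,\partial_m]$ is the algebra of differential operators in $m$ variables with constant real coefficients, graded by order. "Algorithm" is understood as a procedure performing finitely many exact arithmetic operations and sign tests on the coefficients of $V$ (so an ordinary Turing algorithm when the coefficients are rational). A quasitoric manifold $M^{2n}=M(P,\Lambda)$ is determined by a simple convex $n$-polytope $P$ with facets $F_1,\dots,F_m$ and an integer $n\times m$ matrix $\Lambda$ whose columns $\lambda_{i_1},\dots,\lambda_{i_n}$ form a basis of $\mathbb{Z}^n$ whenever $F_{i_1}\cap\dots\cap F_{i_n}$ is a vertex; it is the oriented closed manifold $P\times T^n/\sim$, $T^n=\mathbb{R}^n/\mathbb{Z}^n$, where $(p,t)\sim(p,t')$ iff $t-t'$ lies in the subtorus generated by the circles in the directions $\lambda_i$ with $p\in F_i$. With $x_i\in H^2(M^{2n};\mathbb{Z})$ the Poincaré dual of the codimension-2 characteristic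 submanifold lying over $F_i$, the volume polynomial of its multifan $\mathcal{F}$ is $V_{\mathcal{F}}(c_1,\dots,c_m)=\frac1{n!}\langle(c_1x_1+\dots+c_mx_m)^n,[M^{2n}]\rangle$. *)

theory Defs
  imports "HOL-Homology.Simplices" "HOL-Analysis.Finite_Function_Topology"
    "HOL-Analysis.Analysis" "Jordan_Normal_Form.Determinant"
begin

unbundle no vec_syntax
hide_const (open) Determinants.det

section \<open>Polynomials and differential operators with constant coefficients\<close>

text \<open>
  A polynomial in the variables with indices \<open>0, 1, 2, \<dots>\<close> is a finitely supported function on
  exponent vectors, with the convolution ring structure of \<^theory>\<open>HOL-Library.Poly_Mapping\<close>.
  The same type serves for the elements of the algebra of differential operators in the \<open>\<partial>\<^sub>i\<close>.
\<close>

type_synonym mpoly = "(nat \<Rightarrow>\<^sub>0 nat) \<Rightarrow>\<^sub>0 real"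

definition mvar :: "nat \<Rightarrow> mpoly"
  where "mvar i = Poly_Mapping.single (Poly_Mapping.single i 1) 1"

text \<open>The zero polynomial is homogeneous of every degree.\<close>

definition homogeneous :: "nat \<Rightarrow> nat \<Rightarrow> mpoly \<Rightarrow> bool"
  where "homogeneous m d V \<longleftrightarrow>
    (\<forall>\<alpha>\<in>Poly_Mapping.keys V.
       Poly_Mapping.keys \<alpha> \<subseteq> {..<m} \<and> (\<Sum>i<m. Poly_Mapping.lookup \<alpha> i) = d)"

definition mpoly_eval :: "mpoly \<Rightarrow> (nat \<Rightarrow> real) \<Rightarrow> real"
  where "mpoly_eval V x =
    (\<Sum>\<alpha>\<in>Poly_Mapping.keys V.
       Poly_Mapping.lookup V \<alpha> *
       (\<Prod>i\<in>Poly_Mapping.keys \<alpha>. x i ^ Poly_Mapping.lookup \<alpha> i))"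

definition partial :: "nat \<Rightarrow> mpoly \<Rightarrow> mpoly"
  where "partial i V =
    (\<Sum>\<alpha>\<in>Poly_Mapping.keys V.
       Poly_Mapping.single (\<alpha> - Poly_Mapping.single i 1)
         (of_nat (Poly_Mapping.lookup \<alpha> i) * Poly_Mapping.lookup V \<alpha>))"

definition iterated_partial :: "nat \<Rightarrow> (nat \<Rightarrow>\<^sub>0 nat) \<Rightarrow> mpoly \<Rightarrow> mpoly"
  where "iterated_partial m \<alpha> V =
    fold (\<lambda>i. partial i ^^ Poly_Mapping.lookup \<alpha> i) [0..<m] V"

definition apply_dop :: "nat \<Rightarrow> mpoly \<Rightarrow> mpoly \<Rightarrow> mpoly"
  where "apply_dop m D V =
    (\<Sum>\<alpha>\<in>Poly_Mapping.keys D. Poly_Mapping.lookup D \<alpha> *\<^sub>R iterated_partial m \<alpha> V)"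

definition opposite_signs :: "mpoly \<Rightarrow> bool"
  where "opposite_signs W \<longleftrightarrow> (\<exists>x. mpoly_eval W x > 0) \<and> (\<exists>y. mpoly_eval W y < 0)"

definition derivatives_change_sign :: "nat \<Rightarrow> nat \<Rightarrow> mpoly \<Rightarrow> bool"
  where "derivatives_change_sign m d V \<longleftrightarrow>
    (\<forall>k<d. \<forall>D. homogeneous m k D \<longrightarrow> apply_dop m D V \<noteq> 0 \<longrightarrow> opposite_signs (apply_dop m D V))"


section \<open>Algorithms over the reals\<close>

text \<open>
  Algorithms are finite lists of mutually recursive procedures of one argument, operating on binary
  trees whose leaves are exact real numbers or the empty tree.  Their only constants are rational,
  and their only access to a number is by the field operations and the test for positivity; thus they
  are machines in the sense of Blum, Shub and Smale without irrational parameters.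
  The big-step semantics is a partial function (\<open>run_deterministic\<close>): nonterminating computations,
  division by zero and ill-formed operations yield no value.
\<close>

datatype val = Null | Num real | Pair val val

datatype expr =
    Arg
  | Empty
  | Const rat
  | Add expr expr
  | Sub expr expr
  | Mul expr expr
  | Div expr expr
  | IfPos expr expr expr
  | Cons expr expr
  | First expr
  | Second expr
  | IfPair expr expr expr
  | Let expr expr
  | Call nat expr

text \<open>
  In \<open>run \<Delta> e v w\<close>, the procedures are \<open>\<Delta>\<close>, and \<open>e\<close> evaluates to \<open>w\<close> when its argument is \<open>v\<close>.
  \<open>Let e e'\<close> evaluates \<open>e'\<close> with the value of \<open>e\<close> as its argument.
\<close>

inductive run :: "expr list \<Rightarrow> expr \<Rightarrow> val \<Rightarrow> val \<Rightarrow> bool" for \<Delta> where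
  run_Arg: "run \<Delta> Arg v v"
| run_Empty: "run \<Delta> Empty v Null"
| run_Const: "run \<Delta> (Const q) v (Num (of_rat q))"
| run_Add: "run \<Delta> e v (Num a) \<Longrightarrow> run \<Delta> e' v (Num b) \<Longrightarrow> run \<Delta> (Add e e') v (Num (a + b))"
| run_Sub: "run \<Delta> e v (Num a) \<Longrightarrow> run \<Delta> e' v (Num b) \<Longrightarrow> run \<Delta> (Sub e e') v (Num (a - b))"
| run_Mul: "run \<Delta> e v (Num a) \<Longrightarrow> run \<Delta> e' v (Num b) \<Longrightarrow> run \<Delta> (Mul e e') v (Num (a * b))"
| run_Div: "run \<Delta> e v (Num a) \<Longrightarrow> run \<Delta> e' v (Num b) \<Longrightarrow> b \<noteq> 0 \<Longrightarrow>
    run \<Delta> (Div e e') v (Num (a / b))"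
| run_IfPos1: "run \<Delta> e v (Num a) \<Longrightarrow> a > 0 \<Longrightarrow> run \<Delta> e1 v w \<Longrightarrow> run \<Delta> (IfPos e e1 e2) v w"
| run_IfPos2: "run \<Delta> e v (Num a) \<Longrightarrow> \<not> a > 0 \<Longrightarrow> run \<Delta> e2 v w \<Longrightarrow> run \<Delta> (IfPos e e1 e2) v w"
| run_Cons: "run \<Delta> e v a \<Longrightarrow> run \<Delta> e' v b \<Longrightarrow> run \<Delta> (Cons e e') v (Pair a b)"
| run_First: "run \<Delta> e v (Pair a b) \<Longrightarrow> run \<Delta> (First e) v a"
| run_Second: "run \<Delta> e v (Pair a b) \<Longrightarrow> run \<Delta> (Second e) v b"
| run_IfPair1: "run \<Delta> e v (Pair a b) \<Longrightarrow> run \<Delta> e1 v w \<Longrightarrow> run \<Delta> (IfPair e e1 e2) v w"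
| run_IfPair2: "run \<Delta> e v u \<Longrightarrow> (\<And>a b. u \<noteq> Pair a b) \<Longrightarrow> run \<Delta> e2 v w \<Longrightarrow>
    run \<Delta> (IfPair e e1 e2) v w"
| run_Let: "run \<Delta> e v u \<Longrightarrow> run \<Delta> e' u w \<Longrightarrow> run \<Delta> (Let e e') v w"
| run_Call: "run \<Delta> e v u \<Longrightarrow> k < length \<Delta> \<Longrightarrow> run \<Delta> (\<Delta> ! k) u w \<Longrightarrow> run \<Delta> (Call k e) v w"

lemma run_deterministic:
  assumes "run \<Delta> e v w" "run \<Delta> e v w'"
  shows "w' = w"
  using assms
proof (induction arbitrary: w' rule: run.induct)
  case (run_IfPair1 e v a b e1 w e2)
  from run_IfPair1.prems show ?case
    by (cases rule: run.cases) (use run_IfPair1.IH in blast)+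
next
  case (run_IfPair2 e v u e2 w e1)
  from run_IfPair2.prems show ?case
    by (cases rule: run.cases) (use run_IfPair2.IH run_IfPair2.hyps in blast)+
next
  case (run_IfPos1 e v a e1 w e2)
  from run_IfPos1.prems show ?case
    by (cases rule: run.cases) (use run_IfPos1.IH run_IfPos1.hyps in blast)+
next
  case (run_IfPos2 e v a e2 w e1)
  from run_IfPos2.prems show ?case
    by (cases rule: run.cases) (use run_IfPos2.IH run_IfPos2.hyps in blast)+
qed (erule run.cases; blast)+

text \<open>On rational data all computations remain rational.\<close>

fun rational_val :: "val \<Rightarrow> bool" where
  "rational_val Null = True"
| "rational_val (Num a) = (a \<in> \<rat>)"
| "rational_val (Pair a b) = (rational_val a \<and> rational_val b)"

lemma run_rational:
  assumes "run \<Delta> e v w" "rational_val v"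
  shows "rational_val w"
  using assms by (induction rule: run.induct) auto

definition encode_nat :: "nat \<Rightarrow> val"
  where "encode_nat k = Num (of_nat k)"

definition encode_list :: "val list \<Rightarrow> val"
  where "encode_list vs = foldr Pair vs Null"

text \<open>The exponents of the monomials of degree \<open>d\<close> in \<open>m\<close> variables, in lexicographic order.\<close>

fun exponents :: "nat \<Rightarrow> nat \<Rightarrow> nat list list" where
  "exponents 0 d = (if d = 0 then [[]] else [])"
| "exponents (Suc m) d = concat (map (\<lambda>k. map ((#) k) (exponents m (d - k))) [0..<Suc d])"

lemma set_exponents: "set (exponents m d) = {\<alpha>. length \<alpha> = m \<and> sum_list \<alpha> = d}"
proof (induction m arbitrary: d)
  case (Suc m)
  show ?case
  proof (rule equalityI; rule subsetI)
    fix \<alpha> assume "\<alpha> \<in> {\<alpha>. length \<alpha> = Suc m \<and> sum_list \<alpha> = d}"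
    then show "\<alpha> \<in> set (exponents (Suc m) d)"
      by (cases \<alpha>) (auto simp: Suc.IH simp del: upt_Suc intro!: bexI[of _ "hd \<alpha>"])
  qed (auto simp: Suc.IH simp del: upt_Suc)
qed auto

text \<open>
  The input: \<open>m\<close>, \<open>d\<close>, and the list of all coefficients (including the zero ones) in degree \<open>d\<close>,
  each tagged with its exponent vector.
\<close>

definition encode_input :: "nat \<Rightarrow> nat \<Rightarrow> mpoly \<Rightarrow> val"
  where "encode_input m d V =
    Pair (encode_nat m) (Pair (encode_nat d)
      (encode_list
        (map (\<lambda>\<alpha>. Pair (encode_list (map encode_nat \<alpha>))
                       (Num (Poly_Mapping.lookup V (Poly_Mapping.nth \<alpha>))))
             (exponents m d))))"

definition algorithmically_verifiable ::
    "(nat \<times> nat \<times> mpoly) set \<Rightarrow> (nat \<Rightarrow> nat \<Rightarrow> mpoly \<Rightarrow> bool) \<Rightarrow> bool"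
  where "algorithmically_verifiable S C \<longleftrightarrow>
    (\<exists>\<Delta>. \<forall>(m, d, V)\<in>S.
       run \<Delta> (Call 0 Arg) (encode_input m d V) (Num (if C m d V then 1 else 0)))"


section \<open>Singular cochains\<close>

type_synonym ('a, 'r) cochain = "((nat \<Rightarrow> real) \<Rightarrow> 'a) \<Rightarrow> 'r"

definition cochain_eval :: "('a, 'r::comm_ring_1) cochain \<Rightarrow> 'a chain \<Rightarrow> 'r"
  where "cochain_eval \<phi> c = (\<Sum>\<sigma>\<in>Poly_Mapping.keys c. of_int (Poly_Mapping.lookup c \<sigma>) * \<phi> \<sigma>)"

definition cocycle :: "nat \<Rightarrow> 'a topology \<Rightarrow> ('a, 'r::comm_ring_1) cochain \<Rightarrow> bool"
  where "cocycle p X \<phi> \<longleftrightarrow>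
    (\<forall>\<sigma>. singular_simplex (Suc p) X \<sigma> \<longrightarrow>
         cochain_eval \<phi> (chain_boundary (Suc p) (frag_of \<sigma>)) = 0)"

text \<open>The faces of a \<open>p + q\<close>-simplex spanned by its first \<open>p + 1\<close> and its last \<open>q + 1\<close> vertices.\<close>

definition front_face :: "nat \<Rightarrow> ((nat \<Rightarrow> real) \<Rightarrow> 'a) \<Rightarrow> (nat \<Rightarrow> real) \<Rightarrow> 'a"
  where "front_face p \<sigma> = restrict \<sigma> (standard_simplex p)"

definition back_face :: "nat \<Rightarrow> nat \<Rightarrow> ((nat \<Rightarrow> real) \<Rightarrow> 'a) \<Rightarrow> (nat \<Rightarrow> real) \<Rightarrow> 'a"
  where "back_face p q \<sigma> =
    (\<lambda>x\<in>standard_simplex q. \<sigma> (\<lambda>i. if i < p then 0 else x (i - p)))"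

definition cup :: "nat \<Rightarrow> nat \<Rightarrow> ('a, 'r::comm_ring_1) cochain \<Rightarrow> ('a, 'r) cochain \<Rightarrow> ('a, 'r) cochain"
  where "cup p q \<phi> \<psi> = (\<lambda>\<sigma>. \<phi> (front_face p \<sigma>) * \<psi> (back_face p q \<sigma>))"

definition cap :: "nat \<Rightarrow> nat \<Rightarrow> 'a chain \<Rightarrow> ('a, int) cochain \<Rightarrow> 'a chain"
  where "cap p q c \<phi> =
    frag_extend (\<lambda>\<sigma>. frag_cmul (\<phi> (front_face p \<sigma>)) (frag_of (back_face p q \<sigma>))) c"

primrec cup_power2 :: "nat \<Rightarrow> ('a, 'r::comm_ring_1) cochain \<Rightarrow> ('a, 'r) cochain"
  \<comment> \<open>\<open>k\<close>-th cup power of a cochain of degree 2\<close>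
where
  "cup_power2 0 \<phi> = (\<lambda>\<sigma>. 1)"
| "cup_power2 (Suc k) \<phi> = cup (2 * k) 2 (cup_power2 k \<phi>) \<phi>"


section \<open>Quasitoric manifolds\<close>

text \<open>
  To let \<open>n\<close> vary, \<open>\<real>\<^sup>n\<close> is taken to be the subspace of vectors supported on \<open>{..<n}\<close> in the normed space
  of finitely supported sequences.
\<close>

type_synonym rvec = "nat \<Rightarrow>\<^sub>0 real"

definition Rn :: "nat \<Rightarrow> rvec set"
  where "Rn n = {x. Poly_Mapping.keys x \<subseteq> {..<n}}"

definition Zn :: "nat \<Rightarrow> rvec set"
  where "Zn n = {x \<in> Rn n. \<forall>j. Poly_Mapping.lookup x j \<in> \<int>}"

text \<open>
  The library's \<open>facet_of\<close> is restricted to type class \<open>euclidean_space\<close>; \<open>facet n\<close> is the same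
  notion for polytopes of dimension \<open>n\<close>, with \<open>aff_dim G = n - 1\<close> unfolded.
\<close>

definition facet :: "nat \<Rightarrow> rvec set \<Rightarrow> rvec set \<Rightarrow> bool"
  where "facet n P G \<longleftrightarrow> G face_of P \<and> G \<noteq> {} \<and>
    (\<exists>B. finite B \<and> \<not> affine_dependent B \<and> affine hull B = affine hull G \<and> card B = n)"

definition column :: "int mat \<Rightarrow> nat \<Rightarrow> rvec"
  where "column \<Lambda> i = (\<Sum>j<dim_row \<Lambda>. Poly_Mapping.single j (of_int (\<Lambda> $$ (j, i))))"

locale quasitoric =
  fixes n m :: nat
    and P :: "rvec set"
    and F :: "nat \<Rightarrow> rvec set"
    and \<Lambda> :: "int mat"
  assumes polytope: "polytope P"
    and full_dim: "affine hull P = Rn n"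
    and facets: "bij_betw F {..<m} {G. facet n P G}"
    and simple: "v extreme_point_of P \<Longrightarrow> card {i. i < m \<and> v \<in> F i} = n"
    and matrix: "\<Lambda> \<in> carrier_mat n m"
    and unimodular:
      "I \<subseteq> {..<m} \<Longrightarrow> card I = n \<Longrightarrow> v extreme_point_of P \<Longrightarrow> P \<inter> (\<Inter>i\<in>I. F i) = {v} \<Longrightarrow>
       (\<forall>y\<in>Zn n. \<exists>!a::nat \<Rightarrow> int. (\<forall>i. i \<notin> I \<longrightarrow> a i = 0) \<and> (\<Sum>i\<in>I. of_int (a i) *\<^sub>R column \<Lambda> i) = y)"

text \<open>
  Points of \<open>P \<times> T\<^sup>n\<close> are represented by points \<open>(p, t)\<close> of \<open>P \<times> \<real>\<^sup>n\<close>: the class of \<open>t\<close> modulo \<open>\<int>\<^sup>n\<close>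
  lies in the subtorus generated by the circles in the directions \<open>\<lambda>\<^sub>i\<close> iff \<open>t\<close> lies in \<open>\<int>\<^sup>n\<close> plus the
  linear span of the \<open>\<lambda>\<^sub>i\<close>.  So \<open>proj\<close> is the composition of \<open>P \<times> \<real>\<^sup>n \<rightarrow> P \<times> T\<^sup>n\<close> with the quotient map to the
  quasitoric manifold, whose points are the equivalence classes.
\<close>

type_synonym qpoint = "(rvec \<times> rvec) set"

context
  fixes n m :: nat
    and P :: "rvec set"
    and F :: "nat \<Rightarrow> rvec set"
    and \<Lambda> :: "int mat"
begin

definition subtorus :: "rvec \<Rightarrow> rvec set"
  where "subtorus p = {z + u |z u. z \<in> Zn n \<and> u \<in> span (column \<Lambda> ` {i. i < m \<and> p \<in> F i})}"

definition proj :: "rvec \<times> rvec \<Rightarrow> qpoint"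
  where "proj = (\<lambda>(p, t). {(p', t'). p' = p \<and> t' \<in> Rn n \<and> t - t' \<in> subtorus p})"

definition manifold :: "qpoint topology"
  where "manifold = topology (\<lambda>U. U \<subseteq> proj ` (P \<times> Rn n) \<and>
    openin (top_of_set (P \<times> Rn n)) {x \<in> P \<times> Rn n. proj x \<in> U})"

lemma openin_manifold:
  "openin manifold U \<longleftrightarrow> U \<subseteq> proj ` (P \<times> Rn n) \<and>
     openin (top_of_set (P \<times> Rn n)) {x \<in> P \<times> Rn n. proj x \<in> U}"
proof -
  have "istopology (\<lambda>U. U \<subseteq> proj ` (P \<times> Rn n) \<and>
    openin (top_of_set (P \<times> Rn n)) {x \<in> P \<times> Rn n. proj x \<in> U})"
    unfolding istopology_def
  proof (intro conjI allI impI)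
    fix U V
    assume U: "U \<subseteq> proj ` (P \<times> Rn n) \<and> openin (top_of_set (P \<times> Rn n)) {x \<in> P \<times> Rn n. proj x \<in> U}"
      and V: "V \<subseteq> proj ` (P \<times> Rn n) \<and> openin (top_of_set (P \<times> Rn n)) {x \<in> P \<times> Rn n. proj x \<in> V}"
    show "U \<inter> V \<subseteq> proj ` (P \<times> Rn n)" using U by blast
    have "{x \<in> P \<times> Rn n. proj x \<in> U \<inter> V} =
        {x \<in> P \<times> Rn n. proj x \<in> U} \<inter> {x \<in> P \<times> Rn n. proj x \<in> V}"
      by blast
    then show "openin (top_of_set (P \<times> Rn n)) {x \<in> P \<times> Rn n. proj x \<in> U \<inter> V}"
      using U V by (simp only: openin_Int)
  next
    fix \<U>
    assume \<U>: "\<forall>U\<in>\<U>. U \<subseteq> proj ` (P \<times> Rn n) \<and>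
      openin (top_of_set (P \<times> Rn n)) {x \<in> P \<times> Rn n. proj x \<in> U}"
    then show "\<Union> \<U> \<subseteq> proj ` (P \<times> Rn n)" by blast
    have "{x \<in> P \<times> Rn n. proj x \<in> \<Union> \<U>} = (\<Union>U\<in>\<U>. {x \<in> P \<times> Rn n. proj x \<in> U})"
      by blast
    moreover have "openin (top_of_set (P \<times> Rn n)) (\<Union>U\<in>\<U>. {x \<in> P \<times> Rn n. proj x \<in> U})"
      by (rule openin_Union) (use \<U> in blast)
    ultimately show "openin (top_of_set (P \<times> Rn n)) {x \<in> P \<times> Rn n. proj x \<in> \<Union> \<U>}"
      by (simp only:)
  qed
  then show ?thesis
    by (simp only: manifold_def topology_inverse')
qed

definition char_submanifold :: "nat \<Rightarrow> qpoint topology"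
  where "char_submanifold i = subtopology manifold (proj ` (F i \<times> Rn n))"

text \<open>
  Orientations: \<open>\<real>\<^sup>n \<times> \<real>\<^sup>n\<close> carries the product orientation, in which the sign of a sequence of \<open>2n\<close> vectors
  is that of the determinant of their coordinates, those of the first factor before those of the
  second.  It induces the orientation of the manifold on the interior of \<open>P\<close>.
\<close>

definition frame_sign :: "(nat \<Rightarrow> rvec \<times> rvec) \<Rightarrow> int"
  where "frame_sign w =
    (let D = Determinant.det (mat (2 * n) (2 * n)
       (\<lambda>(r, c). if r < n then Poly_Mapping.lookup (fst (w c)) r
                 else Poly_Mapping.lookup (snd (w c)) (r - n)))
     in if D > 0 then 1 else if D < 0 then -1 else 0)"

text \<open>The image under \<open>proj\<close> of the affine simplex with vertices \<open>a 0, \<dots>, a N\<close>.\<close>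

definition proj_simplex :: "nat \<Rightarrow> (nat \<Rightarrow> rvec \<times> rvec) \<Rightarrow> (nat \<Rightarrow> real) \<Rightarrow> qpoint"
  where "proj_simplex N a = (\<lambda>x\<in>standard_simplex N. proj (\<Sum>j\<le>N. x j *\<^sub>R a j))"

definition barycenter :: "nat \<Rightarrow> nat \<Rightarrow> real"
  where "barycenter N = (\<lambda>i. if i \<le> N then 1 / (real N + 1) else 0)"

text \<open>
  \<open>sign_simplex a s\<close>: the affine simplex with vertices \<open>a 0, \<dots>, a (2n)\<close> over the interior of \<open>P\<close> is
  nondegenerate and has orientation \<open>s = \<plusminus>1\<close> in the manifold.
\<close>

definition sign_simplex :: "(nat \<Rightarrow> rvec \<times> rvec) \<Rightarrow> int \<Rightarrow> bool"
  where "sign_simplex a s \<longleftrightarrow>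
    (\<forall>j\<le>2 * n. a j \<in> rel_interior P \<times> Rn n) \<and> s \<noteq> 0 \<and> frame_sign (\<lambda>c. a (Suc c) - a 0) = s"

text \<open>
  The same for affine simplices with vertices \<open>a 0, \<dots>, a (2n - 2)\<close> over the interior of \<open>F\<^sub>i\<close> and the
  characteristic submanifold.  The action of the circle \<open>\<lambda>\<^sub>i\<close> makes its normal bundle a complex line
  bundle, oriented by an inward normal of \<open>F\<^sub>i\<close> followed by \<open>\<lambda>\<^sub>i\<close>; the submanifold is oriented so that
  a positive basis of its normal space followed by one of its tangent space is positive in the
  manifold.  (For \<open>n = 1\<close> it is a point, so that the sign cannot be absorbed into the order of the
  vertices.)
\<close>

definition sign_simplex_char :: "nat \<Rightarrow> (nat \<Rightarrow> rvec \<times> rvec) \<Rightarrow> int \<Rightarrow> bool"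
  where "sign_simplex_char i a s \<longleftrightarrow>
    (\<forall>j\<le>2 * n - 2. a j \<in> rel_interior (F i) \<times> Rn n) \<and> s \<noteq> 0 \<and>
    (\<forall>p\<in>rel_interior P. frame_sign
       (\<lambda>c. if c = 0 then (p - fst (a 0), 0)
            else if c = 1 then (0, column \<Lambda> i)
            else a (c - 1) - a 0) = s)"

text \<open>
  A cycle represents the fundamental class iff it restricts to the local orientations: if an affine
  simplex of orientation \<open>s\<close> is embedded by \<open>proj\<close> and has barycenter \<open>b\<close>, the cycle must be homologous
  to \<open>s\<close> times that simplex relative to the complement of \<open>b\<close>.
\<close>

definition fundamental_cycle ::
    "nat \<Rightarrow> qpoint topology \<Rightarrow> ((nat \<Rightarrow> rvec \<times> rvec) \<Rightarrow> int \<Rightarrow> bool) \<Rightarrow> qpoint chain \<Rightarrow> bool"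
  where "fundamental_cycle N X ori z \<longleftrightarrow>
    singular_relcycle N X {} z \<and>
    (\<forall>a s. ori a s \<longrightarrow> inj_on (proj_simplex N a) (standard_simplex N) \<longrightarrow>
       homologous_rel N X (topspace X - {proj_simplex N a (barycenter N)})
         z (frag_cmul s (frag_of (proj_simplex N a))))"

text \<open>
  \<open>poincare_dual z i \<xi>\<close>: the cocycle \<open>\<xi>\<close> represents the class \<open>x\<^sub>i\<close> in \<open>H\<^sup>2(M; \<int>)\<close> whose cap product with the
  fundamental class, represented by \<open>z\<close>, is that of the characteristic submanifold over \<open>F\<^sub>i\<close>.
\<close>

definition poincare_dual :: "qpoint chain \<Rightarrow> nat \<Rightarrow> (qpoint, int) cochain \<Rightarrow> bool"
  where "poincare_dual z i \<xi> \<longleftrightarrow>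
    cocycle 2 manifold \<xi> \<and>
    (\<exists>y. fundamental_cycle (2 * n - 2) (char_submanifold i) (sign_simplex_char i) y \<and>
         homologous_rel (2 * n - 2) manifold {} (cap 2 (2 * n - 2) z \<xi>) y)"

text \<open>
  Here \<open>c\<^sub>1x\<^sub>1 + \<dots> + c\<^sub>mx\<^sub>m\<close> is a cochain with coefficients in the polynomial ring of the \<open>c\<^sub>i\<close>.
  Cocycles and fundamental cycle are arbitrary representatives of the classes in the formula, on which
  the value does not depend.
\<close>

definition volume_polynomial :: "mpoly \<Rightarrow> bool"
  where "volume_polynomial V \<longleftrightarrow>
    (\<exists>z \<xi>. fundamental_cycle (2 * n) manifold sign_simplex z \<and>
       (\<forall>i<m. poincare_dual z i (\<xi> i)) \<and>
       V = (1 / fact n) *\<^sub>R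
             cochain_eval (cup_power2 n (\<lambda>\<sigma>. \<Sum>i<m. mvar i * of_int (\<xi> i \<sigma>))) z)"

end

end

theory Submission
  imports Defs
begin

text \<open>
  A nonzero \<open>DV\<close> fails to change sign iff, up to replacing \<open>D\<close> by \<open>-D\<close>, it is nonnegative everywhere and
  positive somewhere.  Since \<open>DV\<close> is a linear combination of the \<open>k\<close>-fold partial derivatives of \<open>V\<close>, the
  condition says that for no \<open>k < d\<close> there are coefficients \<open>c\<close> and a point \<open>x\<close> such that for all \<open>y\<close>
  the combination \<open>P\<close> with coefficients \<open>c\<close> satisfies \<open>P(x) > 0\<close> and \<open>P(y) \<ge> 0\<close>.  This is a first-order
  statement over the reals, which is decided by the Cohen--Hoermander quantifier elimination: the
  sign pattern of univariate polynomials along the line is determined by the signs of their leading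
  coefficients and the sign pattern of polynomials of lower degree, namely the derivative of one of
  highest degree, the other ones, and the remainders of the former modulo all of these.  At a root
  of a divisor the sign of the polynomial is that of the remainder, and between two such roots it is
  monotone, so that the intermediate value theorem locates its roots.
\<close>

section \<open>Computable functions\<close>

text \<open>The statement asks for a program of the machine model. The decision procedure is
  therefore written as a function on numbers, pairs and lists, whose computability follows from
  closure rules, while its correctness is a separate and purely mathematical claim. Polynomials are
  unnormalised lists of terms: they enter only through their signs at points, so equality of
  polynomials never has to be tested. The number of variables is part of the input, so eliminations
  are iterated, and the coefficients of the univariate polynomials depend on the variables that are
  still free. Their signs are unknown, so each step branches into cases. The sign conditions
  collected along a branch form a conjunction, and the branches whose diagrams are accepted form the
  eliminated formula, again in disjunctive normal form. Roots are never computed; a diagram records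
  only their order and the signs at and between them. Each step doubles the number of polynomials,
  so termination rests on the multiset of their lengths.\<close>

class enc =
  fixes enc :: "'a \<Rightarrow> val"

instantiation real :: enc begin
definition "enc_real (x::real) = Num x"
instance ..
end

instantiation nat :: enc begin
definition "enc_nat (n::nat) = Num (of_nat n)"
instance ..
end

instantiation bool :: enc begin
definition "enc_bool b = Num (if b then 1 else 0)"
instance ..
end

instantiation prod :: (enc, enc) enc begin
definition "enc_prod p = Pair (enc (fst p)) (enc (snd p))"
instance ..
end

instantiation list :: (enc) enc begin
definition "enc_list xs = foldr Pair (map enc xs) Null"
instance ..
end

lemma enc_list_simps [simp]:
  "enc ([] :: 'a::enc list) = Null"
  "enc (x # xs :: 'a::enc list) = Pair (enc x) (enc xs)"
  by (simp_all add: enc_list_def)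

lemma enc_pair [simp]: "enc (a, b) = Pair (enc a) (enc b)"
  by (simp add: enc_prod_def)

text \<open>
  Procedures call each other by absolute position, so a procedure list may be placed after any prefix
  of known length and extended arbitrarily; this makes programs composable without renumbering.
\<close>

definition computable :: "('a::enc \<Rightarrow> 'b::enc) \<Rightarrow> bool"
  where "computable f \<longleftrightarrow> (\<forall>n. \<exists>\<Delta>\<^sub>1 e. \<forall>\<Delta>\<^sub>0 \<Delta>\<^sub>2 x. length \<Delta>\<^sub>0 = n \<longrightarrow>
    run (\<Delta>\<^sub>0 @ \<Delta>\<^sub>1 @ \<Delta>\<^sub>2) e (enc x) (enc (f x)))"

named_theorems computable_intros

lemma computableI0:
  assumes "\<And>\<Delta> x. run \<Delta> e (enc x) (enc (f x))"
  shows "computable f"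
  unfolding computable_def using assms by blast

lemma computableI1:
  assumes f: "computable f"
    and run: "\<And>\<Delta> e x. run \<Delta> e (enc x) (enc (f x)) \<Longrightarrow> run \<Delta> (c e) (enc x) (enc (g x))"
  shows "computable g"
  unfolding computable_def
proof
  fix n
  from f obtain \<Delta>\<^sub>1 e where "\<And>\<Delta>\<^sub>0 \<Delta>\<^sub>2 x. length \<Delta>\<^sub>0 = n \<Longrightarrow> run (\<Delta>\<^sub>0 @ \<Delta>\<^sub>1 @ \<Delta>\<^sub>2) e (enc x) (enc (f x))"
    unfolding computable_def by meson
  then show "\<exists>\<Delta>\<^sub>1 e. \<forall>\<Delta>\<^sub>0 \<Delta>\<^sub>2 x. length \<Delta>\<^sub>0 = n \<longrightarrow> run (\<Delta>\<^sub>0 @ \<Delta>\<^sub>1 @ \<Delta>\<^sub>2) e (enc x) (enc (g x))"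
    using run by blast
qed

text \<open>The procedures for \<open>g\<close> are chosen for a prefix that already includes those
  for \<open>f\<close>, so both lists keep their absolute positions when concatenated. The runs of
  \<open>e\<close> and \<open>e'\<close> are assumed on all inputs because the combined expression
  may run one of them on an intermediate value, as composition does.\<close>

lemma computableI2:
  fixes f :: "'a::enc \<Rightarrow> 'b::enc" and g :: "'c::enc \<Rightarrow> 'd::enc" and h :: "'k::enc \<Rightarrow> 'l::enc"
  assumes f: "computable f" and g: "computable g"
    and run: "\<And>\<Delta> e e' x. (\<And>y. run \<Delta> e (enc y) (enc (f y))) \<Longrightarrow> (\<And>y. run \<Delta> e' (enc y) (enc (g y))) \<Longrightarrow>
      run \<Delta> (c e e') (enc x) (enc (h x))"
  shows "computable h"
  unfolding computable_def
proof
  fix n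
  from f obtain A e where A: "\<And>\<Delta>\<^sub>0 \<Delta>\<^sub>2 x. length \<Delta>\<^sub>0 = n \<Longrightarrow> run (\<Delta>\<^sub>0 @ A @ \<Delta>\<^sub>2) e (enc x) (enc (f x))"
    unfolding computable_def by meson
  from g obtain B e' where B: "\<And>\<Delta>\<^sub>0 \<Delta>\<^sub>2 x. length \<Delta>\<^sub>0 = n + length A \<Longrightarrow> run (\<Delta>\<^sub>0 @ B @ \<Delta>\<^sub>2) e' (enc x) (enc (g x))"
    unfolding computable_def by meson
  have "run (\<Delta>\<^sub>0 @ (A @ B) @ \<Delta>\<^sub>2) (c e e') (enc x) (enc (h x))" if "length \<Delta>\<^sub>0 = n" for \<Delta>\<^sub>0 \<Delta>\<^sub>2 x
  proof (rule run)
    show "run (\<Delta>\<^sub>0 @ (A @ B) @ \<Delta>\<^sub>2) e (enc y) (enc (f y))" for y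
      using A[OF that, of "B @ \<Delta>\<^sub>2"] by simp
    show "run (\<Delta>\<^sub>0 @ (A @ B) @ \<Delta>\<^sub>2) e' (enc y) (enc (g y))" for y
      using B[of "\<Delta>\<^sub>0 @ A" \<Delta>\<^sub>2] that by simp
  qed
  then show "\<exists>\<Delta>\<^sub>1 e. \<forall>\<Delta>\<^sub>0 \<Delta>\<^sub>2 x. length \<Delta>\<^sub>0 = n \<longrightarrow> run (\<Delta>\<^sub>0 @ \<Delta>\<^sub>1 @ \<Delta>\<^sub>2) e (enc x) (enc (h x))"
    by blast
qed

section \<open>Closure under the basic operations\<close>

lemma computable_id [computable_intros]: "computable (\<lambda>x. x)"
  by (rule computableI0[of Arg]) (rule run_Arg)

lemma computable_comp:
  assumes "computable f" "computable g"
  shows "computable (\<lambda>x. f (g x))"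
  by (rule computableI2[OF assms, of "\<lambda>e e'. Defs.Let e' e"]) (blast intro: run_Let)

lemma computable_Pair [computable_intros]:
  assumes "computable f" "computable g"
  shows "computable (\<lambda>x. (f x, g x))"
  by (rule computableI2[OF assms, of "\<lambda>e e'. Defs.Cons e e'"]) (simp add: run_Cons)

lemma computable_fst [computable_intros]:
  assumes "computable f" shows "computable (\<lambda>x. fst (f x))"
  by (rule computableI1[OF assms, of First]) (auto simp: enc_prod_def intro: run_First)

lemma computable_snd [computable_intros]:
  assumes "computable f" shows "computable (\<lambda>x. snd (f x))"
  by (rule computableI1[OF assms, of Second]) (auto simp: enc_prod_def intro: run_Second)

lemma computable_Nil [computable_intros]: "computable (\<lambda>x. [])"
  by (rule computableI0[of Empty]) (simp add: run_Empty)

lemma computable_Cons [computable_intros]: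
  assumes "computable f" "computable g"
  shows "computable (\<lambda>x. f x # g x)"
  by (rule computableI2[OF assms, of "\<lambda>e e'. Defs.Cons e e'"]) (simp add: run_Cons)

lemma computable_const_of_rat: "computable (\<lambda>x. of_rat q :: real)"
  by (rule computableI0[of "Const q"]) (simp add: enc_real_def run_Const)

lemma computable_0 [computable_intros]: "computable (\<lambda>x. 0 :: real)"
  using computable_const_of_rat[of 0] by simp

lemma computable_1 [computable_intros]: "computable (\<lambda>x. 1 :: real)"
  using computable_const_of_rat[of 1] by simp

text \<open>A natural number and the equal real number have the same encoding, so arithmetic and
  comparison on \<open>nat\<close> are inherited from \<open>real\<close>.\<close>

lemma computable_nat_of_rat:
  assumes "computable (\<lambda>x. real (f x))" shows "computable f"
  using assms unfolding computable_def enc_real_def enc_nat_def by simp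

lemma computable_real_of_nat [computable_intros]:
  assumes "computable f" shows "computable (\<lambda>x. real (f x))"
  using assms unfolding computable_def enc_real_def enc_nat_def by simp

lemma computable_nat_0 [computable_intros]: "computable (\<lambda>x. 0 :: nat)"
  by (rule computable_nat_of_rat) (simp add: computable_0)

lemma computable_nat_1 [computable_intros]: "computable (\<lambda>x. 1 :: nat)"
  by (rule computable_nat_of_rat) (simp add: computable_1)

lemma computable_add [computable_intros]:
  fixes f g :: "'a::enc \<Rightarrow> real"
  assumes "computable f" "computable g"
  shows "computable (\<lambda>x. f x + g x)"
  by (rule computableI2[OF assms, of "\<lambda>e e'. Add e e'"]) (simp add: run_Add enc_real_def)

lemma computable_diff [computable_intros]:
  fixes f g :: "'a::enc \<Rightarrow> real"
  assumes "computable f" "computable g"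
  shows "computable (\<lambda>x. f x - g x)"
  by (rule computableI2[OF assms, of "\<lambda>e e'. Sub e e'"]) (simp add: run_Sub enc_real_def)

lemma computable_mult [computable_intros]:
  fixes f g :: "'a::enc \<Rightarrow> real"
  assumes "computable f" "computable g"
  shows "computable (\<lambda>x. f x * g x)"
  by (rule computableI2[OF assms, of "\<lambda>e e'. Mul e e'"]) (simp add: run_Mul enc_real_def)

lemma computable_uminus [computable_intros]:
  fixes f :: "'a::enc \<Rightarrow> real"
  assumes "computable f"
  shows "computable (\<lambda>x. - f x)"
  using computable_diff[OF computable_0 assms] by simp

lemma computable_nat_add [computable_intros]:
  fixes f g :: "'a::enc \<Rightarrow> nat"
  assumes "computable f" "computable g"
  shows "computable (\<lambda>x. f x + g x)"
  by (rule computable_nat_of_rat) (simp add: computable_intros assms)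

lemma computable_Suc [computable_intros]:
  assumes "computable f"
  shows "computable (\<lambda>x. Suc (f x))"
  using computable_nat_add[OF assms computable_nat_1] by simp

lemma computable_pos [computable_intros]:
  fixes f :: "'a::enc \<Rightarrow> real"
  assumes "computable f"
  shows "computable (\<lambda>x. 0 < f x)"
proof (rule computableI1[OF assms, of "\<lambda>e. IfPos e (Const 1) (Const 0)"])
  fix \<Delta> e x assume *: "run \<Delta> e (enc x) (enc (f x))"
  show "run \<Delta> (IfPos e (Const 1) (Const 0)) (enc x) (enc (0 < f x))"
    using run_IfPos1[of \<Delta> e "enc x" "f x" "Const 1" "Num 1" "Const 0"]
      run_IfPos2[of \<Delta> e "enc x" "f x" "Const 0" "Num 0" "Const 1"]
      run_Const[of \<Delta> 1 "enc x"] run_Const[of \<Delta> 0 "enc x"] *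
    by (cases "0 < f x") (auto simp: enc_bool_def enc_real_def)
qed

text \<open>Both branches are evaluated before one is selected. This is harmless for total
  functions, but recursion cannot stop this way; \<open>computable_rec\<close> therefore places its
  recursive calls inside a branch of \<open>IfPos\<close>.\<close>

lemma computable_if [computable_intros]:
  assumes "computable b" "computable f" "computable g"
  shows "computable (\<lambda>x. if b x then f x else g x)"
proof -
  have "computable (\<lambda>x. (f x, g x))"
    by (intro computable_intros assms)
  from assms(1) this show ?thesis
  proof (rule computableI2[of _ _ "\<lambda>e e'. IfPos e (First e') (Second e')"])
    fix \<Delta> e e' x
    assume b: "\<And>y. run \<Delta> e (enc y) (enc (b y))" and fg: "\<And>y. run \<Delta> e' (enc y) (enc (f y, g y))"
    show "run \<Delta> (IfPos e (First e') (Second e')) (enc x) (enc (if b x then f x else g x))"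
      using b[of x] fg[of x]
      by (cases "b x") (auto simp: enc_bool_def intro: run.intros)
  qed
qed

lemma computable_True [computable_intros]: "computable (\<lambda>x. True)"
  using computable_pos[OF computable_1] by simp

lemma computable_False [computable_intros]: "computable (\<lambda>x. False)"
  using computable_pos[OF computable_0] by simp

lemma computable_not [computable_intros]:
  assumes "computable b" shows "computable (\<lambda>x. \<not> b x)"
proof -
  have "(\<lambda>x. \<not> b x) = (\<lambda>x. if b x then False else True)" by auto
  then show ?thesis using computable_if[OF assms computable_False computable_True] by simp
qed

lemma computable_conj [computable_intros]:
  assumes "computable b" "computable c" shows "computable (\<lambda>x. b x \<and> c x)"
proof -
  have "(\<lambda>x. b x \<and> c x) = (\<lambda>x. if b x then c x else False)" by auto
  then show ?thesis using computable_if[OF assms computable_False] by simp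
qed

lemma computable_disj [computable_intros]:
  assumes "computable b" "computable c" shows "computable (\<lambda>x. b x \<or> c x)"
proof -
  have "(\<lambda>x. b x \<or> c x) = (\<lambda>x. if b x then True else c x)" by auto
  then show ?thesis using computable_if[OF assms(1) computable_True assms(2)] by simp
qed

lemma computable_less [computable_intros]:
  fixes f g :: "'a::enc \<Rightarrow> real"
  assumes "computable f" "computable g"
  shows "computable (\<lambda>x. f x < g x)"
  using computable_pos[OF computable_diff[OF assms(2,1)]] by simp

lemma computable_eq [computable_intros]:
  fixes f g :: "'a::enc \<Rightarrow> real"
  assumes "computable f" "computable g"
  shows "computable (\<lambda>x. f x = g x)"
proof -
  have "computable (\<lambda>x. \<not> f x < g x \<and> \<not> g x < f x)"
    by (intro computable_intros assms)
  then show ?thesis by (auto simp: not_less eq_iff conj_commute)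
qed

lemma computable_nat_less [computable_intros]:
  fixes f g :: "'a::enc \<Rightarrow> nat"
  assumes "computable f" "computable g"
  shows "computable (\<lambda>x. f x < g x)"
  using computable_less[OF assms[THEN computable_real_of_nat]] by simp

lemma computable_nat_eq [computable_intros]:
  fixes f g :: "'a::enc \<Rightarrow> nat"
  assumes "computable f" "computable g"
  shows "computable (\<lambda>x. f x = g x)"
  using computable_eq[OF assms[THEN computable_real_of_nat]] by simp

lemma computable_nat_diff [computable_intros]:
  fixes f g :: "'a::enc \<Rightarrow> nat"
  assumes "computable f" "computable g"
  shows "computable (\<lambda>x. f x - g x)"
proof (rule computable_nat_of_rat)
  have "computable (\<lambda>x. if g x < f x then real (f x) - real (g x) else 0)"
    by (intro computable_intros assms)
  also have "(\<lambda>x. if g x < f x then real (f x) - real (g x) else 0) = (\<lambda>x. real (f x - g x))"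
    by (auto simp: fun_eq_iff)
  finally show "computable (\<lambda>x. real (f x - g x))" .
qed

text \<open>A nonempty list is encoded like the pair of its head and tail. Hence
  \<open>IfPair\<close> is the case distinction, and the encoding of \<open>(x, y # ys)\<close> is
  already that of the argument \<open>(x, y, ys)\<close> of \<open>f\<close>.\<close>

lemma computable_case_list [computable_intros]:
  assumes xs: "computable xs" and z: "computable z"
    and f: "computable (\<lambda>p. f (fst p) (fst (snd p)) (snd (snd p)))"
  shows "computable (\<lambda>x. case xs x of [] \<Rightarrow> z x | y # ys \<Rightarrow> f x y ys)"
proof -
  have xz: "computable (\<lambda>x. (x, xs x, z x))"
    by (intro computable_intros xs z)
  show ?thesis
  proof (rule computableI2[OF xz f, of "\<lambda>e e'. Defs.Let e (IfPair (First (Second Arg))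
      (Defs.Let (Defs.Cons (First Arg) (First (Second Arg))) e') (Second (Second Arg)))"])
    fix \<Delta> e e' x
    assume e: "\<And>y. run \<Delta> e (enc y) (enc (y, xs y, z y))"
      and e': "\<And>y. run \<Delta> e' (enc y) (enc (f (fst y) (fst (snd y)) (snd (snd y))))"
    show "run \<Delta> (Defs.Let e (IfPair (First (Second Arg))
      (Defs.Let (Defs.Cons (First Arg) (First (Second Arg))) e') (Second (Second Arg)))) (enc x)
      (enc (case xs x of [] \<Rightarrow> z x | y # ys \<Rightarrow> f x y ys))"
    proof (rule run_Let, rule e, cases "xs x")
      case Nil
      then show "run \<Delta> (IfPair (First (Second Arg))
        (Defs.Let (Defs.Cons (First Arg) (First (Second Arg))) e') (Second (Second Arg)))
        (enc (x, xs x, z x)) (enc (case xs x of [] \<Rightarrow> z x | y # ys \<Rightarrow> f x y ys))"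
        by (intro run_IfPair2[where u = Null]) (auto intro: run.intros)
    next
      case (Cons y ys)
      have "run \<Delta> e' (Pair (enc x) (Pair (enc y) (enc ys))) (enc (f x y ys))"
        using e'[of "(x, y, ys)"] by simp
      with Cons show "run \<Delta> (IfPair (First (Second Arg))
        (Defs.Let (Defs.Cons (First Arg) (First (Second Arg))) e') (Second (Second Arg)))
        (enc (x, xs x, z x)) (enc (case xs x of [] \<Rightarrow> z x | y # ys \<Rightarrow> f x y ys))"
        by (intro run_IfPair1[where a = "enc y" and b = "enc ys"] run_Let) (auto intro: run.intros)
    qed
  qed
qed

lemma computable_Let [computable_intros]:
  assumes "computable g" "computable (\<lambda>p. f (fst p) (snd p))"
  shows "computable (\<lambda>x. let a = g x in f x a)"
  using computable_comp[OF assms(2) computable_Pair[OF computable_id assms(1)]] by simp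

text \<open>All recursion below, including nested and non-primitive one, is an instance of this rule.\<close>

lemma computable_rec:
  fixes F :: "'a::enc \<Rightarrow> 'b::enc"
  assumes wf: "wf R"
    and R: "\<And>x y. \<not> b x \<Longrightarrow> y \<in> set (r x) \<Longrightarrow> (y, x) \<in> R"
    and F: "\<And>x. F x = (if b x then g x else h (x, map F (r x)))"
    and comp: "computable b" "computable g" "computable r" "computable h"
  shows "computable F"
  unfolding computable_def
proof
  fix n
  have "computable (\<lambda>x. (b x, g x))"
    by (intro computable_intros comp)
  then obtain A ebg where A: "\<And>\<Delta>\<^sub>0 \<Delta>\<^sub>2 x. length \<Delta>\<^sub>0 = n \<Longrightarrow>
      run (\<Delta>\<^sub>0 @ A @ \<Delta>\<^sub>2) ebg (enc x) (enc (b x, g x))"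
    unfolding computable_def by meson
  from comp(3) obtain B er where B: "\<And>\<Delta>\<^sub>0 \<Delta>\<^sub>2 x. length \<Delta>\<^sub>0 = n + length A \<Longrightarrow>
      run (\<Delta>\<^sub>0 @ B @ \<Delta>\<^sub>2) er (enc x) (enc (r x))"
    unfolding computable_def by meson
  from comp(4) obtain C eh where C: "\<And>\<Delta>\<^sub>0 \<Delta>\<^sub>2 x. length \<Delta>\<^sub>0 = n + length A + length B \<Longrightarrow>
      run (\<Delta>\<^sub>0 @ C @ \<Delta>\<^sub>2) eh (enc x) (enc (h x))"
    unfolding computable_def by meson
  \<comment> \<open>\<open>k\<close> is the absolute position of \<open>bodyF\<close>. The procedure
    \<open>bodyM\<close> right after it maps the recursive calls over a list of arguments, so the
    two call each other.\<close>
  define k where "k = n + length A + length B + length C"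
  define bodyF where "bodyF = IfPos (First ebg) (Second ebg)
    (Defs.Let (Defs.Cons Arg (Defs.Let er (Call (Suc k) Arg))) eh)"
  define bodyM where "bodyM = IfPair Arg (Defs.Cons (Call k (First Arg)) (Call (Suc k) (Second Arg))) Empty"
  have "run (\<Delta>\<^sub>0 @ (A @ B @ C @ [bodyF, bodyM]) @ \<Delta>\<^sub>2) (Call k Arg) (enc x) (enc (F x))"
    if len: "length \<Delta>\<^sub>0 = n" for \<Delta>\<^sub>0 \<Delta>\<^sub>2 x
  proof -
    define \<Delta> where "\<Delta> = \<Delta>\<^sub>0 @ (A @ B @ C @ [bodyF, bodyM]) @ \<Delta>\<^sub>2"
    have bg: "run \<Delta> ebg (enc x) (Pair (enc (b x)) (enc (g x)))" for x
      unfolding \<Delta>_def using A[OF len, of "B @ C @ [bodyF, bodyM] @ \<Delta>\<^sub>2" x] by simp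
    have r: "run \<Delta> er (enc x) (enc (r x))" for x
      unfolding \<Delta>_def using B[of "\<Delta>\<^sub>0 @ A" "C @ [bodyF, bodyM] @ \<Delta>\<^sub>2"] len by simp
    have h: "run \<Delta> eh (enc x) (enc (h x))" for x
      unfolding \<Delta>_def using C[of "\<Delta>\<^sub>0 @ A @ B" "[bodyF, bodyM] @ \<Delta>\<^sub>2"] len by simp
    have len': "length (\<Delta>\<^sub>0 @ A @ B @ C) = k"
      by (simp add: k_def len)
    have \<Delta>_eq: "\<Delta> = (\<Delta>\<^sub>0 @ A @ B @ C) @ bodyF # bodyM # \<Delta>\<^sub>2"
      by (simp add: \<Delta>_def)
    have k: "k < length \<Delta>" "Suc k < length \<Delta>"
      using len' by (simp_all add: \<Delta>_def)
    have nth: "\<Delta> ! k = bodyF" "\<Delta> ! Suc k = bodyM"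
      unfolding \<Delta>_eq using len' by (simp_all only: nth_append) simp_all
    have call: "run \<Delta> (Call k e) v (enc (F y))"
      if "run \<Delta> e v (enc y)" "run \<Delta> bodyF (enc y) (enc (F y))" for e v y
      using run_Call[OF that(1) k(1)] that(2) by (simp add: nth)
    have callM: "run \<Delta> (Call (Suc k) e) v w"
      if "run \<Delta> e v u" "run \<Delta> bodyM u w" for e u v w
      using run_Call[OF that(1) k(2)] that(2) by (simp add: nth)
    \<comment> \<open>The assumption is restricted to the members of \<open>ys\<close>, so that the
      well-founded induction below can supply it for \<open>r x\<close>.\<close>
    have M: "run \<Delta> bodyM (enc ys) (enc (map F ys))"
      if "\<And>y. y \<in> set ys \<Longrightarrow> run \<Delta> bodyF (enc y) (enc (F y))" for ys
      using that
    proof (induction ys)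
      case Nil
      then show ?case unfolding bodyM_def
        by (intro run_IfPair2[where u = Null]) (auto intro: run.intros)
    next
      case (Cons y ys)
      then have "run \<Delta> bodyM (enc ys) (enc (map F ys))" by simp
      then have "run \<Delta> (Call (Suc k) (Second Arg)) (Pair (enc y) (enc ys)) (enc (map F ys))"
        by (rule callM[OF run_Second[OF run_Arg]])
      moreover have "run \<Delta> (Call k (First Arg)) (Pair (enc y) (enc ys)) (enc (F y))"
        using Cons.prems[of y] by (intro call run_First[OF run_Arg]) simp
      ultimately have "run \<Delta> (Defs.Cons (Call k (First Arg)) (Call (Suc k) (Second Arg)))
          (Pair (enc y) (enc ys)) (Pair (enc (F y)) (enc (map F ys)))"
        by (rule run_Cons[rotated])
      then show ?case
        unfolding bodyM_def by (simp add: run_IfPair1[OF run_Arg])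
    qed
    have "run \<Delta> bodyF (enc x) (enc (F x))"
      using wf
    proof (induction x rule: wf_induct_rule)
      case (less x)
      show ?case
      proof (cases "b x")
        case True
        then show ?thesis
          using bg[of x] unfolding bodyF_def F[of x]
          by (intro run_IfPos1[of _ _ _ 1]) (auto simp: enc_bool_def intro: run.intros)
      next
        case False
        have "run \<Delta> bodyM (enc (r x)) (enc (map F (r x)))"
          by (rule M) (use less R False in blast)
        then have "run \<Delta> (Defs.Let (Defs.Cons Arg (Defs.Let er (Call (Suc k) Arg))) eh) (enc x) (enc (h (x, map F (r x))))"
          using h[of "(x, map F (r x))"]
          by (intro run_Let[of _ _ _ "enc (x, map F (r x))"]) (auto intro!: run_Cons run_Let[OF r] callM run_Arg)
        then show ?thesis
          using bg[of x] False unfolding bodyF_def F[of x]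
          by (intro run_IfPos2[of _ _ _ 0]) (auto simp: enc_bool_def intro: run_First)
      qed
    qed
    then show ?thesis
      unfolding \<Delta>_def[symmetric] by (intro call) (rule run_Arg)
  qed
  then show "\<exists>\<Delta>\<^sub>1 e. \<forall>\<Delta>\<^sub>0 \<Delta>\<^sub>2 x. length \<Delta>\<^sub>0 = n \<longrightarrow> run (\<Delta>\<^sub>0 @ \<Delta>\<^sub>1 @ \<Delta>\<^sub>2) e (enc x) (enc (F x))"
    by blast
qed

lemma computable_app2:
  assumes "computable (\<lambda>p. f (fst p) (snd p))" "computable a" "computable b"
  shows "computable (\<lambda>x. f (a x) (b x))"
  using computable_comp[OF assms(1) computable_Pair[OF assms(2,3)]] by simp

lemma computable_app3:
  assumes "computable (\<lambda>p. f (fst p) (fst (snd p)) (snd (snd p)))" "computable a" "computable b" "computable c"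
  shows "computable (\<lambda>x. f (a x) (b x) (c x))"
  using computable_comp[OF assms(1) computable_Pair[OF assms(2) computable_Pair[OF assms(3,4)]]] by simp

text \<open>The step function receives the ambient argument \<open>x\<close> explicitly, because a
  body under a fold may refer to variables bound outside and computable functions take one argument.
  The combinators below that take a function follow this pattern.\<close>

lemma computable_foldr [computable_intros]:
  assumes f: "computable (\<lambda>p. f (fst p) (fst (snd p)) (snd (snd p)))"
    and xs: "computable xs" and z: "computable z"
  shows "computable (\<lambda>x. foldr (f x) (xs x) (z x))"
proof -
  define F where "F = (\<lambda>p. foldr (f (fst p)) (snd p) (z (fst p)))"
  have z': "computable (\<lambda>q. z (a q))" if "computable a" for a :: "'q::enc \<Rightarrow> 'a"
    using computable_comp[OF z that] .
  have "computable F"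
  proof (rule computable_rec)
    show "wf (Wellfounded.measure (\<lambda>p :: 'a \<times> 'b list. length (snd p)))" by simp
    show "F p = (if (case snd p of [] \<Rightarrow> True | y # ys \<Rightarrow> False) then z (fst p) else
      (\<lambda>q. case snd (fst q) of [] \<Rightarrow> z (fst (fst q)) | y # ys \<Rightarrow>
        (case snd q of [] \<Rightarrow> z (fst (fst q)) | w # ws \<Rightarrow> f (fst (fst q)) y w))
      (p, map F (case snd p of [] \<Rightarrow> [] | y # ys \<Rightarrow> [(fst p, ys)])))" for p
      by (auto simp: F_def split: list.split)
  qed (intro computable_intros z' computable_app3[OF f] | (auto split: list.splits)[1])+
  from computable_comp[OF this computable_Pair[OF computable_id xs]]
  show ?thesis by (simp add: F_def)
qed

lemma computable_rec_nat [computable_intros]: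
  assumes f: "computable (\<lambda>p. f (fst p) (fst (snd p)) (snd (snd p)))"
    and n: "computable n" and z: "computable z"
  shows "computable (\<lambda>x. rec_nat (z x) (f x) (n x))"
proof -
  define F where "F = (\<lambda>p. rec_nat (z (fst p)) (f (fst p)) (snd p))"
  have z': "computable (\<lambda>q. z (a q))" if "computable a" for a :: "'q::enc \<Rightarrow> 'a"
    using computable_comp[OF z that] .
  have "computable F"
  proof (rule computable_rec)
    show "wf (Wellfounded.measure (\<lambda>p :: 'a \<times> nat. snd p))" by simp
    show "F p = (if \<not> 0 < snd p then z (fst p) else
      (\<lambda>q. case snd q of [] \<Rightarrow> z (fst (fst q)) | w # ws \<Rightarrow> f (fst (fst q)) (snd (fst q) - 1) w)
      (p, map F [(fst p, snd p - 1)]))" for p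
      by (cases "snd p") (auto simp: F_def)
  qed (intro computable_intros computable_nat_less z' computable_app3[OF f] | (auto)[1])+
  from computable_comp[OF this computable_Pair[OF computable_id n]]
  show ?thesis by (simp add: F_def)
qed

lemma computable_append [computable_intros]:
  assumes "computable f" "computable g"
  shows "computable (\<lambda>x. f x @ g x)"
proof -
  have "computable (\<lambda>x. foldr (\<lambda>a b. a # b) (f x) (g x))"
    by (intro computable_intros assms)
  moreover have "foldr (\<lambda>a b. a # b) xs ys = xs @ ys" for xs ys :: "'b list"
    by (induction xs) auto
  ultimately show ?thesis by simp
qed

lemma computable_map [computable_intros]:
  assumes "computable (\<lambda>p. f (fst p) (snd p))" "computable xs"
  shows "computable (\<lambda>x. map (f x) (xs x))"
proof -
  have "computable (\<lambda>x. foldr (\<lambda>a b. f x a # b) (xs x) [])"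
    by (intro computable_intros computable_app2[OF assms(1)] assms(2))
  moreover have "foldr (\<lambda>a b. g a # b) ys [] = map g ys" for g :: "'b \<Rightarrow> 'c" and ys
    by (induction ys) auto
  ultimately show ?thesis by simp
qed

lemma computable_concat [computable_intros]:
  assumes "computable xs"
  shows "computable (\<lambda>x. concat (xs x))"
proof -
  have "computable (\<lambda>x. foldr (\<lambda>a b. a @ b) (xs x) [])"
    by (intro computable_intros assms)
  then show ?thesis by (simp add: concat_conv_foldr)
qed

lemma computable_filter [computable_intros]:
  assumes "computable (\<lambda>p. f (fst p) (snd p))" "computable xs"
  shows "computable (\<lambda>x. filter (f x) (xs x))"
proof -
  have "computable (\<lambda>x. foldr (\<lambda>a b. if f x a then a # b else b) (xs x) [])"
    by (intro computable_intros computable_app2[OF assms(1)] assms(2))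
  moreover have "foldr (\<lambda>a b. if g a then a # b else b) ys [] = filter g ys" for g and ys :: "'b list"
    by (induction ys) auto
  ultimately show ?thesis by simp
qed

lemma computable_takeWhile [computable_intros]:
  assumes "computable (\<lambda>p. f (fst p) (snd p))" "computable xs"
  shows "computable (\<lambda>x. takeWhile (f x) (xs x))"
proof -
  have "computable (\<lambda>x. foldr (\<lambda>a b. if f x a then a # b else []) (xs x) [])"
    by (intro computable_intros computable_app2[OF assms(1)] assms(2))
  moreover have "foldr (\<lambda>a b. if g a then a # b else []) ys [] = takeWhile g ys" for g and ys :: "'b list"
    by (induction ys) auto
  ultimately show ?thesis by simp
qed

lemma computable_list_ex [computable_intros]:
  assumes "computable (\<lambda>p. f (fst p) (snd p))" "computable xs"
  shows "computable (\<lambda>x. list_ex (f x) (xs x))"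
proof -
  have "computable (\<lambda>x. foldr (\<lambda>a b. f x a \<or> b) (xs x) False)"
    by (intro computable_intros computable_app2[OF assms(1)] assms(2))
  moreover have "foldr (\<lambda>a b. g a \<or> b) ys False = list_ex g ys" for g and ys :: "'b list"
    by (induction ys) auto
  ultimately show ?thesis by simp
qed

lemma computable_list_all [computable_intros]:
  assumes "computable (\<lambda>p. f (fst p) (snd p))" "computable xs"
  shows "computable (\<lambda>x. list_all (f x) (xs x))"
proof -
  have "computable (\<lambda>x. \<not> list_ex (\<lambda>y. \<not> f x y) (xs x))"
    by (intro computable_intros assms)
  then show ?thesis by (simp add: list_ex_iff list_all_iff)
qed

lemma computable_length [computable_intros]:
  assumes "computable xs"
  shows "computable (\<lambda>x. length (xs x))"
proof -
  have "computable (\<lambda>x. foldr (\<lambda>a b. Suc b) (xs x) 0)"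
    by (intro computable_intros assms)
  moreover have "foldr (\<lambda>a b. Suc b) ys 0 = length ys" for ys :: "'b list"
    by (induction ys) auto
  ultimately show ?thesis by simp
qed

lemma computable_rev [computable_intros]:
  assumes "computable xs"
  shows "computable (\<lambda>x. rev (xs x))"
proof -
  have "computable (\<lambda>x. foldr (\<lambda>a b. b @ [a]) (xs x) [])"
    by (intro computable_intros assms)
  moreover have "foldr (\<lambda>a b. b @ [a]) ys [] = rev ys" for ys :: "'b list"
    by (induction ys) auto
  ultimately show ?thesis by simp
qed

lemma computable_sum_list [computable_intros]:
  fixes xs :: "'a::enc \<Rightarrow> real list"
  assumes "computable xs"
  shows "computable (\<lambda>x. sum_list (xs x))"
proof -
  have "computable (\<lambda>x. foldr (\<lambda>a b. a + b) (xs x) 0)"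
    by (intro computable_intros assms)
  then show ?thesis by (simp add: sum_list.eq_foldr)
qed

lemma computable_sum_list_nat [computable_intros]:
  fixes xs :: "'a::enc \<Rightarrow> nat list"
  assumes "computable xs"
  shows "computable (\<lambda>x. sum_list (xs x))"
proof -
  have "computable (\<lambda>x. foldr (\<lambda>a b. a + b) (xs x) 0)"
    by (intro computable_intros assms)
  then show ?thesis by (simp add: sum_list.eq_foldr)
qed

lemma computable_tl [computable_intros]:
  assumes "computable xs"
  shows "computable (\<lambda>x. tl (xs x))"
  unfolding tl_def by (intro computable_intros assms)

lemma computable_funpow [computable_intros]:
  fixes f :: "'a::enc \<Rightarrow> 'b::enc \<Rightarrow> 'b"
  assumes "computable (\<lambda>p. f (fst p) (snd p))" "computable n" "computable z"
  shows "computable (\<lambda>x. (f x ^^ n x) (z x))"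
proof -
  have "computable (\<lambda>x. rec_nat (z x) (\<lambda>i. f x) (n x))"
    by (intro computable_intros computable_app2[OF assms(1)] assms(2,3))
  moreover have "rec_nat z (\<lambda>i. f) n = (f ^^ n) z" for f :: "'b \<Rightarrow> 'b" and n z
    by (induction n) auto
  ultimately show ?thesis by simp
qed

lemma computable_drop [computable_intros]:
  assumes "computable n" "computable xs"
  shows "computable (\<lambda>x. drop (n x) (xs x))"
proof -
  have "computable (\<lambda>x. (tl ^^ n x) (xs x))"
    by (intro computable_intros assms)
  moreover have "(tl ^^ n) xs = drop n xs" for n and xs :: "'b list"
    by (induction n) (auto simp: tl_drop drop_Suc)
  ultimately show ?thesis by simp
qed

lemma computable_take [computable_intros]:
  assumes "computable n" "computable xs"
  shows "computable (\<lambda>x. take (n x) (xs x))"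
proof -
  have "computable (\<lambda>x. rev (drop (length (xs x) - n x) (rev (xs x))))"
    by (intro computable_intros assms)
  moreover have "rev (drop (length ys - k) (rev ys)) = take k ys" for k and ys :: "'b list"
    by (cases "k \<le> length ys") (simp_all add: rev_drop)
  ultimately show ?thesis by simp
qed

lemma computable_upt_0 [computable_intros]:
  assumes "computable n"
  shows "computable (\<lambda>x. [0..<n x])"
proof -
  have "computable (\<lambda>x. rec_nat [] (\<lambda>i is. is @ [i]) (n x))"
    by (intro computable_intros assms)
  moreover have "rec_nat [] (\<lambda>i is. is @ [i]) n = [0..<n]" for n
    by (induction n) auto
  ultimately show ?thesis by simp
qed

lemma computable_replicate [computable_intros]:
  assumes "computable n" "computable f"
  shows "computable (\<lambda>x. replicate (n x) (f x))"
proof -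
  have "computable (\<lambda>x. map (\<lambda>i. f x) [0..<n x])"
    by (intro computable_intros assms(1) computable_comp[OF assms(2)])
  then show ?thesis by (simp add: map_replicate_const)
qed

lemma computable_sgn [computable_intros]:
  fixes f :: "'a::enc \<Rightarrow> real"
  assumes "computable f"
  shows "computable (\<lambda>x. sgn (f x))"
  unfolding sgn_if by (intro computable_intros assms)

text \<open>Serves to compare vectors of signs with those prescribed by a formula.\<close>

lemma computable_list_eq [computable_intros]:
  fixes xs ys :: "'a::enc \<Rightarrow> real list"
  assumes "computable xs" "computable ys"
  shows "computable (\<lambda>x. xs x = ys x)"
proof -
  define E :: "real list \<times> real list \<Rightarrow> bool" where "E = (\<lambda>(xs, ys). xs = ys)"
  have "computable E"
  proof (rule computable_rec)
    show "wf (Wellfounded.measure (\<lambda>p :: real list \<times> real list. length (fst p)))" by simp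
    show "E p = (if (case fst p of [] \<Rightarrow> True | a # as \<Rightarrow> False) \<or> (case snd p of [] \<Rightarrow> True | a # as \<Rightarrow> False) then
          (case fst p of [] \<Rightarrow> (case snd p of [] \<Rightarrow> True | a # as \<Rightarrow> False) | a # as \<Rightarrow> False)
        else (\<lambda>q. case fst (fst q) of [] \<Rightarrow> False | a # as \<Rightarrow>
          (case snd (fst q) of [] \<Rightarrow> False | b # bs \<Rightarrow>
            a = b \<and> (case snd q of [] \<Rightarrow> False | w # ws \<Rightarrow> w)))
        (p, map E [(tl (fst p), tl (snd p))]))" for p
      by (auto simp: E_def split: list.splits)
  qed (intro computable_intros | (auto split: list.splits)[1])+
  from computable_comp[OF this computable_Pair[OF assms]]
  show ?thesis by (simp add: E_def)
qed

section \<open>Signs of univariate polynomials\<close>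

text \<open>Coefficient lists of univariate polynomials start with the leading coefficient.\<close>

primrec hev :: "real list \<Rightarrow> real \<Rightarrow> real" where
  "hev [] x = 0"
| "hev (a # p) x = a * x ^ length p + hev p x"

primrec hderiv :: "real list \<Rightarrow> real list" where
  "hderiv [] = []"
| "hderiv (a # p) = (if p = [] then [] else real (length p) * a # hderiv p)"

lemma hev_eq_poly: "hev p x = poly (Poly (rev p)) x"
  by (induction p) (simp_all add: Poly_snoc poly_monom)

lemma length_hderiv [simp]: "length (hderiv p) = length p - 1"
  by (induction p) auto

lemma DERIV_hev: "(hev p has_real_derivative hev (hderiv p) x) (at x)"
proof (induction p)
  case (Cons a p)
  show ?case
  proof (cases "p = []")
    case False
    have "((\<lambda>x. a * x ^ length p + hev p x) has_real_derivative
        a * (real (length p) * x ^ (length p - 1)) + hev (hderiv p) x) (at x)"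
      by (rule derivative_eq_intros Cons.IH refl | simp)+
    with False show ?thesis by (simp add: mult_ac cong: if_cong)
  qed (simp add: hev.simps[abs_def])
qed (simp add: hev.simps[abs_def])

lemma finite_zeros_hev:
  assumes "p \<noteq> []" "hd p \<noteq> 0"
  shows "finite {x. hev p x = 0}"
proof -
  have "Poly (rev p) \<noteq> 0"
  proof
    assume "Poly (rev p) = 0"
    then have "coeff (Poly (rev p)) (length p - 1) = 0" by simp
    then show False
      using assms by (cases p) (simp_all add: nth_default_def nth_append)
  qed
  then show ?thesis
    unfolding hev_eq_poly by (rule poly_roots_finite)
qed

text \<open>The degree is at most \<open>length p - 1\<close>; the additional factor |x| on the left
  avoids this exponent, whose subtraction would be truncated for the empty list.\<close>

lemma hev_bound: "\<exists>C\<ge>0. \<forall>x. 1 \<le> \<bar>x\<bar> \<longrightarrow> \<bar>hev p x\<bar> * \<bar>x\<bar> \<le> C * \<bar>x\<bar> ^ length p"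
proof (induction p)
  case (Cons a p)
  then obtain C where C: "C \<ge> 0" "\<And>x. 1 \<le> \<bar>x\<bar> \<Longrightarrow> \<bar>hev p x\<bar> * \<bar>x\<bar> \<le> C * \<bar>x\<bar> ^ length p"
    by blast
  have "\<bar>hev (a # p) x\<bar> * \<bar>x\<bar> \<le> (\<bar>a\<bar> + C) * \<bar>x\<bar> ^ length (a # p)" if x: "1 \<le> \<bar>x\<bar>" for x
  proof -
    have "\<bar>hev (a # p) x\<bar> * \<bar>x\<bar> \<le> (\<bar>a * x ^ length p\<bar> + \<bar>hev p x\<bar>) * \<bar>x\<bar>"
      by (intro mult_right_mono) auto
    also have "\<dots> \<le> \<bar>a\<bar> * \<bar>x\<bar> ^ length (a # p) + C * \<bar>x\<bar> ^ length p"
      using C(2)[OF x] by (simp add: algebra_simps abs_mult power_abs)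
    also have "C * \<bar>x\<bar> ^ length p \<le> C * \<bar>x\<bar> ^ length (a # p)"
      by (intro mult_left_mono power_increasing x C) simp_all
    finally show ?thesis by (simp add: algebra_simps)
  qed
  then show ?case using C(1) by (intro exI[of _ "\<bar>a\<bar> + C"]) auto
qed auto

lemma sgn_hev_at_infinity:
  assumes "a \<noteq> 0"
  shows "\<exists>N>0. \<forall>x. N \<le> \<bar>x\<bar> \<longrightarrow> sgn (hev (a # p) x) = sgn a * sgn x ^ length p"
proof -
  obtain C where C: "C \<ge> 0" "\<And>x. 1 \<le> \<bar>x\<bar> \<Longrightarrow> \<bar>hev p x\<bar> * \<bar>x\<bar> \<le> C * \<bar>x\<bar> ^ length p"
    using hev_bound by blast
  \<comment> \<open>Beyond this bound |x| is at least 1, as the estimate for \<open>hev p\<close>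
    requires, and C < |a| |x|, so the leading term dominates the rest.\<close>
  define N where "N = 1 + C / \<bar>a\<bar>"
  have "sgn (hev (a # p) x) = sgn a * sgn x ^ length p" if "N \<le> \<bar>x\<bar>" for x
  proof -
    from that have x: "1 \<le> \<bar>x\<bar>" "C / \<bar>a\<bar> < \<bar>x\<bar>"
      using C(1) by (auto simp: N_def intro: order_trans[rotated])
    then have "C < \<bar>a\<bar> * \<bar>x\<bar>"
      using assms by (simp add: field_simps)
    then have "C * \<bar>x\<bar> ^ length p < (\<bar>a\<bar> * \<bar>x\<bar>) * \<bar>x\<bar> ^ length p"
      using x by (intro mult_strict_right_mono) auto
    with C(2)[OF x(1)] have "\<bar>hev p x\<bar> * \<bar>x\<bar> < \<bar>a * x ^ length p\<bar> * \<bar>x\<bar>"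
      by (simp add: abs_mult power_abs mult_ac)
    then have "\<bar>hev p x\<bar> < \<bar>a * x ^ length p\<bar>"
      by (rule mult_right_less_imp_less) simp
    moreover have "sgn (u + v) = sgn u" if "\<bar>v\<bar> < \<bar>u\<bar>" for u v :: real
      using that by (auto simp: sgn_if)
    ultimately have "sgn (a * x ^ length p + hev p x) = sgn (a * x ^ length p)"
      by blast
    moreover have "sgn (x ^ n) = sgn x ^ n" for n
      by (induction n) (simp_all add: sgn_mult)
    ultimately show ?thesis by (simp add: sgn_mult)
  qed
  moreover have "N > 0" using C(1) by (simp add: N_def add_pos_nonneg)
  ultimately show ?thesis by blast
qed

text \<open>By Rolle \<open>f\<close> is injective on the closed interval, hence strictly monotone:
  it has one zero inside if the end signs are opposite, and at most one end sign is zero otherwise.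
  The cell \<open>S\<close> may be unbounded; \<open>a\<close> and \<open>b\<close> are then points
  beyond which the sign on \<open>S\<close> is already constant, which is what the second halves of
  the assumptions on the two ends express.\<close>

lemma sgn_between_roots_of_derivative:
  fixes f f' :: "real \<Rightarrow> real"
  assumes deriv: "\<And>x. (f has_real_derivative f' x) (at x)"
    and nz: "\<And>x. a < x \<Longrightarrow> x < b \<Longrightarrow> f' x \<noteq> 0"
    and ab: "a < b"
    and S: "{a<..<b} \<subseteq> S"
    and l: "sgn (f a) = sl" "\<And>x. x \<in> S \<Longrightarrow> x \<le> a \<Longrightarrow> sgn (f x) = sl \<and> sl \<noteq> 0"
    and r: "sgn (f b) = sr" "\<And>x. x \<in> S \<Longrightarrow> b \<le> x \<Longrightarrow> sgn (f x) = sr \<and> sr \<noteq> 0"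
  shows "if sl * sr < 0
    then \<exists>u\<in>S. f u = 0 \<and> (\<forall>x\<in>S. x < u \<longrightarrow> sgn (f x) = sl) \<and> (\<forall>x\<in>S. u < x \<longrightarrow> sgn (f x) = sr)
    else \<forall>x\<in>S. sgn (f x) = (if sl \<noteq> 0 then sl else sr)"
proof -
  have cont: "continuous_on T f" for T
    by (rule DERIV_continuous_on) (rule has_field_derivative_at_within[OF deriv])
  have "f x \<noteq> f y" if "a \<le> x" "x < y" "y \<le> b" for x y
  proof
    assume "f x = f y"
    \<comment> \<open>Rolle's theorem is applied to the derivative as a linear map; that map is zero
      at \<open>z\<close>, and its value at 1 is \<open>f' z\<close>.\<close>
    then obtain z where "x < z" "z < y" "f' z = 0"
      using Rolle_deriv[of x y f "\<lambda>x h. f' x * h"] cont deriv \<open>x < y\<close>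
      by (auto simp: has_field_derivative_def fun_eq_iff dest: spec[of _ 1])
    then show False using nz[of z] that by auto
  qed
  then have inj: "inj_on f {a..b}"
    by (intro linorder_inj_onI) auto
  have mono: "(f c < f x \<and> f x < f d) \<or> (f d < f x \<and> f x < f c)"
    if "a \<le> c" "c < x" "x < d" "d \<le> b" for c x d
    using that by (intro continuous_inj_imp_mono cont inj_on_subset[OF inj]) auto
  show ?thesis
  proof (cases "sl * sr < 0")
    case True
    then have "f a < 0 \<and> 0 < f b \<or> 0 < f a \<and> f b < 0"
      using l(1) r(1) by (auto simp: sgn_if split: if_splits)
    then obtain u where u: "a \<le> u" "u \<le> b" "f u = 0"
      using IVT'[of f a 0 b] IVT2'[of f b 0 a] cont ab by (meson less_imp_le)
    have "u \<noteq> a" "u \<noteq> b"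
      using True l(1) r(1) u by auto
    with u have u': "a < u" "u < b" by auto
    have "sgn (f x) = sl" if "x \<in> S" "x < u" for x
    proof (cases "x \<le> a")
      case False
      with mono[of a x u] u u' that l(1) show ?thesis by (auto simp: sgn_if)
    qed (use l that in auto)
    moreover have "sgn (f x) = sr" if "x \<in> S" "u < x" for x
    proof (cases "b \<le> x")
      case False
      with mono[of u x b] u u' that r(1) show ?thesis by (auto simp: sgn_if)
    qed (use r that in auto)
    moreover have "u \<in> S" using u' S by auto
    ultimately show ?thesis using True u(3) by (simp only: if_True) blast
  next
    case False
    have "sgn (f x) = (if sl \<noteq> 0 then sl else sr)" if "x \<in> S" for x
    proof -
      consider "x \<le> a" | "a < x" "x < b" | "b \<le> x" by linarith
      then show ?thesis
      proof cases
        case 1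
        with l that show ?thesis by auto
      next
        case 2
        with mono[of a x b] False l(1) r(1) show ?thesis
          by (auto simp: sgn_if zero_less_mult_iff mult_less_0_iff split: if_splits)
      next
        case 3
        with r(2)[OF that] r(1) l(1) False show ?thesis
          by (auto simp: sgn_if split: if_splits)
      qed
    qed
    with False show ?thesis by auto
  qed
qed

section \<open>Sign diagrams on the real line\<close>

text \<open>
  \<open>diagram c p A I D\<close>: the points in \<open>D\<close>, with labels given by \<open>p\<close>, cut the upper ray \<open>A\<close> into open
  intervals on which \<open>c\<close> is constant; \<open>I\<close> is its value on the first of them, and each point in \<open>D\<close> comes
  with the value on the interval to its right.
\<close>

primrec diagram :: "(real \<Rightarrow> 'a) \<Rightarrow> (real \<Rightarrow> 'b) \<Rightarrow> real set \<Rightarrow> 'a \<Rightarrow> ('b \<times> 'a) list \<Rightarrow> bool" where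
  "diagram c p A I [] = (\<forall>x\<in>A. c x = I)"
| "diagram c p A I (PJ # D) =
    (\<exists>t\<in>A. (\<forall>x\<in>A. x < t \<longrightarrow> c x = I) \<and> p t = fst PJ \<and> diagram c p {t<..} (snd PJ) D)"

definition upper_ray :: "real set \<Rightarrow> bool"
  where "upper_ray A \<longleftrightarrow> A = UNIV \<or> (\<exists>a. A = {a<..})"

lemma upper_ray_UNIV [simp]: "upper_ray UNIV" and upper_ray_greaterThan [simp]: "upper_ray {a<..}"
  by (auto simp: upper_ray_def)

lemma diagram_map:
  "diagram c p A I D \<Longrightarrow> diagram (\<lambda>x. f (c x)) (\<lambda>x. g (p x)) A (f I) (map (map_prod g f) D)"
  by (induction D arbitrary: A I) (auto intro!: bexI)

lemma diagram_cong:
  assumes "\<And>x. c x = c' x" "\<And>x. p x = p' x"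
  shows "diagram c p A I D = diagram c' p' A I D"
proof -
  have "c = c'" "p = p'" using assms by auto
  then show ?thesis by simp
qed

text \<open>Upper rays are open, so every interval of a diagram is nonempty and each listed value is
  really attained.\<close>

lemma diagram_values:
  assumes "diagram c c A I D" "upper_ray A"
  shows "c ` A = set (I # concat (map (\<lambda>PJ. [fst PJ, snd PJ]) D))"
  using assms
proof (induction D arbitrary: A I)
  case Nil
  then have "A \<noteq> {}" unfolding upper_ray_def using gt_ex by fastforce
  with Nil show ?case by auto
next
  case (Cons PJ D)
  then obtain t where t: "t \<in> A" "\<forall>x\<in>A. x < t \<longrightarrow> c x = I" "c t = fst PJ"
    "diagram c c {t<..} (snd PJ) D" by auto
  obtain s where s: "s \<in> A" "s < t"
    using Cons.prems(2) t(1) lt_ex dense unfolding upper_ray_def by blast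
  have "A = {x \<in> A. x < t} \<union> {t} \<union> {t<..}"
    using t(1) Cons.prems(2) unfolding upper_ray_def by force
  then have "c ` A = c ` {x \<in> A. x < t} \<union> {c t} \<union> c ` {t<..}" by blast
  also have "c ` {x \<in> A. x < t} = {I}" using s t by auto
  finally show ?case using Cons.IH[OF t(4)] t(3) by auto
qed

lemma diagram_initial:
  assumes "diagram c p {t<..} I D"
  shows "\<exists>s>t. \<forall>x. t < x \<and> x < s \<longrightarrow> c x = I"
proof (cases D)
  case Nil
  with assms show ?thesis by (auto intro: exI[of _ "t + 1"])
qed (use assms in auto)

lemma diagram_extend:
  assumes "diagram c p {t<..} I D" "upper_ray A" "t \<in> A" "\<And>x. x \<in> A \<Longrightarrow> x \<le> t \<Longrightarrow> c x = I"
  shows "diagram c p A I D"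
proof (cases D)
  case Nil
  with assms show ?thesis by (force simp: not_le[symmetric])
next
  case (Cons PJ D')
  with assms obtain u where u: "t < u" "\<forall>x. t < x \<and> x < u \<longrightarrow> c x = I" "p u = fst PJ"
    "diagram c p {u<..} (snd PJ) D'" by auto
  have "u \<in> A" using u(1) assms(2,3) unfolding upper_ray_def by auto
  moreover have "c x = I" if "x \<in> A" "x < u" for x
    using assms(4)[OF that(1)] u(2) that(2) by (cases "x \<le> t") auto
  ultimately show ?thesis using u Cons by auto
qed

lemma diagram_filter:
  assumes "diagram c p A I D" "upper_ray A"
    and const: "\<And>t. \<not> z (p t) \<Longrightarrow> eventually (\<lambda>x. c x = c t) (at t)"
  shows "diagram c p A I (filter (\<lambda>PJ. z (fst PJ)) D)"
  using assms(1,2)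
proof (induction D arbitrary: A I)
  case (Cons PJ D)
  then obtain t where t: "t \<in> A" "\<forall>x\<in>A. x < t \<longrightarrow> c x = I" "p t = fst PJ"
    "diagram c p {t<..} (snd PJ) D" by auto
  note IH = Cons.IH[OF t(4)]
  show ?case
  proof (cases "z (fst PJ)")
    case True
    with IH t show ?thesis by auto
  next
    case False
    then obtain d where d: "d > 0" "\<And>x. x \<noteq> t \<Longrightarrow> dist x t < d \<Longrightarrow> c x = c t"
      using const[of t] t(3) unfolding eventually_at by auto
    obtain s where s: "s > t" "\<And>x. t < x \<Longrightarrow> x < s \<Longrightarrow> c x = snd PJ"
      using diagram_initial[OF t(4)] by blast
    \<comment> \<open>A point to the right of \<open>t\<close> that lies both in the next interval
      and within distance \<open>d\<close>; \<open>y\<close> below is its counterpart on the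
      left.\<close>
    define x where "x = min ((t + s) / 2) (t + d / 2)"
    have "t < x" "x < s" "dist x t < d"
      using s(1) d(1) by (auto simp: x_def dist_real_def min_def field_simps)
    then have J: "c t = snd PJ"
      using d(2)[of x] s(2)[of x] by simp
    obtain r where r: "r \<in> A" "r < t"
      using Cons.prems(2) t(1) lt_ex dense unfolding upper_ray_def by blast
    define y where "y = max ((r + t) / 2) (t - d / 2)"
    have y: "r < y" "y < t" "dist y t < d"
      using r(2) d(1) by (auto simp: y_def dist_real_def max_def field_simps)
    then have "y \<in> A" using r(1) Cons.prems(2) unfolding upper_ray_def by auto
    then have I: "c t = I"
      using d(2)[of y] t(2) y by auto
    have "diagram c p A (snd PJ) (filter (\<lambda>PJ. z (fst PJ)) D)"
      using diagram_extend[OF IH Cons.prems(2) t(1)] t(2) I J by (auto simp: le_less)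
    with I J False show ?thesis by simp
  qed
qed auto

text \<open>
  The cells of an interval on which the signs \<open>r\<close> are constant and a further, strictly monotone function
  has the signs \<open>sl\<close> and \<open>sr\<close> at the ends.
\<close>

definition segment :: "real \<Rightarrow> real \<Rightarrow> real list \<Rightarrow> real list \<times> (real list \<times> real list) list"
  where "segment sl sr r =
    (if sl * sr < 0 then (sl # r, [(0 # r, sr # r)]) else ((if sl \<noteq> 0 then sl else sr) # r, []))"

text \<open>Lets minus infinity play the role of a left end point. A nonzero sign is demanded only
  there, because a finite end point may be a root of \<open>f\<close>.\<close>

definition left_sign :: "(real \<Rightarrow> real) \<Rightarrow> real set \<Rightarrow> real \<Rightarrow> bool"
  where "left_sign f A s \<longleftrightarrow>
    A = UNIV \<and> s \<noteq> 0 \<and> (\<exists>N. \<forall>x\<le>N. sgn (f x) = s) \<or> (\<exists>a. A = {a<..} \<and> sgn (f a) = s)"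

lemma left_sign_imp_upper_ray: "left_sign f A s \<Longrightarrow> upper_ray A"
  by (auto simp: left_sign_def upper_ray_def)

lemma left_signE:
  assumes "left_sign f A s" "t \<in> A"
  obtains a where "a < t" "{a<..} \<subseteq> A" "sgn (f a) = s" "\<And>x. x \<in> A \<Longrightarrow> x \<le> a \<Longrightarrow> sgn (f x) = s \<and> s \<noteq> 0"
proof -
  from assms(1) consider N where "A = UNIV" "s \<noteq> 0" "\<forall>x\<le>N. sgn (f x) = s"
    | a where "A = {a<..}" "sgn (f a) = s"
    unfolding left_sign_def by blast
  then show thesis
  proof cases
    case 1
    then show thesis by (intro that[of "min N (t - 1)"]) auto
  next
    case 2
    with assms(2) show thesis by (intro that[of a]) auto
  qed
qed

text \<open>One step of the refinement, from right to left: beyond \<open>t\<close> the diagram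
  \<open>D\<close> already accounts for the roots of \<open>f\<close>, and the interval of
  \<open>A\<close> before \<open>t\<close> is now split at the root of \<open>f\<close>, if it has
  one.\<close>

lemma diagram_segment:
  assumes deriv: "\<And>x. (f has_real_derivative f' x) (at x)"
    and left: "left_sign f A sl" and t: "t \<in> A" "sgn (f t) = sr"
    and nz: "\<And>x. x \<in> A \<Longrightarrow> x < t \<Longrightarrow> f' x \<noteq> 0"
    and R: "\<And>x. x \<in> A \<Longrightarrow> x < t \<Longrightarrow> R x = r"
    and D: "diagram c c {t<..} J D" and c: "\<And>x. c x = sgn (f x) # R x"
  shows "diagram c c A (fst (segment sl sr r)) (snd (segment sl sr r) @ (c t, J) # D)"
proof -
  from left t(1) obtain a where a: "a < t" "{a<..} \<subseteq> A" "sgn (f a) = sl"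
    "\<And>x. x \<in> A \<Longrightarrow> x \<le> a \<Longrightarrow> sgn (f x) = sl \<and> sl \<noteq> 0"
    by (rule left_signE) blast
  have *: "if sl * sr < 0
    then \<exists>u\<in>{x\<in>A. x < t}. f u = 0 \<and> (\<forall>x\<in>{x\<in>A. x < t}. x < u \<longrightarrow> sgn (f x) = sl) \<and>
      (\<forall>x\<in>{x\<in>A. x < t}. u < x \<longrightarrow> sgn (f x) = sr)
    else \<forall>x\<in>{x\<in>A. x < t}. sgn (f x) = (if sl \<noteq> 0 then sl else sr)"
    by (rule sgn_between_roots_of_derivative[OF deriv, of a t]) (use a t nz in auto)
  show ?thesis
  proof (cases "sl * sr < 0")
    case True
    with * obtain u where u: "u \<in> A" "u < t" "f u = 0" "\<And>x. x \<in> A \<Longrightarrow> x < t \<Longrightarrow> x < u \<Longrightarrow> sgn (f x) = sl"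
      "\<And>x. x \<in> A \<Longrightarrow> x < t \<Longrightarrow> u < x \<Longrightarrow> sgn (f x) = sr"
      by auto
    have A: "x \<in> A" if "u < x" for x
      using u(1) left_sign_imp_upper_ray[OF left] that by (auto simp: upper_ray_def)
    show ?thesis
      unfolding segment_def if_P[OF True] fst_conv snd_conv append.simps diagram.simps fst_conv snd_conv
    proof (rule bexI[of _ u], intro conjI)
      show "\<forall>x\<in>A. x < u \<longrightarrow> c x = sl # r" using u(2,4) R by (auto simp: c)
      show "c u = 0 # r" using u(1-3) R by (simp add: c)
      have "\<forall>x\<in>{u<..}. x < t \<longrightarrow> c x = sr # r" using u(5) A R by (auto simp: c)
      then show "\<exists>t'\<in>{u<..}. (\<forall>x\<in>{u<..}. x < t' \<longrightarrow> c x = sr # r) \<and> c t' = c t \<and> diagram c c {t'<..} J D"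
        using D u(2) by blast
    qed (use u in auto)
  next
    case False
    then have "c x = (if sl \<noteq> 0 then sl else sr) # r" if "x \<in> A" "x < t" for x
      using * that R by (simp only: if_False c) simp
    then show ?thesis
      unfolding segment_def if_not_P[OF False] fst_conv snd_conv append.simps diagram.simps fst_conv snd_conv
      using D t(1) by blast
  qed
qed

text \<open>On the unbounded interval the sign of \<open>f\<close> near infinity takes the place of
  a sign at a right end point; \<open>max t N\<close> serves as such a point.\<close>

lemma diagram_last_segment:
  assumes deriv: "\<And>x. (f has_real_derivative f' x) (at x)"
    and left: "left_sign f A sl" and right: "sr \<noteq> 0" "\<And>x. N \<le> x \<Longrightarrow> sgn (f x) = sr"
    and nz: "\<And>x. x \<in> A \<Longrightarrow> f' x \<noteq> 0"
    and R: "\<And>x. x \<in> A \<Longrightarrow> R x = r"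
    and c: "\<And>x. c x = sgn (f x) # R x"
  shows "diagram c c A (fst (segment sl sr r)) (snd (segment sl sr r))"
proof -
  obtain t where t: "t \<in> A" using left_sign_imp_upper_ray[OF left] gt_ex unfolding upper_ray_def by blast
  from left t(1) obtain a where a: "a < t" "{a<..} \<subseteq> A" "sgn (f a) = sl"
    "\<And>x. x \<in> A \<Longrightarrow> x \<le> a \<Longrightarrow> sgn (f x) = sl \<and> sl \<noteq> 0"
    by (rule left_signE) blast
  have *: "if sl * sr < 0
    then \<exists>u\<in>A. f u = 0 \<and> (\<forall>x\<in>A. x < u \<longrightarrow> sgn (f x) = sl) \<and>
      (\<forall>x\<in>A. u < x \<longrightarrow> sgn (f x) = sr)
    else \<forall>x\<in>A. sgn (f x) = (if sl \<noteq> 0 then sl else sr)"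
    by (rule sgn_between_roots_of_derivative[OF deriv, of a "max t N"]) (use a t right nz in auto)
  show ?thesis
  proof (cases "sl * sr < 0")
    case True
    with * obtain u where u: "u \<in> A" "f u = 0" "\<And>x. x \<in> A \<Longrightarrow> x < u \<Longrightarrow> sgn (f x) = sl"
      "\<And>x. x \<in> A \<Longrightarrow> u < x \<Longrightarrow> sgn (f x) = sr"
      by auto
    have A: "x \<in> A" if "u < x" for x
      using u(1) left_sign_imp_upper_ray[OF left] that by (auto simp: upper_ray_def)
    show ?thesis
      unfolding segment_def if_P[OF True] fst_conv snd_conv append.simps diagram.simps fst_conv snd_conv
    proof (intro bexI[of _ u] conjI)
      show "\<forall>x\<in>A. x < u \<longrightarrow> c x = sl # r" using u(3) R by (auto simp: c)
      show "\<forall>x\<in>{u<..}. c x = sr # r" using u(4) A R by (auto simp: c)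
      show "c u = 0 # r" using u(1,2) R by (simp add: c)
    qed (use u in auto)
  next
    case False
    then have "c x = (if sl \<noteq> 0 then sl else sr) # r" if "x \<in> A" for x
      using * that R by (simp only: if_False c)
    then show ?thesis
      unfolding segment_def if_not_P[OF False] fst_conv snd_conv diagram.simps by blast
  qed
qed

text \<open>
  The columns of intervals start with the sign of the derivative, which is dropped; \<open>\<psi>\<close> and \<open>\<kappa>\<close> extract
  from the label of a point the sign of the new function and those of the old ones.  The first component
  of the result is the sign of the new function at the leftmost point, or \<open>s\<close> at infinity.
\<close>

definition insert_roots ::
    "(real list \<Rightarrow> real) \<Rightarrow> (real list \<Rightarrow> real list) \<Rightarrow> real \<Rightarrow> (real list \<times> real list) list \<Rightarrow>
      real \<times> (real list \<times> real list) list"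
  where "insert_roots \<psi> \<kappa> s D =
    foldr (\<lambda>PJ acc. (\<psi> (fst PJ),
      (\<psi> (fst PJ) # \<kappa> (fst PJ), fst (segment (\<psi> (fst PJ)) (fst acc) (tl (snd PJ)))) #
        snd (segment (\<psi> (fst PJ)) (fst acc) (tl (snd PJ))) @ snd acc)) D (s, [])"

text \<open>A cell on which the sign of \<open>f'\<close> is constant contains no zero of
  \<open>f'\<close>: it is infinite, whereas \<open>f'\<close> has only finitely many zeros. So
  \<open>f\<close> is strictly monotone on each interval of the given diagram, and the two preceding
  lemmas apply from right to left. The sign \<open>sl\<close> at the left end varies in the
  induction, as every point of \<open>D\<close> becomes the left end of the remaining ray.\<close>

lemma diagram_insert_roots:
  assumes deriv: "\<And>x. (f has_real_derivative f' x) (at x)"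
    and fin: "finite {x. f' x = 0}"
    and right: "sr \<noteq> 0" "\<And>x. N \<le> x \<Longrightarrow> sgn (f x) = sr"
    and c: "\<And>x. c x = sgn (f x) # R x"
    and z: "\<And>t. z (p t) \<Longrightarrow> \<psi> (p t) = sgn (f t)" and \<kappa>: "\<And>t. \<kappa> (p t) = R t"
  shows "diagram (\<lambda>x. sgn (f' x) # R x) p A I D \<Longrightarrow> (\<And>PJ. PJ \<in> set D \<Longrightarrow> z (fst PJ)) \<Longrightarrow>
    left_sign f A sl \<Longrightarrow>
    diagram c c A (fst (segment sl (fst (insert_roots \<psi> \<kappa> sr D)) (tl I)))
      (snd (segment sl (fst (insert_roots \<psi> \<kappa> sr D)) (tl I)) @ snd (insert_roots \<psi> \<kappa> sr D))"
proof (induction D arbitrary: A I sl)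
  case Nil
  have nz: "f' x \<noteq> 0" if "x \<in> A" for x
  proof
    assume "f' x = 0"
    have "f' y = 0" if "y \<in> A" for y
    proof -
      have "sgn (f' y) # R y = sgn (f' x) # R x"
        using bspec[OF Nil.prems(1)[unfolded diagram.simps]] that \<open>x \<in> A\<close> by metis
      then show ?thesis using \<open>f' x = 0\<close> by (simp add: sgn_zero_iff)
    qed
    then have "A \<subseteq> {x. f' x = 0}" by auto
    moreover have "infinite A"
      using left_sign_imp_upper_ray[OF Nil.prems(3)]
      by (auto simp: upper_ray_def infinite_UNIV_char_0 infinite_Ioi)
    ultimately show False using finite_subset[OF _ fin] by blast
  qed
  show ?case
    unfolding insert_roots_def foldr.simps id_apply fst_conv snd_conv append_Nil2
  proof (rule diagram_last_segment[OF deriv Nil.prems(3) right(1) right(2) nz _ c])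
    show "R x = tl I" if "x \<in> A" for x
      using bspec[OF Nil.prems(1)[unfolded diagram.simps] that] by (metis list.sel(3))
  qed
next
  case (Cons PJ D)
  from Cons.prems(1) obtain t where t: "t \<in> A" "\<And>x. x \<in> A \<Longrightarrow> x < t \<Longrightarrow> sgn (f' x) # R x = I" "p t = fst PJ"
    "diagram (\<lambda>x. sgn (f' x) # R x) p {t<..} (snd PJ) D"
    unfolding diagram.simps by blast
  have ray: "upper_ray A" using left_sign_imp_upper_ray[OF Cons.prems(3)] .
  have nz: "f' x \<noteq> 0" if "x \<in> A" "x < t" for x
  proof
    assume "f' x = 0"
    have "f' y = 0" if "y \<in> A" "y < t" for y
    proof -
      have "sgn (f' y) # R y = sgn (f' x) # R x"
        using t(2)[OF that] t(2)[OF \<open>x \<in> A\<close> \<open>x < t\<close>] by metis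
      then show ?thesis using \<open>f' x = 0\<close> by (simp add: sgn_zero_iff)
    qed
    then have "{x\<in>A. x < t} \<subseteq> {x. f' x = 0}" by auto
    moreover have "{x<..<t} \<subseteq> {x\<in>A. x < t}"
      using ray that unfolding upper_ray_def by auto
    moreover have "infinite {x<..<t}" using that(2) by (rule infinite_Ioo)
    ultimately show False using finite_subset[OF _ fin] by blast
  qed
  have sp: "\<psi> (fst PJ) = sgn (f t)" using z[of t] Cons.prems(2)[of PJ] unfolding t(3) by simp
  have ct: "c t = \<psi> (fst PJ) # \<kappa> (fst PJ)" using c sp \<kappa>[of t] t(3) by simp
  have left: "left_sign f {t<..} (\<psi> (fst PJ))" by (auto simp: left_sign_def sp)
  have "z (fst PJ')" if "PJ' \<in> set D" for PJ'
    using that by (intro Cons.prems(2)) simp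
  note IH = Cons.IH[OF t(4) this left]
  define acc where "acc = insert_roots \<psi> \<kappa> sr D"
  have acc: "insert_roots \<psi> \<kappa> sr (PJ # D) = (\<psi> (fst PJ),
      (c t, fst (segment (\<psi> (fst PJ)) (fst acc) (tl (snd PJ)))) #
        snd (segment (\<psi> (fst PJ)) (fst acc) (tl (snd PJ))) @ snd acc)"
    by (simp add: insert_roots_def acc_def ct)
  show ?case
    unfolding acc fst_conv snd_conv
  proof (rule diagram_segment[OF deriv Cons.prems(3) t(1) sp[symmetric] nz _ _ c])
    show "R x = tl I" if "x \<in> A" "x < t" for x
      using t(2)[OF that] by (metis list.sel(3))
  qed (simp_all only: IH acc_def)
qed

section \<open>Sign diagrams with parameters\<close>

text \<open>
  A polynomial is a sum of terms, in which a monomial is the list of its variables with repetitions.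
  Polynomials in a distinguished variable are lists of such coefficients.
\<close>

type_synonym mp = "(real \<times> nat list) list"

definition meval :: "(nat \<Rightarrow> real) \<Rightarrow> mp \<Rightarrow> real"
  where "meval \<rho> p = (\<Sum>t\<leftarrow>p. fst t * prod_list (map \<rho> (snd t)))"

definition mmul :: "mp \<Rightarrow> mp \<Rightarrow> mp"
  where "mmul p q = concat (map (\<lambda>s. map (\<lambda>t. (fst s * fst t, snd s @ snd t)) q) p)"

definition mscale :: "real \<Rightarrow> mp \<Rightarrow> mp"
  where "mscale r p = map (\<lambda>t. (r * fst t, snd t)) p"

lemma meval_Nil [simp]: "meval \<rho> [] = 0"
  by (simp add: meval_def)

lemma meval_Cons: "meval \<rho> (t # p) = fst t * prod_list (map \<rho> (snd t)) + meval \<rho> p"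
  by (simp add: meval_def)

lemma meval_append [simp]: "meval \<rho> (p @ q) = meval \<rho> p + meval \<rho> q"
  by (simp add: meval_def)

lemma meval_mscale [simp]: "meval \<rho> (mscale r p) = r * meval \<rho> p"
  by (induction p) (simp_all add: mscale_def meval_Cons algebra_simps)

lemma meval_mmul [simp]: "meval \<rho> (mmul p q) = meval \<rho> p * meval \<rho> q"
proof (induction p)
  case (Cons s p)
  have "meval \<rho> (map (\<lambda>t. (fst s * fst t, snd s @ snd t)) q) = fst s * prod_list (map \<rho> (snd s)) * meval \<rho> q"
    by (induction q) (simp_all add: meval_Cons algebra_simps)
  with Cons show ?case by (simp add: mmul_def meval_Cons algebra_simps)
qed (simp add: mmul_def)

definition uev :: "(nat \<Rightarrow> real) \<Rightarrow> mp list \<Rightarrow> real \<Rightarrow> real"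
  where "uev \<rho> p = hev (map (meval \<rho>) p)"

primrec uderiv :: "mp list \<Rightarrow> mp list" where
  "uderiv [] = []"
| "uderiv (a # p) = (if p = [] then [] else mscale (real (length p)) a # uderiv p)"

lemma map_meval_uderiv: "map (meval \<rho>) (uderiv p) = hderiv (map (meval \<rho>) p)"
  by (induction p) auto

lemma length_uderiv [simp]: "length (uderiv p) = length p - 1"
  by (induction p) auto

lemma DERIV_uev: "(uev \<rho> p has_real_derivative uev \<rho> (uderiv p) x) (at x)"
  unfolding uev_def map_meval_uderiv by (rule DERIV_hev)

section \<open>Pseudodivision with parametric coefficients\<close>

text \<open>
  Pseudodivision multiplies the dividend by the square of the leading coefficient \<open>b\<close> of the divisor,
  which leaves signs unchanged.
\<close>

fun combine :: "mp \<Rightarrow> mp \<Rightarrow> mp list \<Rightarrow> mp list \<Rightarrow> mp list" where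
  "combine a b [] q = []"
| "combine a b (x # p) [] = mmul (mmul b b) x # combine a b p []"
| "combine a b (x # p) (y # q) =
    (mmul (mmul b b) x @ mscale (-1) (mmul (mmul a b) y)) # combine a b p q"

lemma length_combine [simp]: "length (combine a b p q) = length p"
  by (induction a b p q rule: combine.induct) auto

text \<open>Here \<open>p\<close> and \<open>q\<close> are dividend and divisor without their
  leading coefficients \<open>a\<close> and \<open>b\<close>. With k and l their lengths, the
  leading terms cancel in b^2 (a x^k + p) - a b x^(k-l) (b x^l + q).\<close>

lemma uev_combine:
  "length q \<le> length p \<Longrightarrow> uev \<rho> (combine a b p q) x =
    meval \<rho> b ^ 2 * uev \<rho> p x - meval \<rho> a * meval \<rho> b * x ^ (length p - length q) * uev \<rho> q x"
proof (induction a b p q rule: combine.induct)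
  case (3 a b y p z q)
  have "x ^ length q * x ^ (length p - length q) = x ^ length p"
    using 3 by (simp add: power_add[symmetric])
  then have e: "x ^ (length p - length q) * (w * x ^ length q) = w * x ^ length p" for w
    by (metis mult.commute mult.assoc)
  show ?case
    using 3 by (simp add: uev_def power2_eq_square ring_distribs e mult.assoc)
qed (auto simp: uev_def power2_eq_square algebra_simps)

text \<open>For the empty divisor the step merely shortens the dividend, so that
  \<open>length_prem\<close> holds for every divisor; \<open>zero_sign\<close> and
  \<open>top_sign\<close> pass over empty polynomials.\<close>

definition pstep :: "mp list \<Rightarrow> mp list \<Rightarrow> mp list"
  where "pstep q p = (case q of [] \<Rightarrow> tl p | b # q' \<Rightarrow> (case p of [] \<Rightarrow> [] | a # p' \<Rightarrow> combine a b p' q'))"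

text \<open>Each step shortens a nonempty dividend by exactly one, even if its leading coefficient
  vanishes. The number of steps is thus independent of the parameters, and for a nonempty divisor no
  longer than the dividend it leaves \<open>length q - 1\<close> coefficients.\<close>

definition prem :: "mp list \<Rightarrow> mp list \<Rightarrow> mp list"
  where "prem q p = (pstep q ^^ (Suc (length p) - length q)) p"

lemma length_pstep [simp]: "length (pstep q p) = length p - 1"
  by (auto simp: pstep_def split: list.split)

lemma length_funpow_pstep [simp]: "length ((pstep q ^^ n) p) = length p - n"
  by (induction n) auto

lemma length_prem: "p \<noteq> [] \<Longrightarrow> length q \<le> length p \<Longrightarrow> length (prem q p) < length p"
  unfolding prem_def length_funpow_pstep by (cases p) auto

lemma uev_pstep:
  assumes "uev \<rho> (b # q) x = 0" "length q < length p"
  shows "uev \<rho> (pstep (b # q) p) x = meval \<rho> b ^ 2 * uev \<rho> p x"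
proof (cases p)
  case (Cons a p')
  with assms have len: "length q \<le> length p'" by simp
  have q: "uev \<rho> q x = - (meval \<rho> b * x ^ length q)"
    using assms(1) by (simp add: uev_def)
  have "x ^ (length p' - length q) * x ^ length q = x ^ length p'"
    using len by (simp add: power_add[symmetric])
  then have "x ^ (length p' - length q) * uev \<rho> q x = - (meval \<rho> b * x ^ length p')"
    by (simp add: q)
  then have e: "meval \<rho> a * meval \<rho> b * x ^ (length p' - length q) * uev \<rho> q x =
      meval \<rho> a * meval \<rho> b * - (meval \<rho> b * x ^ length p')"
    by (metis mult.assoc)
  have "uev \<rho> (pstep (b # q) p) x = meval \<rho> b ^ 2 * uev \<rho> p' x + meval \<rho> b ^ 2 * (meval \<rho> a * x ^ length p')"
    unfolding Cons pstep_def using uev_combine[OF len, of \<rho> a b x]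
    by (simp only: list.case e) (simp add: power2_eq_square algebra_simps)
  then show ?thesis by (simp add: Cons uev_def algebra_simps)
qed (use assms in simp)

lemma sgn_uev_prem:
  assumes "uev \<rho> (b # q) x = 0" "meval \<rho> b \<noteq> 0"
  shows "sgn (uev \<rho> (prem (b # q) p) x) = sgn (uev \<rho> p x)"
proof -
  have "n \<le> length p - length q \<Longrightarrow> sgn (uev \<rho> ((pstep (b # q) ^^ n) p) x) = sgn (uev \<rho> p x)" for n
  proof (induction n)
    case (Suc n)
    have "length q < length ((pstep (b # q) ^^ n) p)"
      unfolding length_funpow_pstep using Suc.prems by simp
    from uev_pstep[OF assms(1) this] show ?case
      using Suc assms(2) by (simp add: sgn_mult) (simp add: sgn_if)
  qed simp
  then show ?thesis by (simp add: prem_def)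
qed

section \<open>Case distinctions on the signs of leading coefficients\<close>

definition holds :: "(nat \<Rightarrow> real) \<Rightarrow> (mp \<times> real) list \<Rightarrow> bool"
  where "holds \<rho> cs \<longleftrightarrow> (\<forall>c\<in>set cs. sgn (meval \<rho> (fst c)) = snd c)"

lemma holds_simps [simp]:
  "holds \<rho> []" "holds \<rho> (c # cs) \<longleftrightarrow> sgn (meval \<rho> (fst c)) = snd c \<and> holds \<rho> cs"
  "holds \<rho> (cs @ cs') \<longleftrightarrow> holds \<rho> cs \<and> holds \<rho> cs'"
  by (auto simp: holds_def)

text \<open>
  Case distinctions on signs that depend on parameters are lists of pairs of a list of sign conditions
  and an outcome that is valid whenever these hold.  \<open>trim\<close> makes the leading coefficient nonzero and
  records its sign, which is \<open>0\<close> for the zero polynomial only.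
\<close>

primrec trim :: "mp list \<Rightarrow> ((mp \<times> real) list \<times> mp list \<times> real) list" where
  "trim [] = [([], [], 0)]"
| "trim (a # p) = ([(a, 1)], a # p, 1) # ([(a, -1)], a # p, -1) #
    map (\<lambda>t. ((a, 0) # fst t, snd t)) (trim p)"

primrec trims :: "mp list list \<Rightarrow> ((mp \<times> real) list \<times> (mp list \<times> real) list) list" where
  "trims [] = [([], [])]"
| "trims (p # ps) = concat (map (\<lambda>t. map (\<lambda>ts. (fst t @ fst ts, snd t # snd ts)) (trims ps)) (trim p))"

text \<open>For a nonempty list the recorded sign is nonzero, so the degree is exactly its length
  minus one and the signs at both infinities are determined.\<close>

definition known_sign :: "(nat \<Rightarrow> real) \<Rightarrow> mp list \<times> real \<Rightarrow> bool"
  where "known_sign \<rho> q \<longleftrightarrow>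
    (case fst q of [] \<Rightarrow> snd q = 0 | a # p \<Rightarrow> snd q \<noteq> 0 \<and> sgn (meval \<rho> a) = snd q)"

lemma trim_complete: "\<exists>t\<in>set (trim p). holds \<rho> (fst t)"
proof (induction p)
  case (Cons a p)
  have "sgn (meval \<rho> a) = 1 \<or> sgn (meval \<rho> a) = -1 \<or> sgn (meval \<rho> a) = 0"
    by (auto simp: sgn_if)
  with Cons show ?case by auto
qed auto

lemma trim_sound:
  "t \<in> set (trim p) \<Longrightarrow> holds \<rho> (fst t) \<Longrightarrow>
    known_sign \<rho> (snd t) \<and> uev \<rho> (fst (snd t)) = uev \<rho> p"
proof (induction p arbitrary: t)
  case (Cons a p)
  from Cons.prems consider "t = ([(a, 1)], a # p, 1)" | "t = ([(a, -1)], a # p, -1)"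
    | u where "u \<in> set (trim p)" "t = ((a, 0) # fst u, snd u)" by auto
  then show ?case
  proof cases
    case 3
    with Cons.prems have "meval \<rho> a = 0" "holds \<rho> (fst u)" by (auto simp: sgn_zero_iff)
    with Cons.IH[of u] 3 show ?thesis by (auto simp: uev_def fun_eq_iff)
  qed (use Cons.prems in \<open>auto simp: known_sign_def\<close>)
qed (auto simp: known_sign_def)

lemma length_trim: "t \<in> set (trim p) \<Longrightarrow> length (fst (snd t)) \<le> length p"
  by (induction p arbitrary: t) fastforce+

lemma trims_complete: "\<exists>t\<in>set (trims ps). holds \<rho> (fst t)"
proof (induction ps)
  case (Cons p ps)
  then obtain ts where ts: "ts \<in> set (trims ps)" "holds \<rho> (fst ts)" by blast
  from trim_complete obtain t where "t \<in> set (trim p)" "holds \<rho> (fst t)" by blast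
  with ts show ?case
    by (intro bexI[of _ "(fst t @ fst ts, snd t # snd ts)"]) auto
qed auto

lemma trims_sound:
  "t \<in> set (trims ps) \<Longrightarrow> holds \<rho> (fst t) \<Longrightarrow>
    (\<forall>q\<in>set (snd t). known_sign \<rho> q) \<and> map (\<lambda>q. uev \<rho> (fst q)) (snd t) = map (uev \<rho>) ps"
proof (induction ps arbitrary: t)
  case (Cons p ps)
  then obtain u us where u: "u \<in> set (trim p)" "us \<in> set (trims ps)" "t = (fst u @ fst us, snd u # snd us)"
    by auto
  with Cons.prems Cons.IH[of us] trim_sound[of u p \<rho>] show ?case by auto
qed auto

lemma length_trims:
  "t \<in> set (trims ps) \<Longrightarrow> q \<in> set (snd t) \<Longrightarrow> \<exists>p\<in>set ps. length (fst q) \<le> length p"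
proof (induction ps arbitrary: t)
  case (Cons p ps)
  then obtain u us where u: "u \<in> set (trim p)" "us \<in> set (trims ps)" "t = (fst u @ fst us, snd u # snd us)"
    by auto
  with Cons.prems(2) Cons.IH[of us] length_trim[of u p] show ?case by auto
qed auto

section \<open>The reduction step and its termination\<close>

definition max_length :: "(mp list \<times> real) list \<Rightarrow> nat"
  where "max_length qs = foldr (\<lambda>q n. if n < length (fst q) then length (fst q) else n) qs 0"

definition top_index :: "(mp list \<times> real) list \<Rightarrow> nat"
  where "top_index qs = length (takeWhile (\<lambda>q. length (fst q) < max_length qs) qs)"

definition top_poly :: "(mp list \<times> real) list \<Rightarrow> mp list \<times> real"
  where "top_poly qs = (case drop (top_index qs) qs of [] \<Rightarrow> ([], 0) | q # _ \<Rightarrow> q)"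

definition other_polys :: "(mp list \<times> real) list \<Rightarrow> (mp list \<times> real) list"
  where "other_polys qs = take (top_index qs) qs @ drop (Suc (top_index qs)) qs"

text \<open>The leading coefficient of the derivative is a positive multiple of that of a
  nonconstant polynomial, so its sign carries over without a new case distinction. The derivative
  stands first because \<open>insert_roots\<close> drops the head of each interval column.\<close>

definition lower_polys :: "(mp list \<times> real) list \<Rightarrow> (mp list \<times> real) list"
  where "lower_polys qs = (uderiv (fst (top_poly qs)), snd (top_poly qs)) # other_polys qs"

definition remainders :: "(mp list \<times> real) list \<Rightarrow> mp list list"
  where "remainders qs = map (\<lambda>q. prem (fst q) (fst (top_poly qs))) (lower_polys qs)"

type_synonym state = "(mp \<times> real) list \<times> (mp list \<times> real) list"

definition successors :: "state \<Rightarrow> state list"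
  where "successors S = map (\<lambda>t. (fst t @ fst S, lower_polys (snd S) @ snd t)) (trims (remainders (snd S)))"

lemma length_le_max_length: "q \<in> set qs \<Longrightarrow> length (fst q) \<le> max_length qs"
  by (induction qs) (auto simp: max_length_def)

lemma max_length_attained: "0 < max_length qs \<Longrightarrow> \<exists>q\<in>set qs. length (fst q) = max_length qs"
  by (induction qs) (auto simp: max_length_def split: if_splits)

lemma
  assumes "0 < max_length qs"
  shows split_at_top: "qs = take (top_index qs) qs @ top_poly qs # drop (Suc (top_index qs)) qs"
    and length_top_poly: "length (fst (top_poly qs)) = max_length qs"
    and top_index_less: "top_index qs < length qs"
proof -
  let ?P = "\<lambda>q :: mp list \<times> real. length (fst q) < max_length qs"
  have "dropWhile ?P qs \<noteq> []"
    using max_length_attained[OF assms] unfolding dropWhile_eq_Nil_conv by (metis less_irrefl)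
  then obtain q r where qr: "dropWhile ?P qs = q # r" by (cases "dropWhile ?P qs") auto
  then have "\<not> ?P q" by (metis hd_dropWhile list.sel(1) list.distinct(1))
  moreover have "q \<in> set qs" using qr by (metis list.set_intros(1) set_dropWhileD)
  ultimately have len: "length (fst q) = max_length qs" using length_le_max_length[of q qs] by simp
  have drop: "drop (top_index qs) qs = q # r"
    using qr by (simp add: top_index_def dropWhile_eq_drop)
  then have top: "top_poly qs = q" by (simp add: top_poly_def)
  show "length (fst (top_poly qs)) = max_length qs" using len top by simp
  show less: "top_index qs < length qs"
    using drop by (metis drop_all leI list.distinct(1))
  show "qs = take (top_index qs) qs @ top_poly qs # drop (Suc (top_index qs)) qs"
    using id_take_nth_drop[OF less] Cons_nth_drop_Suc[OF less] drop top by simp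
qed

text \<open>A successor has twice as many polynomials, but a longest one has been exchanged for
  shorter ones. This decreases the multiset of lengths, even if other polynomials of maximal length
  remain.\<close>

definition successor_rel :: "(state \<times> state) set"
  where "successor_rel = inv_image (mult less_than) (\<lambda>S. mset (map (\<lambda>q. length (fst q)) (snd S)))"

lemma wf_successor_rel: "wf successor_rel"
  unfolding successor_rel_def by (intro wf_inv_image wf_mult wf_less_than)

lemma successors_less:
  assumes "1 < max_length (snd S)" "T \<in> set (successors S)"
  shows "(T, S) \<in> successor_rel"
proof -
  let ?qs = "snd S" and ?l = "\<lambda>q :: mp list \<times> real. length (fst q)"
  let ?p = "fst (top_poly ?qs)"
  from assms(2) obtain t where t: "t \<in> set (trims (remainders ?qs))"
    "T = (fst t @ fst S, lower_polys ?qs @ snd t)"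
    by (auto simp: successors_def)
  have pos: "0 < max_length ?qs" using assms(1) by simp
  note split = split_at_top[OF pos] and len = length_top_poly[OF pos]
  have "set ?qs = set (take (top_index ?qs) ?qs @ top_poly ?qs # drop (Suc (top_index ?qs)) ?qs)"
    using split by simp
  then have sub: "set (other_polys ?qs) \<subseteq> set ?qs" by (auto simp: other_polys_def)
  have low: "?l q \<le> length ?p" if "q \<in> set (lower_polys ?qs)" for q
    using that sub length_le_max_length[of q ?qs] len by (auto simp: lower_polys_def)
  have rem: "length r < length ?p" if "r \<in> set (remainders ?qs)" for r
  proof -
    from that obtain q where "q \<in> set (lower_polys ?qs)" "r = prem (fst q) ?p"
      by (auto simp: remainders_def)
    moreover have "?p \<noteq> []" using len pos by auto
    ultimately show ?thesis using length_prem low by blast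
  qed
  have new: "?l q < length ?p" if "q \<in> set (snd t)" for q
    using length_trims[OF t(1) that] rem by fastforce
  have "mset (map ?l ?qs) = mset (map ?l (take (top_index ?qs) ?qs @ top_poly ?qs # drop (Suc (top_index ?qs)) ?qs))"
    using split by simp
  then have S: "mset (map ?l ?qs) = mset (map ?l (other_polys ?qs)) + {#length ?p#}"
    by (simp add: other_polys_def)
  have T: "mset (map ?l (snd T)) = mset (map ?l (other_polys ?qs)) +
      mset ((length ?p - 1) # map ?l (snd t))"
    by (simp add: t(2) lower_polys_def)
  have "(mset (map ?l (snd T)), mset (map ?l ?qs)) \<in> mult less_than"
    unfolding S T by (rule one_step_implies_mult) (use new len assms(1) in auto)
  then show ?thesis by (simp add: successor_rel_def)
qed

section \<open>Lifting a diagram to the polynomial of highest degree\<close>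

text \<open>
  Columns consist of the signs of \<open>lower_polys\<close> followed by those of \<open>remainders\<close>; where one of the former
  vanishes, the corresponding remainder has the sign of \<open>top_poly\<close>.  Points that are only roots of
  remainders have to be removed, because there the sign of \<open>top_poly\<close> is unknown.
\<close>

definition zero_sign :: "(mp list \<times> real) list \<Rightarrow> real list \<Rightarrow> bool"
  where "zero_sign qs c = list_ex (\<lambda>u. fst (fst u) \<noteq> [] \<and> snd u = 0) (zip qs c)"

definition top_sign :: "(mp list \<times> real) list \<Rightarrow> real list \<Rightarrow> real"
  where "top_sign qs c =
    foldr (\<lambda>u r. if fst (fst u) \<noteq> [] \<and> fst (snd u) = 0 then snd (snd u) else r)
      (zip qs (zip c (drop (length qs) c))) 0"

text \<open>Undoes the reordering by \<open>other_polys\<close>: the head of a column, the sign of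
  \<open>top_poly\<close>, returns to position \<open>i\<close>.\<close>

definition move_top :: "nat \<Rightarrow> real list \<Rightarrow> real list"
  where "move_top i c = take i (tl c) @ take 1 c @ drop i (tl c)"

type_synonym diag = "real list \<times> (real list \<times> real list) list"

text \<open>Interval columns are cut to the signs of \<open>lower_polys\<close>, while point labels
  keep those of the remainders, from which \<open>top_sign\<close> reads off the sign of
  \<open>top_poly\<close>. The recorded leading sign starts the fold as the sign at plus infinity;
  negated once per degree, it is the sign at minus infinity.\<close>

definition lift_diagram :: "(mp list \<times> real) list \<Rightarrow> diag \<Rightarrow> diag"
  where "lift_diagram qs D =
    (let n = length qs; L = lower_polys qs;
       acc = insert_roots (top_sign L) (\<lambda>c. tl (take n c)) (snd (top_poly qs))
         (filter (\<lambda>PJ. zero_sign L (fst PJ)) (map (\<lambda>PJ. (fst PJ, take n (snd PJ))) (snd D)));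
       seg = segment ((uminus ^^ (length (fst (top_poly qs)) - 1)) (snd (top_poly qs))) (fst acc)
         (tl (take n (fst D)))
     in (move_top (top_index qs) (fst seg),
         map (\<lambda>PJ. (move_top (top_index qs) (fst PJ), move_top (top_index qs) (snd PJ)))
           (snd seg @ snd acc)))"

definition column_of :: "(nat \<Rightarrow> real) \<Rightarrow> (mp list \<times> real) list \<Rightarrow> real \<Rightarrow> real list"
  where "column_of \<rho> qs x = map (\<lambda>q. sgn (uev \<rho> (fst q) x)) qs"

definition is_diagram :: "(nat \<Rightarrow> real) \<Rightarrow> (mp list \<times> real) list \<Rightarrow> diag \<Rightarrow> bool"
  where "is_diagram \<rho> qs D \<longleftrightarrow> diagram (column_of \<rho> qs) (column_of \<rho> qs) UNIV (fst D) (snd D)"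

lemma known_sign_Cons:
  "known_sign \<rho> q \<Longrightarrow> fst q \<noteq> [] \<Longrightarrow> \<exists>a p. fst q = a # p \<and> meval \<rho> a \<noteq> 0 \<and> snd q \<noteq> 0 \<and> sgn (meval \<rho> a) = snd q"
  by (cases "fst q") (auto simp: known_sign_def sgn_zero_iff)

lemma known_sign_lower:
  assumes "\<And>q. q \<in> set qs \<Longrightarrow> known_sign \<rho> q" "1 < max_length qs" "q \<in> set (lower_polys qs)"
  shows "known_sign \<rho> q"
proof -
  have pos: "0 < max_length qs" using assms(2) by simp
  have "set qs = set (take (top_index qs) qs @ top_poly qs # drop (Suc (top_index qs)) qs)"
    using split_at_top[OF pos] by simp
  then have sub: "set (other_polys qs) \<subseteq> set qs" "top_poly qs \<in> set qs" by (auto simp: other_polys_def)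
  obtain a b p where p: "fst (top_poly qs) = a # b # p"
    using length_top_poly[OF pos] assms(2)
    by (metis One_nat_def length_0_conv length_Cons less_irrefl list.exhaust not_less_zero)
  from assms(1)[OF sub(2)] have "known_sign \<rho> (uderiv (fst (top_poly qs)), snd (top_poly qs))"
    unfolding known_sign_def p by (simp add: sgn_mult)
  moreover from assms(3) have "q = (uderiv (fst (top_poly qs)), snd (top_poly qs)) \<or> q \<in> set qs"
    using sub(1) unfolding lower_polys_def by auto
  ultimately show ?thesis using assms(1) by blast
qed

lemma length_lower_polys:
  assumes "0 < max_length qs"
  shows "length (lower_polys qs) = length qs"
  using top_index_less[OF assms] by (simp add: lower_polys_def other_polys_def)

lemma move_top_column:
  assumes "0 < max_length qs"
  shows "move_top (top_index qs) (sgn (uev \<rho> (fst (top_poly qs)) x) # column_of \<rho> (other_polys qs) x) =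
    column_of \<rho> qs x"
proof -
  have "column_of \<rho> qs x = column_of \<rho> (take (top_index qs) qs @ top_poly qs # drop (Suc (top_index qs)) qs) x"
    using split_at_top[OF assms] by simp
  moreover have "min (length qs) (top_index qs) = top_index qs"
    using top_index_less[OF assms] by simp
  ultimately show ?thesis
    by (simp add: move_top_def column_of_def other_polys_def)
qed

lemma foldr_first_match:
  "\<exists>q\<in>set qs. P q \<Longrightarrow> (\<And>q. q \<in> set qs \<Longrightarrow> P q \<Longrightarrow> g q = v) \<Longrightarrow>
    foldr (\<lambda>q r. if P q then g q else r) qs w = v"
  by (induction qs) auto

text \<open>A nonzero value keeps its sign nearby by continuity. The empty polynomial vanishes
  everywhere, so its sign is locally constant too; this is one reason why \<open>zero_sign\<close>
  passes over it.\<close>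

lemma eventually_sgn_uev:
  assumes "p = [] \<or> uev \<rho> p t \<noteq> 0"
  shows "eventually (\<lambda>x. sgn (uev \<rho> p x) = sgn (uev \<rho> p t)) (at t)"
proof (cases "p = []")
  case True
  then show ?thesis by (simp add: uev_def)
next
  case False
  have "isCont (uev \<rho> p) t"
    using DERIV_isCont[OF DERIV_uev] .
  then have lim: "(uev \<rho> p \<longlongrightarrow> uev \<rho> p t) (at t)" by (simp add: isCont_def)
  show ?thesis
  proof (cases "0 < uev \<rho> p t")
    case True
    from order_tendstoD(1)[OF lim this] show ?thesis
      by eventually_elim (use True in simp)
  next
    case 2: False
    with assms False have "uev \<rho> p t < 0" by auto
    from order_tendstoD(2)[OF lim this] show ?thesis
      by eventually_elim (use \<open>uev \<rho> p t < 0\<close> in simp)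
  qed
qed

lemma eventually_column_of:
  assumes "\<And>q. q \<in> set qs \<Longrightarrow> fst q = [] \<or> uev \<rho> (fst q) t \<noteq> 0"
  shows "eventually (\<lambda>x. column_of \<rho> qs x = column_of \<rho> qs t) (at t)"
proof -
  have "eventually (\<lambda>x. \<forall>q\<in>set qs. sgn (uev \<rho> (fst q) x) = sgn (uev \<rho> (fst q) t)) (at t)"
    by (intro eventually_ball_finite ballI eventually_sgn_uev assms) simp_all
  then show ?thesis by (simp add: column_of_def)
qed

lemma sgn_uev_at_infinity:
  assumes "known_sign \<rho> q" "fst q \<noteq> []"
  shows "\<exists>N. \<forall>x\<ge>N. sgn (uev \<rho> (fst q) x) = snd q"
    and "\<exists>N. \<forall>x\<le>N. sgn (uev \<rho> (fst q) x) = (uminus ^^ (length (fst q) - 1)) (snd q)"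
proof -
  from known_sign_Cons[OF assms] obtain a p where p: "fst q = a # p" "meval \<rho> a \<noteq> 0" "sgn (meval \<rho> a) = snd q"
    by blast
  from sgn_hev_at_infinity[OF p(2), of "map (meval \<rho>) p"] obtain N
    where N: "N > 0" "\<And>x. N \<le> \<bar>x\<bar> \<Longrightarrow> sgn (uev \<rho> (fst q) x) = snd q * sgn x ^ length p"
    by (auto simp: uev_def p)
  have "sgn (uev \<rho> (fst q) x) = snd q" if "N \<le> x" for x
    using N(2)[of x] N(1) that by simp
  then show "\<exists>N. \<forall>x\<ge>N. sgn (uev \<rho> (fst q) x) = snd q" by blast
  have pow: "(uminus ^^ k) s = s * (-1) ^ k" for k and s :: real
    by (induction k) simp_all
  have "sgn (uev \<rho> (fst q) x) = (uminus ^^ (length (fst q) - 1)) (snd q)" if "x \<le> - N" for x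
    using N(2)[of x] N(1) that by (simp add: p pow)
  then show "\<exists>N. \<forall>x\<le>N. sgn (uev \<rho> (fst q) x) = (uminus ^^ (length (fst q) - 1)) (snd q)" by blast
qed

lemma is_diagram_lift_diagram:
  assumes known: "\<And>q. q \<in> set qs \<Longrightarrow> known_sign \<rho> q" and len: "1 < max_length qs"
    and gs: "map (\<lambda>q. uev \<rho> (fst q)) gs = map (uev \<rho>) (remainders qs)"
    and D: "is_diagram \<rho> (lower_polys qs @ gs) D"
  shows "is_diagram \<rho> qs (lift_diagram qs D)"
proof -
  have pos: "0 < max_length qs" using len by simp
  define L n C where "L = lower_polys qs" and "n = length qs" and "C = column_of \<rho> (L @ gs)"
  define q where "q = top_poly qs"
  define f f' R where "f = uev \<rho> (fst q)" and "f' = uev \<rho> (uderiv (fst q))" and "R = column_of \<rho> (other_polys qs)"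
  have nL: "length L = n" by (simp add: L_def n_def length_lower_polys[OF pos])
  have "q \<in> set qs" using split_at_top[OF pos] by (metis in_set_conv_decomp q_def)
  then have kq: "known_sign \<rho> q" by (rule known)
  have lq: "1 < length (fst q)" using length_top_poly[OF pos] len by (simp add: q_def)
  then have q_ne: "fst q \<noteq> []" by auto
  have kL: "known_sign \<rho> u" if "u \<in> set L" for u
    using known_sign_lower[OF known len] that by (simp add: L_def)
  have takeC: "take n (C x) = column_of \<rho> L x" for x
    by (simp add: C_def column_of_def nL)
  have colL: "column_of \<rho> L x = sgn (f' x) # R x" for x
    by (simp add: L_def lower_polys_def column_of_def f'_def R_def q_def)
  have "drop n (C x) = map (\<lambda>h. sgn (h x)) (map (\<lambda>q. uev \<rho> (fst q)) gs)" for x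
    by (simp add: C_def column_of_def nL)
  then have dropC: "drop n (C x) = map (\<lambda>u. sgn (uev \<rho> (prem (fst u) (fst q)) x)) L" for x
    by (simp add: gs remainders_def L_def q_def)
  have C: "C x = column_of \<rho> L x @ map (\<lambda>u. sgn (uev \<rho> (prem (fst u) (fst q)) x)) L" for x
    using append_take_drop_id[of n "C x"] by (simp add: takeC dropC)
  have zipL: "zip L (map g L) = map (\<lambda>u. (u, g u)) L" for g :: "mp list \<times> real \<Rightarrow> real"
    by (simp add: zip_map2 zip_same_conv_map)
  have zero: "zero_sign L (C x) \<longleftrightarrow> (\<exists>u\<in>set L. fst u \<noteq> [] \<and> uev \<rho> (fst u) x = 0)" for x
  proof -
    \<comment> \<open>\<open>zip\<close> stops at the end of \<open>L\<close>, so it sees only the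
      signs of \<open>L\<close> and not those of the remainders.\<close>
    have "zip L (C x) = zip L (column_of \<rho> L x)"
      unfolding C by (simp add: zip_append2 column_of_def)
    also have "\<dots> = map (\<lambda>u. (u, sgn (uev \<rho> (fst u) x))) L"
      unfolding column_of_def by (rule zipL)
    finally show ?thesis by (auto simp: zero_sign_def list_ex_iff sgn_zero_iff)
  qed
  have top: "top_sign L (C x) = sgn (f x)" if "zero_sign L (C x)" for x
  proof -
    have "zip (C x) (drop n (C x)) = zip (column_of \<rho> L x) (drop n (C x))"
      unfolding dropC unfolding C by (simp add: zip_append1 column_of_def)
    also have "\<dots> = map (\<lambda>u. (sgn (uev \<rho> (fst u) x), sgn (uev \<rho> (prem (fst u) (fst q)) x))) L"
      unfolding dropC column_of_def by (simp add: zip_map1 zip_map2 zip_same_conv_map)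
    finally have "zip L (zip (C x) (drop (length L) (C x))) =
        map (\<lambda>u. (u, sgn (uev \<rho> (fst u) x), sgn (uev \<rho> (prem (fst u) (fst q)) x))) L"
      by (simp add: nL zip_map2 zip_same_conv_map)
    then have "top_sign L (C x) = foldr (\<lambda>u r. if fst u \<noteq> [] \<and> sgn (uev \<rho> (fst u) x) = 0
        then sgn (uev \<rho> (prem (fst u) (fst q)) x) else r) L 0"
      by (simp add: top_sign_def foldr_map comp_def)
    \<comment> \<open>Every vanishing divisor yields the same sign, that of \<open>f\<close>, so the
      first one found may be used.\<close>
    also have "\<dots> = sgn (f x)"
    proof (rule foldr_first_match)
      show "\<exists>u\<in>set L. fst u \<noteq> [] \<and> sgn (uev \<rho> (fst u) x) = 0"
        using that by (auto simp: zero)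
      fix u assume u: "u \<in> set L" "fst u \<noteq> [] \<and> sgn (uev \<rho> (fst u) x) = 0"
      from known_sign_Cons[OF kL[OF u(1)]] u(2) obtain b p where "fst u = b # p" "meval \<rho> b \<noteq> 0" by blast
      with u(2) show "sgn (uev \<rho> (prem (fst u) (fst q)) x) = sgn (f x)"
        by (simp add: f_def sgn_uev_prem sgn_zero_iff)
    qed
    finally show ?thesis .
  qed
  define D' where "D' = filter (\<lambda>PJ. zero_sign L (fst PJ)) (map (\<lambda>PJ. (fst PJ, take n (snd PJ))) (snd D))"
  have "diagram C C UNIV (fst D) (snd D)"
    using D by (simp add: is_diagram_def C_def L_def)
  then have "diagram (\<lambda>x. take n (C x)) C UNIV (take n (fst D)) (map (map_prod (\<lambda>x. x) (take n)) (snd D))"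
    by (rule diagram_map)
  then have "diagram (column_of \<rho> L) C UNIV (take n (fst D)) (map (\<lambda>PJ. (fst PJ, take n (snd PJ))) (snd D))"
    by (simp add: takeC map_prod_def case_prod_unfold)
  \<comment> \<open>At a discarded point no nonempty polynomial of \<open>L\<close> vanishes, so the
    column of \<open>L\<close> is locally constant there.\<close>
  then have "diagram (column_of \<rho> L) C UNIV (take n (fst D)) D'"
    unfolding D'_def by (rule diagram_filter) (auto simp: zero intro: eventually_column_of)
  then have D': "diagram (\<lambda>x. sgn (f' x) # R x) C UNIV (take n (fst D)) D'"
    by (simp add: colL cong: diagram_cong)
  define sl where "sl = (uminus ^^ (length (fst q) - 1)) (snd q)"
  define acc where "acc = insert_roots (top_sign L) (\<lambda>c. tl (take n c)) (snd q) D'"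
  define seg where "seg = segment sl (fst acc) (tl (take n (fst D)))"
  define c where "c = (\<lambda>x. sgn (f x) # R x)"
  obtain N where N: "\<And>x. N \<le> x \<Longrightarrow> sgn (f x) = snd q"
    using sgn_uev_at_infinity(1)[OF kq q_ne] by (auto simp: f_def)
  have sq: "snd q \<noteq> 0" using known_sign_Cons[OF kq q_ne] by auto
  have "(uminus ^^ k) s \<noteq> 0" if "s \<noteq> 0" for k and s :: real
    using that by (induction k) auto
  then have left: "left_sign f UNIV sl"
    using sgn_uev_at_infinity(2)[OF kq q_ne] sq by (auto simp: left_sign_def sl_def f_def)
  have "known_sign \<rho> (uderiv (fst q), snd q)"
    by (rule kL) (simp add: L_def lower_polys_def q_def)
  moreover have "uderiv (fst q) \<noteq> []" using lq length_uderiv[of "fst q"] by (metis length_greater_0_conv zero_less_diff)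
  ultimately have "finite {x. f' x = 0}"
    unfolding f'_def uev_def using known_sign_Cons[of \<rho> "(uderiv (fst q), snd q)"]
    by (intro finite_zeros_hev) (auto simp: list.map_sel)
  then have "diagram c c UNIV (fst seg) (snd seg @ snd acc)"
    unfolding seg_def acc_def
    by (rule diagram_insert_roots[OF DERIV_uev[of \<rho> "fst q", folded f_def f'_def] _ sq N _ _ _ D' _ left,
          where z = "zero_sign L"])
      (auto simp: c_def takeC colL D'_def top)
  then have "diagram (\<lambda>x. move_top (top_index qs) (c x)) (\<lambda>x. move_top (top_index qs) (c x)) UNIV
      (move_top (top_index qs) (fst seg))
      (map (map_prod (move_top (top_index qs)) (move_top (top_index qs))) (snd seg @ snd acc))"
    by (rule diagram_map)
  moreover have "move_top (top_index qs) (c x) = column_of \<rho> qs x" for x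
    unfolding c_def f_def R_def q_def by (rule move_top_column[OF pos])
  ultimately show ?thesis
    by (simp add: is_diagram_def lift_diagram_def Let_def map_prod_def case_prod_unfold seg_def acc_def
        sl_def D'_def q_def n_def L_def)
qed

section \<open>The tree of sign cases\<close>

function cells :: "state \<Rightarrow> ((mp \<times> real) list \<times> diag) list" where
  "cells S = (if max_length (snd S) \<le> 1 then [(fst S, map snd (snd S), [])]
    else map (\<lambda>t. (fst t, lift_diagram (snd S) (snd t))) (concat (map cells (successors S))))"
  by auto
termination
  by (relation successor_rel) (auto intro: wf_successor_rel successors_less)

declare cells.simps [simp del]

text \<open>Conditions are only added on the way down. Those of a leaf thus imply those of every
  ancestor, which gives back the validity of the trims made on the path.\<close>

lemma cells_extends: "t \<in> set (cells S) \<Longrightarrow> holds \<rho> (fst t) \<Longrightarrow> holds \<rho> (fst S)"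
proof (induction S arbitrary: t rule: cells.induct)
  case (1 S)
  show ?case
  proof (cases "max_length (snd S) \<le> 1")
    case True
    with 1 show ?thesis by (subst (asm) (2) cells.simps) simp
  next
    case False
    with "1.prems" obtain T u where T: "T \<in> set (successors S)" "u \<in> set (cells T)" "fst t = fst u"
      by (subst (asm) cells.simps) auto
    with "1.IH"[OF False T(1,2)] "1.prems"(2) have "holds \<rho> (fst T)" by simp
    with T(1) show ?thesis by (auto simp: successors_def)
  qed
qed

lemma is_diagram_constants:
  assumes "max_length qs \<le> 1" "\<And>q. q \<in> set qs \<Longrightarrow> known_sign \<rho> q"
  shows "is_diagram \<rho> qs (map snd qs, [])"
proof -
  have "sgn (uev \<rho> (fst q) x) = snd q" if "q \<in> set qs" for q x
  proof -
    have "length (fst q) \<le> 1" using length_le_max_length[OF that] assms(1) by simp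
    with assms(2)[OF that] show ?thesis
      by (cases "fst q") (auto simp: known_sign_def uev_def)
  qed
  then show ?thesis by (simp add: is_diagram_def column_of_def)
qed

lemma cells_correct:
  assumes "holds \<rho> (fst S)" "\<And>q. q \<in> set (snd S) \<Longrightarrow> known_sign \<rho> q"
  shows "(\<exists>t\<in>set (cells S). holds \<rho> (fst t)) \<and>
    (\<forall>t\<in>set (cells S). holds \<rho> (fst t) \<longrightarrow> is_diagram \<rho> (snd S) (snd t))"
  using assms
proof (induction S rule: cells.induct)
  case (1 S)
  show ?case
  proof (cases "max_length (snd S) \<le> 1")
    case True
    with 1 show ?thesis by (subst (1 2) cells.simps) (simp add: is_diagram_constants)
  next
    case False
    have succ: "holds \<rho> (fst T) \<and> (\<forall>q\<in>set (snd T). known_sign \<rho> q) \<and>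
        map (\<lambda>q. uev \<rho> (fst q)) (snd u) = map (uev \<rho>) (remainders (snd S))"
      if u: "u \<in> set (trims (remainders (snd S)))" "holds \<rho> (fst u)"
        and T: "T = (fst u @ fst S, lower_polys (snd S) @ snd u)" for T u
      using trims_sound[OF u] u "1.prems" False known_sign_lower[OF "1.prems"(2)] by (auto simp: T)
    have cells: "cells S = map (\<lambda>t. (fst t, lift_diagram (snd S) (snd t))) (concat (map cells (successors S)))"
      using False by (subst cells.simps) simp
    show ?thesis
    proof (intro conjI ballI impI)
      from trims_complete obtain u where u: "u \<in> set (trims (remainders (snd S)))" "holds \<rho> (fst u)"
        by blast
      define T where "T = (fst u @ fst S, lower_polys (snd S) @ snd u)"
      have T: "T \<in> set (successors S)" using u by (auto simp: successors_def T_def)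
      from "1.IH"[OF False T] succ[OF u T_def] obtain t where "t \<in> set (cells T)" "holds \<rho> (fst t)"
        by blast
      with T show "\<exists>t\<in>set (cells S). holds \<rho> (fst t)" unfolding cells by auto
    next
      fix t assume t: "t \<in> set (cells S)" "holds \<rho> (fst t)"
      then obtain T v where T: "T \<in> set (successors S)" "v \<in> set (cells T)"
        "t = (fst v, lift_diagram (snd S) (snd v))"
        unfolding cells by auto
      from T(1) obtain u where u: "u \<in> set (trims (remainders (snd S)))"
        "T = (fst u @ fst S, lower_polys (snd S) @ snd u)"
        by (auto simp: successors_def)
      have "holds \<rho> (fst T)" using cells_extends[OF T(2)] t(2) T(3) by simp
      then have "holds \<rho> (fst u)" by (simp add: u(2))
      note s = succ[OF u(1) this u(2)]
      then have "is_diagram \<rho> (snd T) (snd v)"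
        using "1.IH"[OF False T(1)] T(2,3) t(2) by auto
      then show "is_diagram \<rho> (snd S) (snd t)"
        unfolding T(3) snd_conv
        by (intro is_diagram_lift_diagram[where gs = "snd u"]) (use "1.prems"(2) False s in \<open>auto simp: u(2)\<close>)
    qed
  qed
qed

section \<open>Quantifier elimination\<close>

definition mcoeff :: "nat \<Rightarrow> nat \<Rightarrow> mp \<Rightarrow> mp"
  where "mcoeff v i p = map (\<lambda>t. (fst t, filter (\<lambda>w. w \<noteq> v) (snd t)))
    (filter (\<lambda>t. length (filter (\<lambda>w. w = v) (snd t)) = i) p)"

text \<open>The total length of all monomials is a crude bound for the degree in \<open>v\<close>.
  Surplus leading coefficients are empty sums; the cases of \<open>trim\<close> in which one of them
  is nonzero have unsatisfiable conditions.\<close>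

definition ucoeffs :: "nat \<Rightarrow> mp \<Rightarrow> mp list"
  where "ucoeffs v p = map (\<lambda>i. mcoeff v i p) (rev [0..<Suc (sum_list (map (\<lambda>t. length (snd t)) p))])"

lemma hev_map_rev_upt: "hev (map g (rev [0..<n])) x = (\<Sum>i<n. g i * x ^ i)"
  by (induction n) simp_all

lemma meval_fun_upd:
  assumes "\<And>t. t \<in> set p \<Longrightarrow> length (snd t) < n"
  shows "(\<Sum>i<n. meval \<rho> (mcoeff v i p) * x ^ i) = meval (\<rho>(v := x)) p"
  using assms
proof (induction p)
  case (Cons t p)
  define k where "k = length (filter (\<lambda>w. w = v) (snd t))"
  have k: "k < n" using Cons.prems[of t] le_less_trans[OF length_filter_le[of "\<lambda>w. w = v" "snd t"]] by (simp add: k_def)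
  have t: "prod_list (map (\<rho>(v := x)) l) = prod_list (map \<rho> (filter (\<lambda>w. w \<noteq> v) l)) * x ^ length (filter (\<lambda>w. w = v) l)" for l
    by (induction l) auto
  have IH: "(\<Sum>i<n. meval \<rho> (mcoeff v i p) * x ^ i) = meval (\<rho>(v := x)) p"
    by (rule Cons.IH, rule Cons.prems) simp
  have "(\<Sum>i<n. meval \<rho> (mcoeff v i (t # p)) * x ^ i) =
      (\<Sum>i<n. (if i = k then fst t * prod_list (map \<rho> (filter (\<lambda>w. w \<noteq> v) (snd t))) * x ^ k else 0) +
        meval \<rho> (mcoeff v i p) * x ^ i)"
    by (intro sum.cong) (auto simp: mcoeff_def meval_Cons k_def algebra_simps)
  also have "\<dots> = fst t * prod_list (map \<rho> (filter (\<lambda>w. w \<noteq> v) (snd t))) * x ^ k + meval (\<rho>(v := x)) p"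
    unfolding sum.distrib IH using k by simp
  finally show ?case by (simp only: meval_Cons t k_def mult.assoc)
qed (simp add: mcoeff_def)

lemma uev_ucoeffs: "uev \<rho> (ucoeffs v p) x = meval (\<rho>(v := x)) p"
proof -
  have "length (snd t) \<le> sum_list (map (\<lambda>t. length (snd t)) p)" if "t \<in> set p" for t
    using that by (intro member_le_sum_list) auto
  then show ?thesis
    unfolding uev_def ucoeffs_def map_map comp_def hev_map_rev_upt
    by (intro meval_fun_upd) (simp add: le_imp_less_Suc)
qed

text \<open>Formulas are disjunctions of conjunctions of sign conditions.\<close>

type_synonym formula = "(mp \<times> real) list list"

definition sat :: "(nat \<Rightarrow> real) \<Rightarrow> formula \<Rightarrow> bool"
  where "sat \<rho> \<phi> \<longleftrightarrow> (\<exists>cs\<in>set \<phi>. holds \<rho> cs)"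

definition atoms :: "formula \<Rightarrow> mp list"
  where "atoms \<phi> = map fst (concat \<phi>)"

primrec sat_signs :: "formula \<Rightarrow> real list \<Rightarrow> bool" where
  "sat_signs [] ss = False"
| "sat_signs (cs # \<phi>) ss = (map snd cs = take (length cs) ss \<or> sat_signs \<phi> (drop (length cs) ss))"

lemma sat_signs: "sat_signs \<phi> (map (\<lambda>p. sgn (meval \<rho> p)) (atoms \<phi>)) = sat \<rho> \<phi>"
proof (induction \<phi>)
  case (Cons cs \<phi>)
  have "holds \<rho> cs \<longleftrightarrow> map snd cs = map (\<lambda>p. sgn (meval \<rho> p)) (map fst cs)"
    by (induction cs) auto
  with Cons show ?case by (simp add: sat_def atoms_def)
qed (simp add: sat_def atoms_def)

definition case_states :: "nat \<Rightarrow> formula \<Rightarrow> ((mp \<times> real) list \<times> diag) list"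
  where "case_states v \<phi> = concat (map cells (trims (map (ucoeffs v) (atoms \<phi>))))"

definition columns :: "diag \<Rightarrow> real list list"
  where "columns D = fst D # concat (map (\<lambda>PJ. [fst PJ, snd PJ]) (snd D))"

definition elim_ex :: "nat \<Rightarrow> formula \<Rightarrow> formula"
  where "elim_ex v \<phi> = map fst (filter (\<lambda>t. list_ex (sat_signs \<phi>) (columns (snd t))) (case_states v \<phi>))"

text \<open>Negating twice would require restoring the disjunctive normal form. Instead the leaves
  are selected directly: they cover all parameters, and the columns of each satisfied leaf are
  exactly the sign vectors of all points.\<close>

definition elim_all :: "nat \<Rightarrow> formula \<Rightarrow> formula"
  where "elim_all v \<phi> = map fst (filter (\<lambda>t. list_all (sat_signs \<phi>) (columns (snd t))) (case_states v \<phi>))"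

lemma case_states_complete: "\<exists>t\<in>set (case_states v \<phi>). holds \<rho> (fst t)"
proof -
  from trims_complete obtain S where S: "S \<in> set (trims (map (ucoeffs v) (atoms \<phi>)))" "holds \<rho> (fst S)"
    by blast
  with cells_correct[of \<rho> S] trims_sound[OF S] show ?thesis by (auto simp: case_states_def)
qed

lemma case_states_sound:
  assumes "t \<in> set (case_states v \<phi>)" "holds \<rho> (fst t)"
  shows "set (columns (snd t)) = range (\<lambda>x. map (\<lambda>p. sgn (meval (\<rho>(v := x)) p)) (atoms \<phi>))"
proof -
  from assms(1) obtain S where S: "S \<in> set (trims (map (ucoeffs v) (atoms \<phi>)))" "t \<in> set (cells S)"
    by (auto simp: case_states_def)
  from cells_extends[OF S(2) assms(2)] have h: "holds \<rho> (fst S)" .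
  note s = trims_sound[OF S(1) h]
  with cells_correct[OF h] S(2) assms(2) have "is_diagram \<rho> (snd S) (snd t)" by blast
  then have "range (column_of \<rho> (snd S)) = set (columns (snd t))"
    unfolding is_diagram_def columns_def by (intro diagram_values) simp_all
  moreover have "column_of \<rho> (snd S) x = map (\<lambda>p. sgn (meval (\<rho>(v := x)) p)) (atoms \<phi>)" for x
  proof -
    have "column_of \<rho> (snd S) x = map (\<lambda>h. sgn (h x)) (map (\<lambda>q. uev \<rho> (fst q)) (snd S))"
      by (simp add: column_of_def)
    also have "\<dots> = map (\<lambda>p. sgn (meval (\<rho>(v := x)) p)) (atoms \<phi>)"
      using s by (simp add: uev_ucoeffs)
    finally show ?thesis .
  qed
  ultimately show ?thesis by (metis (no_types, lifting) image_cong)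
qed

lemma sat_elim_ex: "sat \<rho> (elim_ex v \<phi>) \<longleftrightarrow> (\<exists>x. sat (\<rho>(v := x)) \<phi>)"
proof -
  have *: "list_ex (sat_signs \<phi>) (columns (snd t)) \<longleftrightarrow> (\<exists>x. sat (\<rho>(v := x)) \<phi>)"
    if "t \<in> set (case_states v \<phi>)" "holds \<rho> (fst t)" for t
    unfolding list_ex_iff case_states_sound[OF that] by (simp add: sat_signs)
  have "sat \<rho> (elim_ex v \<phi>) \<longleftrightarrow> (\<exists>t\<in>set (case_states v \<phi>). holds \<rho> (fst t) \<and> list_ex (sat_signs \<phi>) (columns (snd t)))"
    unfolding sat_def elim_ex_def set_map set_filter by blast
  also have "\<dots> \<longleftrightarrow> (\<exists>x. sat (\<rho>(v := x)) \<phi>)"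
    \<comment> \<open>The right-hand side of \<open>*\<close> does not mention \<open>t\<close>: all
      leaves whose conditions hold at \<rho> agree, and there is at least one.\<close>
    using * case_states_complete by blast
  finally show ?thesis .
qed

lemma sat_elim_all: "sat \<rho> (elim_all v \<phi>) \<longleftrightarrow> (\<forall>x. sat (\<rho>(v := x)) \<phi>)"
proof -
  have *: "list_all (sat_signs \<phi>) (columns (snd t)) \<longleftrightarrow> (\<forall>x. sat (\<rho>(v := x)) \<phi>)"
    if "t \<in> set (case_states v \<phi>)" "holds \<rho> (fst t)" for t
    unfolding list_all_iff case_states_sound[OF that] by (simp add: sat_signs)
  have "sat \<rho> (elim_all v \<phi>) \<longleftrightarrow> (\<exists>t\<in>set (case_states v \<phi>). holds \<rho> (fst t) \<and> list_all (sat_signs \<phi>) (columns (snd t)))"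
    unfolding sat_def elim_all_def set_map set_filter by blast
  also have "\<dots> \<longleftrightarrow> (\<forall>x. sat (\<rho>(v := x)) \<phi>)"
    using * case_states_complete by blast
  finally show ?thesis .
qed

lemma sat_foldr_elim_ex:
  "sat \<rho> (foldr elim_ex vs \<phi>) \<longleftrightarrow> (\<exists>\<rho>'. (\<forall>v. v \<notin> set vs \<longrightarrow> \<rho>' v = \<rho> v) \<and> sat \<rho>' \<phi>)"
proof (induction vs arbitrary: \<rho>)
  case (Cons v vs)
  have "(\<exists>x \<rho>'. (\<forall>w. w \<notin> set vs \<longrightarrow> \<rho>' w = (\<rho>(v := x)) w) \<and> sat \<rho>' \<phi>) \<longleftrightarrow>
      (\<exists>\<rho>'. (\<forall>w. w \<notin> set (v # vs) \<longrightarrow> \<rho>' w = \<rho> w) \<and> sat \<rho>' \<phi>)" (is "?L = ?R")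
  proof
    assume ?R
    then obtain \<rho>' where "\<forall>w. w \<notin> set (v # vs) \<longrightarrow> \<rho>' w = \<rho> w" "sat \<rho>' \<phi>" by blast
    then have "(\<forall>w. w \<notin> set vs \<longrightarrow> \<rho>' w = (\<rho>(v := \<rho>' v)) w) \<and> sat \<rho>' \<phi>" by simp
    then show ?L by blast
  next
    assume ?L
    then obtain x \<rho>' where "\<forall>w. w \<notin> set vs \<longrightarrow> \<rho>' w = (\<rho>(v := x)) w" "sat \<rho>' \<phi>" by blast
    then show ?R by (intro exI[of _ \<rho>']) auto
  qed
  then show ?case by (simp add: sat_elim_ex Cons.IH)
qed (auto simp: fun_eq_iff[symmetric])

lemma sat_foldr_elim_all:
  "sat \<rho> (foldr elim_all vs \<phi>) \<longleftrightarrow> (\<forall>\<rho>'. (\<forall>v. v \<notin> set vs \<longrightarrow> \<rho>' v = \<rho> v) \<longrightarrow> sat \<rho>' \<phi>)"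
proof (induction vs arbitrary: \<rho>)
  case (Cons v vs)
  have "(\<forall>x \<rho>'. (\<forall>w. w \<notin> set vs \<longrightarrow> \<rho>' w = (\<rho>(v := x)) w) \<longrightarrow> sat \<rho>' \<phi>) \<longleftrightarrow>
      (\<forall>\<rho>'. (\<forall>w. w \<notin> set (v # vs) \<longrightarrow> \<rho>' w = \<rho> w) \<longrightarrow> sat \<rho>' \<phi>)" (is "?L = ?R")
  proof
    assume L: ?L
    show ?R
    proof (intro allI impI)
      fix \<rho>' assume "\<forall>w. w \<notin> set (v # vs) \<longrightarrow> \<rho>' w = \<rho> w"
      then have "\<forall>w. w \<notin> set vs \<longrightarrow> \<rho>' w = (\<rho>(v := \<rho>' v)) w" by simp
      with L show "sat \<rho>' \<phi>" by blast
    qed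
  next
    assume R: ?R
    show ?L
    proof (intro allI impI)
      fix x \<rho>' assume "\<forall>w. w \<notin> set vs \<longrightarrow> \<rho>' w = (\<rho>(v := x)) w"
      then have "\<forall>w. w \<notin> set (v # vs) \<longrightarrow> \<rho>' w = \<rho> w" by simp
      with R show "sat \<rho>' \<phi>" by blast
    qed
  qed
  then show ?case by (simp add: sat_elim_all Cons.IH)
qed (auto simp: fun_eq_iff[symmetric])

text \<open>Evaluates a sentence from which all variables have been eliminated. At the zero
  assignment only terms with empty monomial survive, so no assignment has to be represented as
  data.\<close>

definition sat_at_0 :: "formula \<Rightarrow> bool"
  where "sat_at_0 \<phi> = list_ex (list_all (\<lambda>c. sgn (\<Sum>t\<leftarrow>filter (\<lambda>t. length (snd t) = 0) (fst c). fst t) = snd c)) \<phi>"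

lemma sat_at_0: "sat_at_0 \<phi> = sat (\<lambda>_. 0) \<phi>"
proof -
  have "meval (\<lambda>_. 0) p = (\<Sum>t\<leftarrow>filter (\<lambda>t. length (snd t) = 0) p. fst t)" for p
  proof (induction p)
    case (Cons t p)
    then show ?case by (cases "snd t") (auto simp: meval_Cons)
  qed simp
  then show ?thesis
    by (simp add: sat_at_0_def sat_def holds_def list_ex_iff list_all_iff)
qed

section \<open>Computability of the quantifier elimination\<close>

lemma computable_zip [computable_intros]:
  assumes "computable xs" "computable ys"
  shows "computable (\<lambda>x. zip (xs x) (ys x))"
proof -
  define F :: "'b list \<times> 'c list \<Rightarrow> ('b \<times> 'c) list" where "F = (\<lambda>p. zip (fst p) (snd p))"
  have "computable F"
  proof (rule computable_rec)
    show "wf (Wellfounded.measure (\<lambda>p :: 'b list \<times> 'c list. length (fst p)))" by simp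
    \<comment> \<open>The results of the recursive calls arrive as a list with a single member,
      which \<open>concat\<close> extracts; for truth values \<open>list_ex\<close> does this later
      on.\<close>
    show "F p = (if (case fst p of [] \<Rightarrow> True | _ # _ \<Rightarrow> False) then []
        else (\<lambda>q. case fst (fst q) of [] \<Rightarrow> [] | a # as \<Rightarrow> (case snd (fst q) of [] \<Rightarrow> [] | b # bs \<Rightarrow>
            (a, b) # concat (snd q)))
        (p, map F [(tl (fst p), tl (snd p))]))" for p
      by (auto simp: F_def split: list.splits)
  qed (intro computable_intros | (auto split: list.splits)[1])+
  from computable_comp[OF this computable_Pair[OF assms]]
  show ?thesis by (simp add: F_def)
qed

lemma computable_mmul: "computable (\<lambda>z. mmul (fst z) (snd z))"
  unfolding mmul_def by (intro computable_intros)

lemma computable_mscale: "computable (\<lambda>z. mscale (fst z) (snd z))"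
  unfolding mscale_def by (intro computable_intros)

lemmas [computable_intros] = computable_app2[OF computable_mmul] computable_app2[OF computable_mscale]

lemma computable_uderiv: "computable uderiv"
proof -
  have "uderiv p = snd (foldr (\<lambda>a r. (Suc (fst r), if fst r = 0 then [] else mscale (real (fst r)) a # snd r)) p (0, []))" for p
  proof -
    have "foldr (\<lambda>a r. (Suc (fst r), if fst r = 0 then [] else mscale (real (fst r)) a # snd r)) p (0, []) = (length p, uderiv p)"
      by (induction p) auto
    then show ?thesis by simp
  qed
  then have "uderiv = (\<lambda>p. snd (foldr (\<lambda>a r. (Suc (fst r), if fst r = 0 then [] else mscale (real (fst r)) a # snd r)) p (0, [])))" 
    by blast
  moreover have "computable \<dots>" by (intro computable_intros)
  ultimately show ?thesis by simp
qed

lemmas [computable_intros] = computable_comp[OF computable_uderiv]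

lemma computable_combine: "computable (\<lambda>z. combine (fst (fst z)) (snd (fst z)) (fst (snd z)) (snd (snd z)))"
  (is "computable ?F")
proof (rule computable_rec[where F = ?F])
  show "wf (Wellfounded.measure (\<lambda>z :: (mp \<times> mp) \<times> (mp list \<times> mp list). length (fst (snd z))))" by simp
  show "?F z = (if (case fst (snd z) of [] \<Rightarrow> True | _ # _ \<Rightarrow> False) then []
      else (\<lambda>q. case fst (snd (fst q)) of [] \<Rightarrow> [] | x # p \<Rightarrow>
        (case snd (snd (fst q)) of [] \<Rightarrow> mmul (mmul (snd (fst (fst q))) (snd (fst (fst q)))) x
          | y # r \<Rightarrow> mmul (mmul (snd (fst (fst q))) (snd (fst (fst q)))) x @
              mscale (-1) (mmul (mmul (fst (fst (fst q))) (snd (fst (fst q)))) y)) # concat (snd q))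
        (z, map ?F [(fst z, tl (fst (snd z)), tl (snd (snd z)))]))" for z
    by (cases "snd z" rule: prod.exhaust) (auto split: list.splits)
qed (intro computable_intros | (auto split: list.splits)[1])+

lemma computable_combine4 [computable_intros]:
  assumes "computable a" "computable b" "computable p" "computable q"
  shows "computable (\<lambda>x. combine (a x) (b x) (p x) (q x))"
  using computable_comp[OF computable_combine, of "\<lambda>x. ((a x, b x), (p x, q x))"]
  by (simp add: computable_intros assms)

lemma computable_le [computable_intros]:
  fixes f g :: "'a::enc \<Rightarrow> nat"
  assumes "computable f" "computable g"
  shows "computable (\<lambda>x. f x \<le> g x)"
  unfolding not_less[symmetric] by (intro computable_intros assms)

lemma computable_pstep: "computable (\<lambda>z. pstep (fst z) (snd z))"
  unfolding pstep_def by (intro computable_intros)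

lemmas [computable_intros] = computable_app2[OF computable_pstep]

lemma computable_prem: "computable (\<lambda>z. prem (fst z) (snd z))"
  unfolding prem_def by (intro computable_intros)

lemmas [computable_intros] = computable_app2[OF computable_prem]

lemma computable_trim: "computable trim"
proof (rule computable_rec)
  show "wf (Wellfounded.measure (length :: mp list \<Rightarrow> nat))" by simp
  show "trim p = (if (case p of [] \<Rightarrow> True | _ # _ \<Rightarrow> False) then [([], [], 0)]
      else (\<lambda>q. case fst q of [] \<Rightarrow> [] | a # as \<Rightarrow>
        ([(a, 1)], fst q, 1) # ([(a, -1)], fst q, -1) # map (\<lambda>t. ((a, 0) # fst t, snd t)) (concat (snd q)))
      (p, map trim [tl p]))" for p
    by (auto split: list.splits)
qed (intro computable_intros | (auto split: list.splits)[1])+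

lemmas [computable_intros] = computable_comp[OF computable_trim]

lemma computable_trims: "computable trims"
proof -
  have "trims = (\<lambda>ps. foldr (\<lambda>p r. concat (map (\<lambda>t. map (\<lambda>ts. (fst t @ fst ts, snd t # snd ts)) r) (trim p))) ps [([], [])])"
  proof
    show "trims ps = foldr (\<lambda>p r. concat (map (\<lambda>t. map (\<lambda>ts. (fst t @ fst ts, snd t # snd ts)) r) (trim p))) ps [([], [])]" for ps
      by (induction ps) auto
  qed
  moreover have "computable \<dots>" by (intro computable_intros)
  ultimately show ?thesis by simp
qed

lemmas [computable_intros] = computable_comp[OF computable_trims]

lemma computable_max_length: "computable max_length"
proof -
  have "max_length = (\<lambda>qs. foldr (\<lambda>q n. if n < length (fst q) then length (fst q) else n) qs 0)"
    by (simp add: fun_eq_iff max_length_def)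
  moreover have "computable \<dots>" by (intro computable_intros)
  ultimately show ?thesis by simp
qed

lemmas [computable_intros] = computable_comp[OF computable_max_length]

lemma computable_top_index [computable_intros]:
  "computable qs \<Longrightarrow> computable (\<lambda>x. top_index (qs x))"
  by (rule computable_comp[of top_index]) (unfold top_index_def[abs_def], intro computable_intros)

lemma computable_top_poly [computable_intros]:
  "computable qs \<Longrightarrow> computable (\<lambda>x. top_poly (qs x))"
  by (rule computable_comp[of top_poly]) (unfold top_poly_def[abs_def], intro computable_intros)

lemma computable_other_polys [computable_intros]:
  "computable qs \<Longrightarrow> computable (\<lambda>x. other_polys (qs x))"
  by (rule computable_comp[of other_polys]) (unfold other_polys_def[abs_def], intro computable_intros)

lemma computable_lower_polys [computable_intros]:
  "computable qs \<Longrightarrow> computable (\<lambda>x. lower_polys (qs x))"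
  by (rule computable_comp[of lower_polys]) (unfold lower_polys_def[abs_def], intro computable_intros)

lemma computable_remainders [computable_intros]:
  "computable qs \<Longrightarrow> computable (\<lambda>x. remainders (qs x))"
  by (rule computable_comp[of remainders]) (unfold remainders_def[abs_def], intro computable_intros)

lemma computable_successors: "computable successors"
  unfolding successors_def[abs_def] by (intro computable_intros)

lemma computable_zero_sign: "computable (\<lambda>z. zero_sign (fst z) (snd z))"
proof -
  have "computable (\<lambda>z :: (mp list \<times> real) list \<times> real list. list_ex (\<lambda>u. 0 < length (fst (fst u)) \<and> snd u = 0) (zip (fst z) (snd z)))"
    by (intro computable_intros)
  then show ?thesis by (simp add: zero_sign_def)
qed

lemma computable_top_sign: "computable (\<lambda>z. top_sign (fst z) (snd z))"
proof -
  have "computable (\<lambda>z :: (mp list \<times> real) list \<times> real list.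
    foldr (\<lambda>u r. if 0 < length (fst (fst u)) \<and> fst (snd u) = 0 then snd (snd u) else r)
      (zip (fst z) (zip (snd z) (drop (length (fst z)) (snd z)))) 0)"
    by (intro computable_intros)
  then show ?thesis by (simp add: top_sign_def)
qed

lemma computable_move_top: "computable (\<lambda>z. move_top (fst z) (snd z))"
  unfolding move_top_def by (intro computable_intros)

lemma computable_segment: "computable (\<lambda>z. segment (fst z) (fst (snd z)) (snd (snd z)))"
proof -
  have "computable (\<lambda>z :: real \<times> real \<times> real list. if fst z * fst (snd z) < 0
    then (fst z # snd (snd z), [(0 # snd (snd z), fst (snd z) # snd (snd z))])
    else ((if \<not> fst z = 0 then fst z else fst (snd z)) # snd (snd z), []))"
    by (intro computable_intros)
  then show ?thesis by (simp add: segment_def)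
qed

lemmas [computable_intros] =
  computable_app2[OF computable_zero_sign] computable_app2[OF computable_top_sign]
  computable_app2[OF computable_move_top] computable_app3[OF computable_segment]

lemma computable_lift_diagram: "computable (\<lambda>z. lift_diagram (fst z) (snd z))"
  unfolding lift_diagram_def insert_roots_def by (intro computable_intros)

lemmas [computable_intros] = computable_app2[OF computable_lift_diagram]

lemma computable_cells: "computable cells"
proof (rule computable_rec[OF wf_successor_rel])
  show "cells S = (if max_length (snd S) \<le> 1 then [(fst S, map snd (snd S), [])]
    else (\<lambda>z. map (\<lambda>t. (fst t, lift_diagram (snd (fst z)) (snd t))) (concat (snd z)))
      (S, map cells (successors S)))" for S
    by (subst cells.simps) simp
qed (use successors_less in \<open>force intro: computable_successors computable_intros\<close> |
  intro computable_intros computable_successors)+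

lemmas [computable_intros] = computable_comp[OF computable_cells]

lemma computable_ucoeffs: "computable (\<lambda>z. ucoeffs (fst z) (snd z))"
  unfolding ucoeffs_def mcoeff_def by (intro computable_intros)

lemma computable_atoms: "computable atoms"
  unfolding atoms_def[abs_def] by (intro computable_intros)

lemma computable_sat_signs: "computable (\<lambda>z. sat_signs (fst z) (snd z))" (is "computable ?F")
proof (rule computable_rec[where F = ?F])
  show "wf (Wellfounded.measure (\<lambda>z :: formula \<times> real list. length (fst z)))" by simp
  show "?F z = (if (case fst z of [] \<Rightarrow> True | _ # _ \<Rightarrow> False) then False
      else (\<lambda>q. case fst (fst q) of [] \<Rightarrow> False | cs # _ \<Rightarrow>
        map snd cs = take (length cs) (snd (fst q)) \<or> list_ex (\<lambda>b. b) (snd q))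
      (z, map ?F (case fst z of [] \<Rightarrow> [] | cs # \<phi> \<Rightarrow> [(\<phi>, drop (length cs) (snd z))])))" for z
    by (auto split: list.splits)
qed (intro computable_intros | (auto split: list.splits)[1])+

lemmas [computable_intros] =
  computable_app2[OF computable_ucoeffs] computable_comp[OF computable_atoms]
  computable_app2[OF computable_sat_signs]

lemma computable_elim_ex: "computable (\<lambda>z. elim_ex (fst z) (snd z))"
  unfolding elim_ex_def case_states_def columns_def by (intro computable_intros)

lemma computable_elim_all: "computable (\<lambda>z. elim_all (fst z) (snd z))"
  unfolding elim_all_def case_states_def columns_def by (intro computable_intros)

lemma computable_sat_at_0: "computable sat_at_0"
  unfolding sat_at_0_def[abs_def] by (intro computable_intros)

lemmas [computable_intros] =
  computable_app2[OF computable_elim_ex] computable_app2[OF computable_elim_all]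
  computable_comp[OF computable_sat_at_0]

section \<open>Polynomials and differential operators\<close>

definition mono :: "nat list \<Rightarrow> nat \<Rightarrow>\<^sub>0 nat"
  where "mono l = (\<Sum>v\<leftarrow>l. Poly_Mapping.single v 1)"

lemma lookup_mono: "Poly_Mapping.lookup (mono l) v = length (filter (\<lambda>w. w = v) l)"
  by (induction l) (auto simp: mono_def lookup_add lookup_single when_def)

definition to_mpoly :: "mp \<Rightarrow> mpoly"
  where "to_mpoly p = (\<Sum>t\<leftarrow>p. Poly_Mapping.single (mono (snd t)) (fst t))"

lemma to_mpoly_simps [simp]:
  "to_mpoly [] = 0" "to_mpoly (t # p) = Poly_Mapping.single (mono (snd t)) (fst t) + to_mpoly p"
  by (simp_all add: to_mpoly_def)

definition xpow :: "(nat \<Rightarrow>\<^sub>0 nat) \<Rightarrow> (nat \<Rightarrow> real) \<Rightarrow> real"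
  where "xpow \<alpha> x = (\<Prod>i\<in>Poly_Mapping.keys \<alpha>. x i ^ Poly_Mapping.lookup \<alpha> i)"

lemma xpow_superset:
  assumes "finite T" "Poly_Mapping.keys \<alpha> \<subseteq> T"
  shows "xpow \<alpha> x = (\<Prod>i\<in>T. x i ^ Poly_Mapping.lookup \<alpha> i)"
  unfolding xpow_def by (rule prod.mono_neutral_left) (use assms in \<open>auto simp: in_keys_iff\<close>)

lemma xpow_add: "xpow (\<alpha> + \<beta>) x = xpow \<alpha> x * xpow \<beta> x"
proof -
  let ?T = "Poly_Mapping.keys \<alpha> \<union> Poly_Mapping.keys \<beta>"
  have T: "finite ?T" "Poly_Mapping.keys (\<alpha> + \<beta>) \<subseteq> ?T" by (auto simp: keys_add)
  show ?thesis
    by (simp add: xpow_superset[OF T] xpow_superset[of ?T \<alpha>] xpow_superset[of ?T \<beta>]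
        lookup_add power_add prod.distrib)
qed

lemma xpow_mono: "xpow (mono l) x = prod_list (map x l)"
proof (induction l)
  case (Cons v l)
  have "mono (v # l) = Poly_Mapping.single v 1 + mono l" by (simp add: mono_def)
  moreover have "xpow (Poly_Mapping.single v 1) x = x v" by (simp add: xpow_def)
  ultimately show ?case using Cons by (simp add: xpow_add)
qed (simp add: mono_def xpow_def)

lemma mpoly_eval_superset:
  assumes "finite S" "Poly_Mapping.keys V \<subseteq> S"
  shows "mpoly_eval V x = (\<Sum>\<alpha>\<in>S. Poly_Mapping.lookup V \<alpha> * xpow \<alpha> x)"
  unfolding mpoly_eval_def xpow_def[symmetric]
  by (rule sum.mono_neutral_left) (use assms in \<open>auto simp: in_keys_iff\<close>)

lemma mpoly_eval_0 [simp]: "mpoly_eval 0 x = 0"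
  by (simp add: mpoly_eval_def)

lemma mpoly_eval_add: "mpoly_eval (U + V) x = mpoly_eval U x + mpoly_eval V x"
proof -
  let ?T = "Poly_Mapping.keys U \<union> Poly_Mapping.keys V"
  have T: "finite ?T" "Poly_Mapping.keys (U + V) \<subseteq> ?T" by (auto simp: keys_add)
  show ?thesis
    by (simp add: mpoly_eval_superset[OF T] mpoly_eval_superset[of ?T U] mpoly_eval_superset[of ?T V]
        lookup_add ring_distribs sum.distrib)
qed

lemma lookup_scaleR [simp]: "Poly_Mapping.lookup (r *\<^sub>R V :: mpoly) \<alpha> = r * Poly_Mapping.lookup V \<alpha>"
proof -
  have "finite {i. r * Poly_Mapping.lookup V i \<noteq> 0}"
    by (rule finite_subset[OF _ finite_keys[of V]]) (auto simp: in_keys_iff)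
  then show ?thesis by (simp add: scaleR_poly_mapping_def)
qed

lemma mpoly_eval_scaleR: "mpoly_eval (r *\<^sub>R V) x = r * mpoly_eval V x"
proof -
  have "Poly_Mapping.keys (r *\<^sub>R V) \<subseteq> Poly_Mapping.keys V" by (auto simp: in_keys_iff)
  then show ?thesis
    by (simp add: mpoly_eval_superset[of "Poly_Mapping.keys V"] sum_distrib_left mult.assoc)
qed

lemma mpoly_eval_single: "mpoly_eval (Poly_Mapping.single \<alpha> a) x = a * xpow \<alpha> x"
  by (subst mpoly_eval_superset[of "{\<alpha>}"]) auto

lemma mpoly_eval_to_mpoly: "mpoly_eval (to_mpoly p) x = meval x p"
  by (induction p) (simp_all add: mpoly_eval_add mpoly_eval_single xpow_mono meval_Cons)

text \<open>The truncated subtraction in \<open>partial\<close> is harmless: where the exponent of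
  the variable is 0, so is the factor. Linearity and commutation of the derivatives can then be
  checked coefficient by coefficient.\<close>

lemma lookup_partial:
  "Poly_Mapping.lookup (partial i V) \<gamma> =
    real (Poly_Mapping.lookup \<gamma> i + 1) * Poly_Mapping.lookup V (\<gamma> + Poly_Mapping.single i 1)"
proof -
  let ?e = "Poly_Mapping.single i 1 :: nat \<Rightarrow>\<^sub>0 nat"
  have eq: "\<alpha> = \<gamma> + ?e" if "\<alpha> - ?e = \<gamma>" "Poly_Mapping.lookup \<alpha> i \<noteq> 0" for \<alpha>
    using that by (intro poly_mapping_eqI) (auto simp: lookup_add lookup_minus lookup_single when_def)
  have "Poly_Mapping.lookup (partial i V) \<gamma> =
      (\<Sum>\<alpha>\<in>Poly_Mapping.keys V. (real (Poly_Mapping.lookup \<alpha> i) * Poly_Mapping.lookup V \<alpha> when \<alpha> - ?e = \<gamma>))"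
    by (simp add: partial_def lookup_sum lookup_single)
  also have "\<dots> = (\<Sum>\<alpha>\<in>Poly_Mapping.keys V. if \<alpha> = \<gamma> + ?e
      then real (Poly_Mapping.lookup \<gamma> i + 1) * Poly_Mapping.lookup V (\<gamma> + ?e) else 0)"
    using eq by (intro sum.cong) (auto simp: when_def lookup_add)
  also have "\<dots> = real (Poly_Mapping.lookup \<gamma> i + 1) * Poly_Mapping.lookup V (\<gamma> + ?e)"
    by (auto simp: in_keys_iff)
  finally show ?thesis .
qed

lemma partial_add: "partial i (U + V) = partial i U + partial i V"
  by (rule poly_mapping_eqI) (simp add: lookup_partial lookup_add ring_distribs)

lemma partial_0 [simp]: "partial i 0 = 0"
  by (rule poly_mapping_eqI) (simp add: lookup_partial)

lemma partial_commute: "partial i (partial j V) = partial j (partial i V)"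
proof (cases "i = j")
  case False
  then show ?thesis
    by (intro poly_mapping_eqI) (simp add: lookup_partial lookup_add lookup_single when_def ac_simps)
qed simp

lemma partial_single:
  "partial i (Poly_Mapping.single \<alpha> a) =
    Poly_Mapping.single (\<alpha> - Poly_Mapping.single i 1) (real (Poly_Mapping.lookup \<alpha> i) * a)"
  by (cases "a = 0") (simp_all add: partial_def)

definition mpartial :: "nat \<Rightarrow> mp \<Rightarrow> mp"
  where "mpartial i p = map (\<lambda>t. (real (length (filter (\<lambda>w. w = i) (snd t))) * fst t,
    replicate (length (filter (\<lambda>w. w = i) (snd t)) - 1) i @ filter (\<lambda>w. w \<noteq> i) (snd t))) p"

lemma to_mpoly_mpartial: "to_mpoly (mpartial i p) = partial i (to_mpoly p)"
proof (induction p)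
  case (Cons t p)
  define k l where "k = length (filter (\<lambda>w. w = i) (snd t))"
    and "l = replicate (k - 1) i @ filter (\<lambda>w. w \<noteq> i) (snd t)"
  have "mono l = mono (snd t) - Poly_Mapping.single i 1"
    by (intro poly_mapping_eqI) (auto simp: lookup_mono lookup_minus lookup_single when_def l_def k_def
        filter_replicate intro!: arg_cong[of _ _ length] filter_cong)
  then have "Poly_Mapping.single (mono l) (real k * fst t) = partial i (Poly_Mapping.single (mono (snd t)) (fst t))"
    by (simp add: partial_single lookup_mono k_def)
  with Cons show ?case
    by (simp add: mpartial_def partial_add k_def l_def)
qed (simp add: mpartial_def)

definition vars_below :: "nat \<Rightarrow> mp \<Rightarrow> bool"
  where "vars_below m p \<longleftrightarrow> (\<forall>t\<in>set p. set (snd t) \<subseteq> {..<m})"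

lemma vars_below_mpartial: "i < m \<Longrightarrow> vars_below m p \<Longrightarrow> vars_below m (mpartial i p)"
  by (fastforce simp: vars_below_def mpartial_def)

lemma meval_cong:
  assumes "vars_below m p" "\<And>v. v < m \<Longrightarrow> \<rho> v = \<rho>' v"
  shows "meval \<rho> p = meval \<rho>' p"
proof -
  have "map \<rho> (snd t) = map \<rho>' (snd t)" if "t \<in> set p" for t
    using assms that unfolding vars_below_def by (auto simp: subset_iff)
  then show ?thesis by (simp add: meval_def cong: map_cong)
qed

lemma xpow_fun_upd: "xpow \<alpha> (x(i := t * x i)) = t ^ Poly_Mapping.lookup \<alpha> i * xpow \<alpha> x"
proof -
  let ?T = "insert i (Poly_Mapping.keys \<alpha>)"
  have "xpow \<alpha> (x(i := t * x i)) =
      (\<Prod>j\<in>?T. (if j = i then t ^ Poly_Mapping.lookup \<alpha> i else 1) * x j ^ Poly_Mapping.lookup \<alpha> j)"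
    by (subst xpow_superset[of ?T]) (auto intro!: prod.cong simp: power_mult_distrib)
  also have "\<dots> = t ^ Poly_Mapping.lookup \<alpha> i * xpow \<alpha> x"
  proof -
    have "xpow \<alpha> x = (\<Prod>j\<in>?T. x j ^ Poly_Mapping.lookup \<alpha> j)"
      by (rule xpow_superset) auto
    moreover have "(\<Prod>j\<in>?T. if j = i then t ^ Poly_Mapping.lookup \<alpha> i else 1) = t ^ Poly_Mapping.lookup \<alpha> i"
      by (subst prod.delta) auto
    ultimately show ?thesis by (simp only: prod.distrib)
  qed
  finally show ?thesis .
qed

section \<open>A polynomial is determined by its values\<close>

text \<open>
  Scaling the \<open>i\<close>-th coordinate by \<open>t\<close> turns a vanishing sum into a polynomial in \<open>t\<close> that vanishes
  identically, so its parts of fixed degree in the \<open>i\<close>-th variable vanish separately.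
\<close>

lemma sum_xpow_slice:
  fixes a :: "(nat \<Rightarrow>\<^sub>0 nat) \<Rightarrow> real"
  assumes "finite A" "\<And>x. (\<Sum>\<alpha>\<in>A. a \<alpha> * xpow \<alpha> x) = 0"
  shows "(\<Sum>\<alpha>\<in>{\<alpha>\<in>A. Poly_Mapping.lookup \<alpha> i = e}. a \<alpha> * xpow \<alpha> x) = 0"
proof -
  define p where "p = (\<Sum>\<alpha>\<in>A. monom (a \<alpha> * xpow \<alpha> x) (Poly_Mapping.lookup \<alpha> i))"
  have "poly p t = 0" for t
    using assms(2)[of "x(i := t * x i)"]
    by (simp add: p_def poly_sum poly_monom xpow_fun_upd ac_simps)
  then have "p = 0" using poly_all_0_iff_0[of p] by blast
  then have "coeff p e = 0" by simp
  then show ?thesis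
    using assms(1) by (simp add: p_def coeff_sum sum.If_cases Int_def conj_commute)
qed

text \<open>Slicing one variable after the other keeps the sum zero and leaves only the exponents
  that agree with \<beta> on the variables treated so far.\<close>

lemma mpoly_eval_eq_0_imp:
  assumes "\<And>x. mpoly_eval V x = 0"
  shows "V = 0"
proof (rule poly_mapping_eqI)
  fix \<beta>
  let ?K = "Poly_Mapping.keys V"
  have "(\<Sum>\<alpha>\<in>{\<alpha>\<in>?K. \<forall>i\<in>I. Poly_Mapping.lookup \<alpha> i = Poly_Mapping.lookup \<beta> i}.
      Poly_Mapping.lookup V \<alpha> * xpow \<alpha> x) = 0" if "finite I" for I x
    using that
  proof (induction I arbitrary: x)
    case empty
    then show ?case using assms[of x] by (simp add: mpoly_eval_superset[of ?K])
  next
    case (insert j I)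
    have "{\<alpha>\<in>?K. \<forall>i\<in>insert j I. Poly_Mapping.lookup \<alpha> i = Poly_Mapping.lookup \<beta> i} =
        {\<alpha>\<in>{\<alpha>\<in>?K. \<forall>i\<in>I. Poly_Mapping.lookup \<alpha> i = Poly_Mapping.lookup \<beta> i}.
          Poly_Mapping.lookup \<alpha> j = Poly_Mapping.lookup \<beta> j}"
      by auto
    then show ?case
      by (simp only:) (rule sum_xpow_slice[OF _ insert.IH], simp)
  qed
  \<comment> \<open>Once all variables of \<beta> and \<open>V\<close> are treated only \<beta>
    itself can remain, and at the point with all coordinates 1 its term is its coefficient.\<close>
  from this[of "Poly_Mapping.keys \<beta> \<union> (\<Union>\<alpha>\<in>?K. Poly_Mapping.keys \<alpha>)" "\<lambda>_. 1"]
  have "(\<Sum>\<alpha>\<in>{\<alpha>\<in>?K. \<forall>i\<in>Poly_Mapping.keys \<beta> \<union> (\<Union>\<alpha>\<in>?K. Poly_Mapping.keys \<alpha>).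
      Poly_Mapping.lookup \<alpha> i = Poly_Mapping.lookup \<beta> i}. Poly_Mapping.lookup V \<alpha>) = 0"
    by (simp add: xpow_def)
  also have "{\<alpha>\<in>?K. \<forall>i\<in>Poly_Mapping.keys \<beta> \<union> (\<Union>\<alpha>\<in>?K. Poly_Mapping.keys \<alpha>).
      Poly_Mapping.lookup \<alpha> i = Poly_Mapping.lookup \<beta> i} = {\<alpha>\<in>?K. \<alpha> = \<beta>}"
    by (auto intro!: poly_mapping_eqI) (metis UN_I UnI1 UnI2 not_in_keys_iff_lookup_eq_zero)
  also have "(\<Sum>\<alpha>\<in>{\<alpha>\<in>?K. \<alpha> = \<beta>}. Poly_Mapping.lookup V \<alpha>) = Poly_Mapping.lookup V \<beta>"
    by (cases "\<beta> \<in> ?K") (auto simp: in_keys_iff Collect_conv_if conj_commute cong: conj_cong)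
  finally show "Poly_Mapping.lookup V \<beta> = Poly_Mapping.lookup 0 \<beta>" by simp
qed

section \<open>Differential operators and linear combinations of derivatives\<close>

lemma apply_dop_superset:
  assumes "finite S" "Poly_Mapping.keys D \<subseteq> S"
  shows "apply_dop m D V = (\<Sum>\<alpha>\<in>S. Poly_Mapping.lookup D \<alpha> *\<^sub>R iterated_partial m \<alpha> V)"
  unfolding apply_dop_def
  by (rule sum.mono_neutral_left) (use assms in \<open>auto simp: in_keys_iff\<close>)

lemma apply_dop_add: "apply_dop m (D + E) V = apply_dop m D V + apply_dop m E V"
proof -
  let ?T = "Poly_Mapping.keys D \<union> Poly_Mapping.keys E"
  have T: "finite ?T" "Poly_Mapping.keys (D + E) \<subseteq> ?T" by (auto simp: keys_add)
  show ?thesis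
    by (simp add: apply_dop_superset[OF T] apply_dop_superset[of ?T D] apply_dop_superset[of ?T E]
        lookup_add scaleR_left_distrib sum.distrib)
qed

lemma apply_dop_single: "apply_dop m (Poly_Mapping.single \<alpha> r) V = r *\<^sub>R iterated_partial m \<alpha> V"
  by (subst apply_dop_superset[of "{\<alpha>}"]) auto

text \<open>
  Derivatives occur once for each order of differentiation; the repetitions do not affect the span.
\<close>

definition mpartials :: "nat \<Rightarrow> nat \<Rightarrow> mp \<Rightarrow> mp list"
  where "mpartials m k p = ((\<lambda>ps. concat (map (\<lambda>q. map (\<lambda>i. mpartial i q) [0..<m]) ps)) ^^ k) [p]"

lemma mpartials_0 [simp]: "mpartials m 0 p = [p]"
  by (simp add: mpartials_def)

lemma set_mpartials_Suc: "set (mpartials m (Suc k) p) = {mpartial i q |i q. i < m \<and> q \<in> set (mpartials m k p)}"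
  by (auto simp: mpartials_def) blast

lemma vars_below_mpartials: "vars_below m p \<Longrightarrow> q \<in> set (mpartials m k p) \<Longrightarrow> vars_below m q"
proof (induction k arbitrary: q)
  case (Suc k)
  then show ?case by (auto simp: set_mpartials_Suc vars_below_mpartial)
qed simp

lemma iterated_partial_in_mpartials:
  assumes "Poly_Mapping.keys \<alpha> \<subseteq> {..<m}" "(\<Sum>i<m. Poly_Mapping.lookup \<alpha> i) = k"
  shows "\<exists>q\<in>set (mpartials m k p). to_mpoly q = iterated_partial m \<alpha> (to_mpoly p)"
proof -
  have pow: "\<exists>q\<in>set (mpartials m (n + c) p). to_mpoly q = (partial i ^^ c) W"
    if "\<exists>q\<in>set (mpartials m n p). to_mpoly q = W" "i < m" for n c i W
  proof (induction c)
    case (Suc c)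
    then obtain q where "q \<in> set (mpartials m (n + c) p)" "to_mpoly q = (partial i ^^ c) W" by blast
    then show ?case using that(2)
      by (intro bexI[of _ "mpartial i q"]) (auto simp: to_mpoly_mpartial set_mpartials_Suc)
  qed (use that in simp)
  have "j \<le> m \<Longrightarrow> \<exists>q\<in>set (mpartials m (\<Sum>i<j. Poly_Mapping.lookup \<alpha> i) p).
      to_mpoly q = fold (\<lambda>i. partial i ^^ Poly_Mapping.lookup \<alpha> i) [0..<j] (to_mpoly p)" for j
  proof (induction j)
    case (Suc j)
    then show ?case using pow[of _ _ j] by simp
  qed simp
  from this[of m] assms(2) show ?thesis by (simp add: iterated_partial_def)
qed

lemma partial_iterated_partial:
  assumes "i < m"
  shows "partial i (iterated_partial m \<alpha> V) = iterated_partial m (\<alpha> + Poly_Mapping.single i 1) V"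
proof -
  have comm: "(partial j ^^ c) (partial i W) = partial i ((partial j ^^ c) W)" for j c W
    by (induction c) (simp_all add: partial_commute)
  \<comment> \<open>For a prefix of the variables the new derivative is present exactly when its
    index has been passed; it can be moved outside because derivatives commute.\<close>
  have "fold (\<lambda>l. partial l ^^ Poly_Mapping.lookup (\<alpha> + Poly_Mapping.single i 1) l) [0..<j] V =
      (if i < j then partial i (fold (\<lambda>l. partial l ^^ Poly_Mapping.lookup \<alpha> l) [0..<j] V)
        else fold (\<lambda>l. partial l ^^ Poly_Mapping.lookup \<alpha> l) [0..<j] V)" for j
    by (induction j) (auto simp: comm lookup_add lookup_single when_def less_Suc_eq)
  from this[of m] assms show ?thesis by (simp add: iterated_partial_def)
qed

lemma iterated_partial_0 [simp]: "iterated_partial m 0 V = V"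
proof -
  have "fold (\<lambda>i. partial i ^^ 0) xs V = V" for xs by (induction xs) auto
  then show ?thesis by (simp add: iterated_partial_def)
qed

lemma mpartials_is_iterated_partial:
  "q \<in> set (mpartials m k p) \<Longrightarrow> \<exists>\<alpha>. Poly_Mapping.keys \<alpha> \<subseteq> {..<m} \<and>
    (\<Sum>i<m. Poly_Mapping.lookup \<alpha> i) = k \<and> to_mpoly q = iterated_partial m \<alpha> (to_mpoly p)"
proof (induction k arbitrary: q)
  case 0
  then show ?case by (intro exI[of _ 0]) auto
next
  case (Suc k)
  then obtain i r where r: "i < m" "r \<in> set (mpartials m k p)" "q = mpartial i r"
    by (auto simp: set_mpartials_Suc)
  from Suc.IH[OF r(2)] obtain \<alpha> where \<alpha>: "Poly_Mapping.keys \<alpha> \<subseteq> {..<m}"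
    "(\<Sum>i<m. Poly_Mapping.lookup \<alpha> i) = k" "to_mpoly r = iterated_partial m \<alpha> (to_mpoly p)" by blast
  show ?case
  proof (intro exI[of _ "\<alpha> + Poly_Mapping.single i 1"] conjI)
    show "Poly_Mapping.keys (\<alpha> + Poly_Mapping.single i 1) \<subseteq> {..<m}"
      using keys_add[of \<alpha> "Poly_Mapping.single i 1"] \<alpha>(1) r(1) by auto
    show "(\<Sum>j<m. Poly_Mapping.lookup (\<alpha> + Poly_Mapping.single i 1) j) = Suc k"
      using \<alpha>(2) r(1) by (simp add: lookup_add sum.distrib lookup_single when_def)
    show "to_mpoly q = iterated_partial m (\<alpha> + Poly_Mapping.single i 1) (to_mpoly p)"
      by (simp add: r(3) to_mpoly_mpartial \<alpha>(3) partial_iterated_partial[OF r(1)])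
  qed
qed

definition combination :: "(nat \<Rightarrow> real) \<Rightarrow> mp list \<Rightarrow> (nat \<Rightarrow> real) \<Rightarrow> real"
  where "combination c qs x = (\<Sum>j<length qs. c j * meval x (qs ! j))"

lemma mpoly_eval_sum: "mpoly_eval (sum f S) x = (\<Sum>s\<in>S. mpoly_eval (f s) x)"
  by (induction S rule: infinite_finite_induct) (simp_all add: mpoly_eval_add)

lemma apply_dop_is_combination:
  assumes "homogeneous m k D"
  shows "\<exists>c. \<forall>x. mpoly_eval (apply_dop m D (to_mpoly p)) x = combination c (mpartials m k p) x"
proof -
  let ?qs = "mpartials m k p"
  have "\<exists>j<length ?qs. to_mpoly (?qs ! j) = iterated_partial m \<alpha> (to_mpoly p)"
    if "\<alpha> \<in> Poly_Mapping.keys D" for \<alpha>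
    using iterated_partial_in_mpartials[of \<alpha> m k p] that assms
    by (auto simp: homogeneous_def in_set_conv_nth)
  then obtain g where g: "\<And>\<alpha>. \<alpha> \<in> Poly_Mapping.keys D \<Longrightarrow> g \<alpha> < length ?qs \<and>
      to_mpoly (?qs ! g \<alpha>) = iterated_partial m \<alpha> (to_mpoly p)" by metis
  \<comment> \<open>Exponents with the same derivative of \<open>p\<close> may be assigned the same
    entry, so their coefficients are added up.\<close>
  define c where "c = (\<lambda>j. \<Sum>\<alpha>\<in>{\<alpha>\<in>Poly_Mapping.keys D. g \<alpha> = j}. Poly_Mapping.lookup D \<alpha>)"
  have "mpoly_eval (apply_dop m D (to_mpoly p)) x = combination c ?qs x" for x
  proof -
    have "mpoly_eval (apply_dop m D (to_mpoly p)) x =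
        (\<Sum>\<alpha>\<in>Poly_Mapping.keys D. Poly_Mapping.lookup D \<alpha> * meval x (?qs ! g \<alpha>))"
      unfolding apply_dop_def mpoly_eval_sum mpoly_eval_scaleR
      by (intro sum.cong refl) (simp add: g[THEN conjunct2, symmetric] mpoly_eval_to_mpoly)
    also have "\<dots> = (\<Sum>j<length ?qs. \<Sum>\<alpha>\<in>{\<alpha>\<in>Poly_Mapping.keys D. g \<alpha> = j}.
        Poly_Mapping.lookup D \<alpha> * meval x (?qs ! g \<alpha>))"
      by (rule sum.group[symmetric]) (use g in auto)
    also have "\<dots> = combination c ?qs x"
      by (simp add: combination_def c_def sum_distrib_right)
    finally show ?thesis .
  qed
  then show ?thesis by blast
qed

lemma homogeneous_0 [simp]: "homogeneous m k 0"
  by (simp add: homogeneous_def)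

lemma homogeneous_add: "homogeneous m k D \<Longrightarrow> homogeneous m k E \<Longrightarrow> homogeneous m k (D + E)"
  unfolding homogeneous_def using keys_add[of D E] by blast

lemma homogeneous_sum: "(\<And>s. s \<in> S \<Longrightarrow> homogeneous m k (f s)) \<Longrightarrow> homogeneous m k (sum f S)"
  by (induction S rule: infinite_finite_induct) (simp_all add: homogeneous_add)

lemma apply_dop_sum: "apply_dop m (sum f S) V = (\<Sum>s\<in>S. apply_dop m (f s) V)"
  by (induction S rule: infinite_finite_induct) (simp_all add: apply_dop_add, simp_all add: apply_dop_def)

lemma combination_is_apply_dop:
  "\<exists>D. homogeneous m k D \<and>
    (\<forall>x. mpoly_eval (apply_dop m D (to_mpoly p)) x = combination c (mpartials m k p) x)"
proof -
  let ?qs = "mpartials m k p"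
  have "\<exists>\<alpha>. Poly_Mapping.keys \<alpha> \<subseteq> {..<m} \<and> (\<Sum>i<m. Poly_Mapping.lookup \<alpha> i) = k \<and>
      to_mpoly (?qs ! j) = iterated_partial m \<alpha> (to_mpoly p)" if "j < length ?qs" for j
    using mpartials_is_iterated_partial[OF nth_mem[OF that]] .
  then obtain \<alpha> where \<alpha>: "\<And>j. j < length ?qs \<Longrightarrow> Poly_Mapping.keys (\<alpha> j) \<subseteq> {..<m} \<and>
      (\<Sum>i<m. Poly_Mapping.lookup (\<alpha> j) i) = k \<and> to_mpoly (?qs ! j) = iterated_partial m (\<alpha> j) (to_mpoly p)"
    by metis
  define D where "D = (\<Sum>j<length ?qs. Poly_Mapping.single (\<alpha> j) (c j))"
  have "homogeneous m k D"
    unfolding D_def by (intro homogeneous_sum) (use \<alpha> in \<open>auto simp: homogeneous_def\<close>)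
  moreover have "mpoly_eval (apply_dop m D (to_mpoly p)) x = combination c ?qs x" for x
    unfolding D_def apply_dop_sum mpoly_eval_sum combination_def apply_dop_single mpoly_eval_scaleR
    by (intro sum.cong refl) (simp add: \<alpha>[THEN conjunct2, THEN conjunct2, symmetric] mpoly_eval_to_mpoly)
  ultimately show ?thesis by blast
qed

text \<open>Keeping the condition at \<open>x\<close> under the quantifier over \<open>y\<close>
  gives a prenex statement with one quantifier-free matrix, to which the eliminations apply
  directly.\<close>

definition has_definite_combination :: "nat \<Rightarrow> nat \<Rightarrow> mp \<Rightarrow> bool"
  where "has_definite_combination m k p \<longleftrightarrow>
    (\<exists>c x. \<forall>y. combination c (mpartials m k p) x > 0 \<and> combination c (mpartials m k p) y \<ge> 0)"

lemma derivatives_change_sign_iff: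
  "derivatives_change_sign m d (to_mpoly p) \<longleftrightarrow> (\<forall>k<d. \<not> has_definite_combination m k p)"
proof (intro iffI allI impI notI)
  fix k assume ch: "derivatives_change_sign m d (to_mpoly p)" and k: "k < d"
    and "has_definite_combination m k p"
  then obtain c x where c: "\<And>y. combination c (mpartials m k p) x > 0 \<and> combination c (mpartials m k p) y \<ge> 0"
    unfolding has_definite_combination_def by blast
  obtain D where D: "homogeneous m k D"
    "\<And>x. mpoly_eval (apply_dop m D (to_mpoly p)) x = combination c (mpartials m k p) x"
    using combination_is_apply_dop by blast
  have "apply_dop m D (to_mpoly p) \<noteq> 0"
    using D(2)[of x] c[of x] by auto
  with ch k D(1) have "opposite_signs (apply_dop m D (to_mpoly p))"
    by (auto simp: derivatives_change_sign_def)
  with c show False unfolding opposite_signs_def D(2) by (meson not_less)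
next
  assume nd: "\<forall>k<d. \<not> has_definite_combination m k p"
  show "derivatives_change_sign m d (to_mpoly p)"
    unfolding derivatives_change_sign_def
  proof (intro allI impI)
    fix k D assume k: "k < d" and D: "homogeneous m k D" "apply_dop m D (to_mpoly p) \<noteq> 0"
    obtain c where c: "\<And>x. mpoly_eval (apply_dop m D (to_mpoly p)) x = combination c (mpartials m k p) x"
      using apply_dop_is_combination[OF D(1)] by blast
    obtain x where x: "combination c (mpartials m k p) x \<noteq> 0"
      using mpoly_eval_eq_0_imp D(2) c by metis
    have neg: "combination (\<lambda>j. - c j) (mpartials m k p) y = - combination c (mpartials m k p) y" for y
      by (simp add: combination_def sum_negf)
    have "\<exists>y. combination c' (mpartials m k p) y < 0" if "combination c' (mpartials m k p) x > 0" for c'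
      using nd k that unfolding has_definite_combination_def by (meson not_less)
    \<comment> \<open>The first instance serves if the value at \<open>x\<close> is positive, the
      second if it is negative.\<close>
    from this[of c] this[of "\<lambda>j. - c j"] x show "opposite_signs (apply_dop m D (to_mpoly p))"
      unfolding opposite_signs_def c neg by (auto simp: neq_iff)
  qed
qed

section \<open>The decision procedure\<close>

definition generic_combination :: "nat \<Rightarrow> mp list \<Rightarrow> mp"
  where "generic_combination r qs =
    concat (map (\<lambda>u. map (\<lambda>t. (fst t, (r + fst u) # snd t)) (snd u)) (zip [0..<length qs] qs))"

lemma meval_concat: "meval \<rho> (concat ps) = (\<Sum>p\<leftarrow>ps. meval \<rho> p)"
  by (induction ps) simp_all

lemma meval_generic_combination:
  "meval \<rho> (generic_combination r qs) = (\<Sum>j<length qs. \<rho> (r + j) * meval \<rho> (qs ! j))"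
proof -
  have "meval \<rho> (map (\<lambda>t. (fst t, v # snd t)) q) = \<rho> v * meval \<rho> q" for v q
    by (induction q) (simp_all add: meval_Cons algebra_simps)
  then have "meval \<rho> (generic_combination r qs) =
      (\<Sum>u\<leftarrow>zip [0..<length qs] qs. \<rho> (r + fst u) * meval \<rho> (snd u))"
    by (simp add: generic_combination_def meval_concat comp_def)
  also have "\<dots> = (\<Sum>j<length qs. \<rho> (r + j) * meval \<rho> (qs ! j))"
    by (simp add: sum_list_sum_nth atLeast0LessThan)
  finally show ?thesis .
qed

definition shift_vars :: "nat \<Rightarrow> mp \<Rightarrow> mp"
  where "shift_vars m p = map (\<lambda>t. (fst t, map (\<lambda>v. m + v) (snd t))) p"

lemma meval_shift_vars: "meval \<rho> (shift_vars m p) = meval (\<lambda>v. \<rho> (m + v)) p"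
  by (simp add: meval_def shift_vars_def comp_def)

text \<open>
  Variables \<open>0, \<dots>, m - 1\<close> stand for a point \<open>x\<close>, variables \<open>m, \<dots>, 2m - 1\<close> for a point \<open>y\<close>, and the
  variables from \<open>2m\<close> on for the coefficients of a combination of the derivatives.
\<close>

definition definite_formula :: "nat \<Rightarrow> mp list \<Rightarrow> formula"
  where "definite_formula m qs =
    (let P = generic_combination (2 * m) qs; Q = generic_combination (2 * m) (map (shift_vars m) qs)
     in [[(P, 1), (Q, 1)], [(P, 1), (Q, 0)]])"

definition definite_sentence :: "nat \<Rightarrow> mp list \<Rightarrow> bool"
  where "definite_sentence m qs =
    sat_at_0 (foldr elim_ex ([0..<m] @ map (\<lambda>j. 2 * m + j) [0..<length qs])
      (foldr elim_all (map (\<lambda>j. m + j) [0..<m]) (definite_formula m qs)))"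

lemma sat_definite_formula:
  "sat \<rho> (definite_formula m qs) \<longleftrightarrow>
    combination (\<lambda>j. \<rho> (2 * m + j)) qs \<rho> > 0 \<and> combination (\<lambda>j. \<rho> (2 * m + j)) qs (\<lambda>v. \<rho> (m + v)) \<ge> 0"
proof -
  have "sgn a = 1 \<longleftrightarrow> a > 0" "sgn a = 1 \<or> a = 0 \<longleftrightarrow> a \<ge> 0" for a :: real
    by (auto simp: sgn_if)
  then show ?thesis
    by (auto simp: sat_def definite_formula_def Let_def meval_generic_combination meval_shift_vars
        combination_def sgn_zero_iff)
qed

lemma combination_cong:
  assumes "\<And>q. q \<in> set qs \<Longrightarrow> vars_below m q"
    and "\<And>j. j < length qs \<Longrightarrow> c j = c' j" "\<And>v. v < m \<Longrightarrow> x v = x' v"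
  shows "combination c qs x = combination c' qs x'"
  unfolding combination_def
  by (intro sum.cong refl arg_cong2[of _ _ _ _ "(*)"] meval_cong[of m] assms) auto

text \<open>The polynomials involve only variables below \<open>m\<close>, so the three blocks of
  variables do not interfere, and a single assignment encodes \<open>x\<close>, \<open>y\<close> and
  \<open>c\<close> independently.\<close>

lemma definite_sentence_iff:
  assumes vars: "\<And>q. q \<in> set qs \<Longrightarrow> vars_below m q"
  shows "definite_sentence m qs \<longleftrightarrow> (\<exists>c x. \<forall>y. combination c qs x > 0 \<and> combination c qs y \<ge> 0)"
proof -
  define X where "X = set ([0..<m] @ map (\<lambda>j. 2 * m + j) [0..<length qs])"
  define Y where "Y = set (map (\<lambda>j. m + j) [0..<m])"
  have X: "v \<in> X \<longleftrightarrow> v < m \<or> 2 * m \<le> v \<and> v < 2 * m + length qs" for v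
    unfolding X_def by (auto simp: image_iff intro!: exI[of _ "v - 2 * m"] bexI[of _ "v - 2 * m"])
  have Y: "v \<in> Y \<longleftrightarrow> m \<le> v \<and> v < 2 * m" for v
    unfolding Y_def by (auto simp: image_iff intro!: bexI[of _ "v - m"])
  have "definite_sentence m qs \<longleftrightarrow> (\<exists>\<rho>. (\<forall>v. v \<notin> X \<longrightarrow> \<rho> v = 0) \<and>
      (\<forall>\<rho>'. (\<forall>v. v \<notin> Y \<longrightarrow> \<rho>' v = \<rho> v) \<longrightarrow> sat \<rho>' (definite_formula m qs)))"
    unfolding definite_sentence_def sat_at_0 sat_foldr_elim_ex sat_foldr_elim_all X_def Y_def ..
  also have "\<dots> \<longleftrightarrow> (\<exists>c x. \<forall>y. combination c qs x > 0 \<and> combination c qs y \<ge> 0)"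
  proof
    assume "\<exists>\<rho>. (\<forall>v. v \<notin> X \<longrightarrow> \<rho> v = 0) \<and>
      (\<forall>\<rho>'. (\<forall>v. v \<notin> Y \<longrightarrow> \<rho>' v = \<rho> v) \<longrightarrow> sat \<rho>' (definite_formula m qs))"
    then obtain \<rho> where \<rho>: "\<And>\<rho>'. (\<forall>v. v \<notin> Y \<longrightarrow> \<rho>' v = \<rho> v) \<Longrightarrow> sat \<rho>' (definite_formula m qs)"
      by blast
    define c where "c = (\<lambda>j. \<rho> (2 * m + j))"
    have "combination c qs \<rho> > 0 \<and> combination c qs y \<ge> 0" for y
    proof -
      define \<rho>' where "\<rho>' = (\<lambda>v. if v \<in> Y then y (v - m) else \<rho> v)"
      have "sat \<rho>' (definite_formula m qs)" by (rule \<rho>) (simp add: \<rho>'_def)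
      moreover have "combination (\<lambda>j. \<rho>' (2 * m + j)) qs \<rho>' = combination c qs \<rho>"
        by (rule combination_cong[OF vars]) (auto simp: \<rho>'_def c_def Y)
      moreover have "combination (\<lambda>j. \<rho>' (2 * m + j)) qs (\<lambda>v. \<rho>' (m + v)) = combination c qs y"
        by (rule combination_cong[OF vars]) (auto simp: \<rho>'_def c_def Y)
      ultimately show ?thesis by (simp add: sat_definite_formula)
    qed
    then show "\<exists>c x. \<forall>y. combination c qs x > 0 \<and> combination c qs y \<ge> 0" by blast
  next
    assume "\<exists>c x. \<forall>y. combination c qs x > 0 \<and> combination c qs y \<ge> 0"
    then obtain c x where c: "\<And>y. combination c qs x > 0 \<and> combination c qs y \<ge> 0" by blast
    define \<rho> where "\<rho> = (\<lambda>v. if v \<in> X then if v < m then x v else c (v - 2 * m) else 0)"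
    have "sat \<rho>' (definite_formula m qs)" if "\<forall>v. v \<notin> Y \<longrightarrow> \<rho>' v = \<rho> v" for \<rho>'
    proof -
      have "combination (\<lambda>j. \<rho>' (2 * m + j)) qs \<rho>' = combination c qs x"
        by (rule combination_cong[OF vars]) (use that in \<open>auto simp: \<rho>_def X Y\<close>)
      moreover have "combination (\<lambda>j. \<rho>' (2 * m + j)) qs (\<lambda>v. \<rho>' (m + v)) = combination c qs (\<lambda>v. \<rho>' (m + v))"
        by (rule combination_cong[OF vars]) (use that in \<open>auto simp: \<rho>_def X Y\<close>)
      ultimately show ?thesis using c by (simp add: sat_definite_formula)
    qed
    then show "\<exists>\<rho>. (\<forall>v. v \<notin> X \<longrightarrow> \<rho> v = 0) \<and>
        (\<forall>\<rho>'. (\<forall>v. v \<notin> Y \<longrightarrow> \<rho>' v = \<rho> v) \<longrightarrow> sat \<rho>' (definite_formula m qs))"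
      by (intro exI[of _ \<rho>]) (simp add: \<rho>_def)
  qed
  finally show ?thesis .
qed

section \<open>Decoding the input\<close>

definition word :: "nat list \<Rightarrow> nat list"
  where "word \<alpha> = concat (map (\<lambda>u. replicate (snd u) (fst u)) (zip [0..<length \<alpha>] \<alpha>))"

lemma word_snoc: "word (\<alpha> @ [k]) = word \<alpha> @ replicate k (length \<alpha>)"
  by (simp add: word_def)

lemma mono_word: "mono (word \<alpha>) = Poly_Mapping.nth \<alpha>"
proof (rule poly_mapping_eqI)
  show "Poly_Mapping.lookup (mono (word \<alpha>)) v = Poly_Mapping.lookup (Poly_Mapping.nth \<alpha>) v" for v
  proof (induction \<alpha> rule: rev_induct)
    case (snoc k \<alpha>)
    have "v < length \<alpha> \<or> v = length \<alpha> \<or> length \<alpha> < v" by arith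
    with snoc show ?case
      by (auto simp: lookup_mono word_snoc filter_replicate nth_default_def nth_append)
  qed (simp add: word_def mono_def)
qed

lemma set_word: "set (word \<alpha>) \<subseteq> {..<length \<alpha>}"
  by (auto simp: word_def dest: set_zip_leftD)

definition decode :: "(nat list \<times> real) list \<Rightarrow> mp"
  where "decode L = map (\<lambda>u. (snd u, word (fst u))) L"

definition coefficient_list :: "nat \<Rightarrow> nat \<Rightarrow> mpoly \<Rightarrow> (nat list \<times> real) list"
  where "coefficient_list m d V = map (\<lambda>\<alpha>. (\<alpha>, Poly_Mapping.lookup V (Poly_Mapping.nth \<alpha>))) (exponents m d)"

text \<open>Guarantees that decoding counts every coefficient once.\<close>

lemma distinct_exponents: "distinct (exponents m d)"
proof (induction m arbitrary: d)
  case (Suc m)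
  \<comment> \<open>Blocks with different first exponents are disjoint.\<close>
  have concat: "distinct (concat (map f ks))"
    if "distinct ks" "\<And>k. distinct (f k)" "\<And>k xs. xs \<in> set (f k) \<Longrightarrow> hd xs = k"
    for f :: "nat \<Rightarrow> nat list list" and ks
    using that(1) by (induction ks) (auto simp: that(2) dest!: that(3))
  show ?case
    unfolding exponents.simps by (rule concat) (auto simp: distinct_map Suc.IH)
qed simp

lemma vars_below_decode: "vars_below m (decode (coefficient_list m d V))"
proof -
  have "set (word \<alpha>) \<subseteq> {..<m}" if "\<alpha> \<in> set (exponents m d)" for \<alpha>
    using set_word[of \<alpha>] that by (simp add: set_exponents)
  then show ?thesis by (force simp: vars_below_def decode_def coefficient_list_def)
qed

lemma to_mpoly_decode:
  assumes "homogeneous m d V"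
  shows "to_mpoly (decode (coefficient_list m d V)) = V"
proof (rule poly_mapping_eqI)
  fix \<gamma>
  have look: "Poly_Mapping.lookup (to_mpoly p) \<gamma> = (\<Sum>t\<leftarrow>p. fst t when mono (snd t) = \<gamma>)" for p
    by (induction p) (simp_all add: lookup_add lookup_single)
  have "Poly_Mapping.lookup (to_mpoly (decode (coefficient_list m d V))) \<gamma> =
      (\<Sum>\<alpha>\<leftarrow>exponents m d. Poly_Mapping.lookup V \<gamma> when Poly_Mapping.nth \<alpha> = \<gamma>)"
    unfolding look decode_def coefficient_list_def map_map comp_def fst_conv snd_conv mono_word
    by (intro arg_cong[of _ _ sum_list] map_cong refl) (auto simp: when_def)
  also have "\<dots> = (\<Sum>\<alpha>\<in>{\<alpha>. length \<alpha> = m \<and> sum_list \<alpha> = d}. Poly_Mapping.lookup V \<gamma> when Poly_Mapping.nth \<alpha> = \<gamma>)"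
    by (simp add: sum_list_distinct_conv_sum_set distinct_exponents set_exponents)
  also have "\<dots> = Poly_Mapping.lookup V \<gamma>"
  proof (cases "\<gamma> \<in> Poly_Mapping.keys V")
    case True
    with assms have \<gamma>: "Poly_Mapping.keys \<gamma> \<subseteq> {..<m}" "(\<Sum>i<m. Poly_Mapping.lookup \<gamma> i) = d"
      by (auto simp: homogeneous_def)
    \<comment> \<open>The only entry of the list that decodes to \<gamma>:
      \<open>Poly_Mapping.nth\<close> forgets trailing zeros, but the length is fixed as
      \<open>m\<close>.\<close>
    define \<alpha> where "\<alpha> = map (Poly_Mapping.lookup \<gamma>) [0..<m]"
    have "(\<beta> :: nat list) = \<alpha>" if "length \<beta> = m" "Poly_Mapping.nth \<beta> = \<gamma>" for \<beta>
    proof (rule nth_equalityI)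
      fix i assume "i < length \<beta>"
      then show "\<beta> ! i = \<alpha> ! i"
        using that by (auto simp: \<alpha>_def nth_default_def)
    qed (simp add: \<alpha>_def that)
    moreover have "Poly_Mapping.nth \<alpha> = \<gamma>"
      using \<gamma>(1) by (intro poly_mapping_eqI) (auto simp: \<alpha>_def nth_default_def in_keys_iff subset_iff)
    moreover have "length \<alpha> = m \<and> sum_list \<alpha> = d"
      using \<gamma>(2) by (simp add: \<alpha>_def interv_sum_list_conv_sum_set_nat atLeast0LessThan)
    ultimately have "(\<Sum>\<alpha>\<in>{\<alpha>. length \<alpha> = m \<and> sum_list \<alpha> = d}. Poly_Mapping.lookup V \<gamma> when Poly_Mapping.nth \<alpha> = \<gamma>) =
        (\<Sum>\<beta>\<in>{\<beta>. length \<beta> = m \<and> sum_list \<beta> = d}. if \<beta> = \<alpha> then Poly_Mapping.lookup V \<gamma> else 0)"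
      by (intro sum.cong) (auto simp: when_def)
    also have "\<dots> = Poly_Mapping.lookup V \<gamma>"
      using \<open>length \<alpha> = m \<and> sum_list \<alpha> = d\<close> finite_set[of "exponents m d"]
      by (subst sum.delta) (simp_all add: set_exponents)
    finally show ?thesis .
  qed (simp add: in_keys_iff)
  finally show "Poly_Mapping.lookup (to_mpoly (decode (coefficient_list m d V))) \<gamma> = Poly_Mapping.lookup V \<gamma>" .
qed

section \<open>The decision procedure as a program\<close>

definition decider :: "nat \<times> nat \<times> (nat list \<times> real) list \<Rightarrow> bool"
  where "decider z = list_all (\<lambda>k. \<not> definite_sentence (fst z) (mpartials (fst z) k (decode (snd (snd z)))))
    [0..<fst (snd z)]"

lemma decider_correct:
  assumes "homogeneous m d V"
  shows "decider (m, d, coefficient_list m d V) \<longleftrightarrow> derivatives_change_sign m d V"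
proof -
  let ?p = "decode (coefficient_list m d V)"
  have "definite_sentence m (mpartials m k ?p) = has_definite_combination m k ?p" for k
    unfolding has_definite_combination_def
    by (rule definite_sentence_iff) (rule vars_below_mpartials[OF vars_below_decode])
  then show ?thesis
    using derivatives_change_sign_iff[of m d ?p] by (simp add: to_mpoly_decode[OF assms] decider_def list_all_iff Ball_def)
qed

lemma computable_generic_combination: "computable (\<lambda>z. generic_combination (fst z) (snd z))"
  unfolding generic_combination_def by (intro computable_intros)

lemma computable_shift_vars: "computable (\<lambda>z. shift_vars (fst z) (snd z))"
  unfolding shift_vars_def by (intro computable_intros)

lemma computable_mpartial: "computable (\<lambda>z. mpartial (fst z) (snd z))"
  unfolding mpartial_def by (intro computable_intros)

lemmas [computable_intros] = computable_app2[OF computable_generic_combination]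
  computable_app2[OF computable_shift_vars] computable_app2[OF computable_mpartial]

lemma computable_mpartials: "computable (\<lambda>z. mpartials (fst z) (fst (snd z)) (snd (snd z)))"
  unfolding mpartials_def by (intro computable_intros)

lemma computable_definite_sentence: "computable (\<lambda>z. definite_sentence (fst z) (snd z))"
  unfolding definite_sentence_def definite_formula_def mult_2 by (intro computable_intros)

lemma computable_decode: "computable decode"
  unfolding decode_def[abs_def] word_def by (intro computable_intros)

lemmas [computable_intros] = computable_app3[OF computable_mpartials]
  computable_app2[OF computable_definite_sentence] computable_comp[OF computable_decode]

lemma computable_decider: "computable decider"
  unfolding decider_def[abs_def] by (intro computable_intros)

lemma enc_input: "encode_input m d V = enc (m, d, coefficient_list m d V)"
proof -
  have "encode_nat = enc" by (simp add: fun_eq_iff encode_nat_def enc_nat_def)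
  then show ?thesis
    by (simp add: encode_input_def coefficient_list_def enc_real_def enc_list_def encode_list_def comp_def)
qed

lemma algorithmically_verifiable_homogeneous:
  "algorithmically_verifiable {(m, d, V). homogeneous m d V} derivatives_change_sign"
proof -
  \<comment> \<open>The main procedure must stand at position 0, so its auxiliary procedures are
    placed after a prefix of length 1.\<close>
  from computable_decider obtain \<Delta> e where \<Delta>: "\<And>\<Delta>\<^sub>0 \<Delta>\<^sub>2 x. length \<Delta>\<^sub>0 = 1 \<Longrightarrow>
      run (\<Delta>\<^sub>0 @ \<Delta> @ \<Delta>\<^sub>2) e (enc x) (enc (decider x))"
    unfolding computable_def by meson
  have "run (e # \<Delta>) (Call 0 Arg) (encode_input m d V) (Num (if derivatives_change_sign m d V then 1 else 0))"
    if "homogeneous m d V" for m d V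
  proof (rule run_Call[OF run_Arg])
    show "run (e # \<Delta>) ((e # \<Delta>) ! 0) (encode_input m d V) (Num (if derivatives_change_sign m d V then 1 else 0))"
      using \<Delta>[of "[e]" "[]" "(m, d, coefficient_list m d V)"]
      unfolding decider_correct[OF that] enc_input[symmetric] by (simp add: enc_bool_def)
  qed simp
  then show ?thesis
    unfolding algorithmically_verifiable_def by (intro exI[of _ "e # \<Delta>"]) auto
qed

section \<open>Homogeneity of the volume polynomial\<close>

lemma homogeneous_mult:
  assumes "homogeneous m a U" "homogeneous m b V"
  shows "homogeneous m (a + b) (U * V)"
  unfolding homogeneous_def
proof
  fix \<gamma> assume "\<gamma> \<in> Poly_Mapping.keys (U * V)"
  then obtain \<alpha> \<beta> where \<alpha>\<beta>: "\<alpha> \<in> Poly_Mapping.keys U" "\<beta> \<in> Poly_Mapping.keys V" "\<gamma> = \<alpha> + \<beta>"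
    using keys_mult[of U V] by blast
  with assms show "Poly_Mapping.keys \<gamma> \<subseteq> {..<m} \<and> (\<Sum>i<m. Poly_Mapping.lookup \<gamma> i) = a + b"
    using keys_add[of \<alpha> \<beta>] by (fastforce simp: homogeneous_def lookup_add sum.distrib)
qed

lemma homogeneous_of_int: "homogeneous m 0 (of_int k)"
proof -
  have "(of_int k :: mpoly) = Poly_Mapping.single 0 (of_int k)" by simp
  then show ?thesis
    by (simp only: homogeneous_def) (auto simp del: single_of_int)
qed

lemma homogeneous_mvar: "i < m \<Longrightarrow> homogeneous m 1 (mvar i)"
  by (auto simp: homogeneous_def mvar_def lookup_single when_def)

lemma homogeneous_cup_power2:
  assumes "\<And>\<sigma>. homogeneous m 1 (\<phi> \<sigma>)"
  shows "homogeneous m k (cup_power2 k \<phi> \<sigma>)"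
proof (induction k arbitrary: \<sigma>)
  case 0
  then show ?case using homogeneous_of_int[of m 1] by simp
next
  case (Suc k)
  from homogeneous_mult[OF Suc.IH assms] show ?case by (simp add: cup_def)
qed

text \<open>Every value of the cup power is a product of \<open>n\<close> linear forms, and
  evaluation on a chain takes integral combinations of these values.\<close>

lemma volume_polynomial_homogeneous:
  assumes "volume_polynomial n m P F \<Lambda> V"
  shows "homogeneous m n V"
proof -
  from assms obtain z :: "qpoint chain" and \<xi> :: "nat \<Rightarrow> (qpoint, int) cochain" where V: "V = (1 / fact n) *\<^sub>R
      cochain_eval (cup_power2 n (\<lambda>\<sigma>. \<Sum>i<m. mvar i * of_int (\<xi> i \<sigma>))) z"
    unfolding volume_polynomial_def by (elim exE conjE) (rule that)
  have "homogeneous m 1 (\<Sum>i<m. mvar i * of_int (\<xi> i \<sigma>))" for \<sigma>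
    using homogeneous_mult[OF homogeneous_mvar homogeneous_of_int, of _ m] by (intro homogeneous_sum) auto
  note power = homogeneous_cup_power2[OF this, of n]
  have "homogeneous m n (cochain_eval (cup_power2 n (\<lambda>\<sigma>. \<Sum>i<m. mvar i * of_int (\<xi> i \<sigma>))) z)"
    unfolding cochain_eval_def
    using homogeneous_mult[OF homogeneous_of_int power] by (intro homogeneous_sum) simp
  then show ?thesis
    by (auto simp: V homogeneous_def in_keys_iff)
qed

theorem corollary6p7:
  "algorithmically_verifiable {(m, d, V). homogeneous m d V} derivatives_change_sign \<and>
   algorithmically_verifiable
     {(m, n, V). \<exists>P F \<Lambda>. quasitoric n m P F \<Lambda> \<and> volume_polynomial n m P F \<Lambda> V}
     derivatives_change_sign"
proof
  show *: "algorithmically_verifiable {(m, d, V). homogeneous m d V} derivatives_change_sign"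
    by (rule algorithmically_verifiable_homogeneous)
  show "algorithmically_verifiable
     {(m, n, V). \<exists>P F \<Lambda>. quasitoric n m P F \<Lambda> \<and> volume_polynomial n m P F \<Lambda> V}
     derivatives_change_sign"
    \<comment> \<open>The same program works, as these inputs are among the homogeneous
      polynomials.\<close>
    using * volume_polynomial_homogeneous unfolding algorithmically_verifiable_def by fast
qed

end
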